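(* Let $w$ be an annular web of degree $n$, and let $I$ be a radial cut of $w$ with initial thickness $t(I)$. Then for $1\le k\le n$ the coefficient of the hook Schur function $s_{(k,1^{n-k})}$ in the web LLT function $\mathrm{LLT}_w$ is $$[s_{(k,1^{n-k})}]\mathrm{LLT}_w=\frac1{[t(I)]!}\sum_{\mathcal L\in\mathrm{SLD}(w,I)}\ \sum_{T\in\mathrm{SYT}(k,1^{n-k})}q^{\mathrm{inv}_{\mathcal L}(T)}.$$
   Context: **Annular webs.** Let $\mathbb A=[0,1]\times[0,1]/\big((x,0)\sim(x,1)\big)$ be the annulus; left/right refer to the first coordinate, upward to the second. An annular web $w$ is a finite trivalent graph embedded in $\mathbb A$ (vertex-free essential circles are allowed as edges), all of whose edges are oriented upward (the second coordinate increases along each edge), together with a thickness $t(e)\in\mathbb Z_{>0}$ for each edge $e$, such that at every vertex the total incoming thickness equals the total outgoing thickness. Every vertex is a merge (two incoming edges, one outgoing) or a split (one incoming, two outgoing). The degree $\deg(w)$ is $\sum t(e)$ over the edges crossed by any radial (horizontal) segment transverse to $w$ and avoiding vertices. **Radial cut, labeled loop decompositions.** A radial cut $I$ is a radial (horizontal) segment across $\mathbb A$ transverse to $w$ and disjoint from its vertices. Let $e_1,\dots,e_r$ be the edges meeting $I$, from left to right; the initial thickness is $t(I)=(t(e_1),\dots,t(e_r))$. For a composition $\alpha=(\alpha_1,\dots,\alpha_r)$, $[\alpha]!=[\alpha_1]!\cdots[\alpha_r]!$ with $[k]!=[1]\cdots[k]$ and $[k]=\frac{q^k-q^{-k}}{q-q^{-1}}$.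 Let $B_j=\{t(e_1)+\cdots+t(e_{j-1})+1,\dots,t(e_1)+\cdots+t(e_j)\}\subset[n]=\{1,\dots,n\}$. A standard labeled loop decomposition of $(w,I)$ is a map $\mathcal L$ from edges of $w$ to subsets of $[n]$ with (1) $\mathcal L(e_j)=B_j$ for all $j$; (2) $|\mathcal L(e)|=t(e)$ for all $e$; (3) at every merge or split, the label set of the single edge on one side is the disjoint union of the label sets of the two edges on the other side. $\mathrm{SLD}(w,I)$ is the set of these. For $u\in[n]$, $L_u$ is the loop formed by the edges whose label set contains $u$. **Web LLT function.** For $\mathcal L\in\mathrm{SLD}(w,I)$, the multiset $\mathsf A_I(\mathcal L)$ of ordered attacking pairs consists of: one pair $(u,v)$ for each block $B_j$ and each $u<v$ in $B_j$; and, for each merge, one pair $(u,v)$ whenever $L_u$ enters the merge from the left and $L_v$ from the right (all counted with multiplicity). For an arbitrary map $\sigma:[n]\to\mathbb Z_{>0}$ put $\epsilon_\sigma(u,v)=+1$ if $\sigma(v)>\sigma(u)$, or $\sigma(v)=\sigma(u)$ and $v<u$; and $\epsilon_\sigma(u,v)=-1$ otherwise. Put $\mathrm{inv}_{\mathcal L}(\sigma)=\sum_{(u,v)\in\mathsf A_I(\mathcal L)}\epsilon_\sigma(u,v)$ and $x^\sigma=\prod_{u=1}^nx_{\sigma(u)}$. The web LLT function of $w$ relative to $I$ is $$\mathrm{LLT}_{w,I}[\mathbf x;q]=\frac1{[t(I)]!}\sum_{\mathcal L\in\mathrm{SLD}(w,I)}\ \sum_{\sigma:[n]\to\mathbb Z_{>0}}q^{\mathrm{inv}_{\mathcal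 L}(\sigma)}x^\sigma .$$ It is a symmetric function over $\mathbb Q(q)$, homogeneous of degree $n$, and does not depend on the choice of $I$ (this is established separately); it is denoted $\mathrm{LLT}_w$. **Tableaux.** $\mathrm{SYT}(k,1^{n-k})$ is the set of standard Young tableaux of shape $(k,1^{n-k})$ (entries $1,\dots,n$, increasing left to right along rows and top to bottom along columns, first row of length $k$). For such a tableau $T$, $\mathrm{inv}_{\mathcal L}(T):=\mathrm{inv}_{\mathcal L}(\sigma_T)$, where $\sigma_T(u)=i$ if $u$ lies in the $i$-th row of $T$. *)

theory Defs
  imports
    "HOL-Analysis.Analysis"
    "HOL-Library.Multiset"
    "HOL-Library.FuncSet"
    "HOL-Computational_Algebra.Polynomial"
    "HOL-Computational_Algebra.Fraction_Field"
begin

type_synonym ratfun = "rat poly fract"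

definition qvar :: ratfun where
  "qvar = Fract [:0, 1:] 1"

definition qint :: "nat \<Rightarrow> ratfun" where
  "qint k = (qvar powi int k - qvar powi (- int k)) / (qvar - qvar powi (- 1))"

definition qfact :: "nat \<Rightarrow> ratfun" where
  "qfact k = (\<Prod>i=1..k. qint i)"

definition qfact_comp :: "nat list \<Rightarrow> ratfun" where
  "qfact_comp \<alpha> = prod_list (map qfact \<alpha>)"

text \<open>
  A point of the annulus \<open>[0,1] \<times> [0,1] / ((x,0) ~ (x,1))\<close> is represented by its unique
  representative in \<open>[0,1] \<times> [0,1)\<close>, so that \<open>(x, frac y)\<close> is the image of the point
  \<open>(x, y)\<close> of the universal cover \<open>[0,1] \<times> \<real>\<close>.

  Since the second coordinate increases strictly along every edge, an edge \<open>e\<close> lifted to the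
  universal cover is parametrised by height: it is the curve \<open>y \<mapsto> (xpos e y, y)\<close> for
  \<open>low e \<le> y \<le> high e\<close>, traversed in its upward orientation. An edge is allowed to run around
  the annulus, so \<open>high e - low e\<close> is not bounded a priori. An edge whose initial point is not a
  vertex is a vertex-free circle; it is cut open at an arbitrary base point.
\<close>

definition annulus :: "(real \<times> real) set" where
  "annulus = {0..1} \<times> {0..<1}"

record 'e web =
  vertices :: "(real \<times> real) set"
  edges :: "'e set"
  thickness :: "'e \<Rightarrow> nat"
  low :: "'e \<Rightarrow> real"
  high :: "'e \<Rightarrow> real"
  xpos :: "'e \<Rightarrow> real \<Rightarrow> real"

definition edge_point :: "'e web \<Rightarrow> 'e \<Rightarrow> real \<Rightarrow> real \<times> real" where
  "edge_point w e y = (xpos w e y, frac y)"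

definition tail :: "'e web \<Rightarrow> 'e \<Rightarrow> real \<times> real" where
  "tail w e = edge_point w e (low w e)"

definition head :: "'e web \<Rightarrow> 'e \<Rightarrow> real \<times> real" where
  "head w e = edge_point w e (high w e)"

text \<open>
  The lifted heights of the points of an edge that are not vertices, each point taken once:
  for a circle the base point is kept at one of the two ends.
\<close>

definition edge_dom :: "'e web \<Rightarrow> 'e \<Rightarrow> real set" where
  "edge_dom w e = (if tail w e \<in> vertices w then {low w e<..<high w e} else {low w e..<high w e})"

definition in_edges :: "'e web \<Rightarrow> real \<times> real \<Rightarrow> 'e set" where
  "in_edges w v = {e \<in> edges w. head w e = v}"

definition out_edges :: "'e web \<Rightarrow> real \<times> real \<Rightarrow> 'e set" where
  "out_edges w v = {e \<in> edges w. tail w e = v}"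

definition merges :: "'e web \<Rightarrow> (real \<times> real) set" where
  "merges w = {v \<in> vertices w. card (in_edges w v) = 2 \<and> card (out_edges w v) = 1}"

definition splits :: "'e web \<Rightarrow> (real \<times> real) set" where
  "splits w = {v \<in> vertices w. card (in_edges w v) = 1 \<and> card (out_edges w v) = 2}"

locale annular_web =
  fixes w :: "'e web"
  assumes finite_vertices: "finite (vertices w)"
    and finite_edges: "finite (edges w)"
    and vertices_annulus: "vertices w \<subseteq> annulus"
    and edge_upward: "e \<in> edges w \<Longrightarrow> low w e < high w e"
    and edge_continuous: "e \<in> edges w \<Longrightarrow> continuous_on {low w e..high w e} (xpos w e)"
    and edge_annulus: "e \<in> edges w \<Longrightarrow> y \<in> {low w e..high w e} \<Longrightarrow> edge_point w e y \<in> annulus"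
    and edge_ends: "e \<in> edges w \<Longrightarrow>
      (tail w e \<in> vertices w \<and> head w e \<in> vertices w) \<or>
      (tail w e \<notin> vertices w \<and> head w e = tail w e)"
    and edges_embedded:
      "inj_on (\<lambda>(e, y). edge_point w e y) (SIGMA e : edges w. edge_dom w e)"
    and edges_avoid_vertices:
      "e \<in> edges w \<Longrightarrow> y \<in> edge_dom w e \<Longrightarrow> edge_point w e y \<notin> vertices w"
    and vertex_trivalent: "v \<in> vertices w \<Longrightarrow> v \<in> merges w \<or> v \<in> splits w"
    and thickness_pos: "e \<in> edges w \<Longrightarrow> thickness w e > 0"
    and thickness_balance: "v \<in> vertices w \<Longrightarrow>
      (\<Sum>e\<in>in_edges w v. thickness w e) = (\<Sum>e\<in>out_edges w v. thickness w e)"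

text \<open>
  The two edges entering a merge, compared by their horizontal positions at heights just below it.
\<close>

definition enters_left_of :: "'e web \<Rightarrow> 'e \<Rightarrow> 'e \<Rightarrow> bool" where
  "enters_left_of w a b \<longleftrightarrow>
     (\<forall>\<^sub>F h in at_right 0. xpos w a (high w a - h) < xpos w b (high w b - h))"

definition left_in :: "'e web \<Rightarrow> real \<times> real \<Rightarrow> 'e" where
  "left_in w v = (THE a. \<exists>b. in_edges w v = {a, b} \<and> enters_left_of w a b)"

definition right_in :: "'e web \<Rightarrow> real \<times> real \<Rightarrow> 'e" where
  "right_in w v = (THE b. \<exists>a. in_edges w v = {a, b} \<and> enters_left_of w a b)"

text \<open>
  A radial segment is given by its height \<open>c\<close>. Because edges are graphs over the height
  coordinate, every radial segment that avoids the vertices is crossed transversely.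
\<close>

definition radial_cut :: "'e web \<Rightarrow> real \<Rightarrow> bool" where
  "radial_cut w c \<longleftrightarrow> c \<in> {0..<1} \<and> (\<forall>v\<in>vertices w. snd v \<noteq> c)"

definition cut_positions :: "'e web \<Rightarrow> real \<Rightarrow> real set" where
  "cut_positions w c = {x. \<exists>e\<in>edges w. \<exists>y\<in>edge_dom w e. edge_point w e y = (x, c)}"

definition edge_at :: "'e web \<Rightarrow> real \<times> real \<Rightarrow> 'e" where
  "edge_at w p = (THE e. e \<in> edges w \<and> (\<exists>y\<in>edge_dom w e. edge_point w e y = p))"

definition cut_edges :: "'e web \<Rightarrow> real \<Rightarrow> 'e list" where
  "cut_edges w c = map (\<lambda>x. edge_at w (x, c)) (sorted_list_of_set (cut_positions w c))"

definition cut_thickness :: "'e web \<Rightarrow> real \<Rightarrow> nat list" where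
  "cut_thickness w c = map (thickness w) (cut_edges w c)"

definition has_degree :: "'e web \<Rightarrow> nat \<Rightarrow> bool" where
  "has_degree w n \<longleftrightarrow> (\<forall>c. radial_cut w c \<longrightarrow> sum_list (cut_thickness w c) = n)"

text \<open>Lists are indexed from 0, so \<open>block \<alpha> j\<close> is the block \<open>B\<close> with index \<open>j + 1\<close>.\<close>

definition block :: "nat list \<Rightarrow> nat \<Rightarrow> nat set" where
  "block \<alpha> j = {sum_list (take j \<alpha>) + 1 .. sum_list (take (Suc j) \<alpha>)}"

definition labels :: "'e web \<Rightarrow> real \<Rightarrow> nat set" where
  "labels w c = {1..sum_list (cut_thickness w c)}"

definition SLD :: "'e web \<Rightarrow> real \<Rightarrow> ('e \<Rightarrow> nat set) set" where
  "SLD w c = {L \<in> edges w \<rightarrow>\<^sub>E Pow (labels w c).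
     (\<forall>j<length (cut_edges w c). L (cut_edges w c ! j) = block (cut_thickness w c) j) \<and>
     (\<forall>e\<in>edges w. card (L e) = thickness w e) \<and>
     (\<forall>v\<in>vertices w. \<forall>e a b. a \<noteq> b \<and>
        (in_edges w v = {a, b} \<and> out_edges w v = {e} \<or>
         in_edges w v = {e} \<and> out_edges w v = {a, b}) \<longrightarrow>
        L e = L a \<union> L b \<and> L a \<inter> L b = {})}"

definition loop :: "'e web \<Rightarrow> ('e \<Rightarrow> nat set) \<Rightarrow> nat \<Rightarrow> 'e set" where
  "loop w L u = {e \<in> edges w. u \<in> L e}"

definition attacking_pairs :: "'e web \<Rightarrow> real \<Rightarrow> ('e \<Rightarrow> nat set) \<Rightarrow> (nat \<times> nat) multiset" where
  "attacking_pairs w c L =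
     (\<Sum>j<length (cut_thickness w c).
        mset_set {(u, v). u \<in> block (cut_thickness w c) j \<and> v \<in> block (cut_thickness w c) j \<and> u < v}) +
     (\<Sum>p\<in>merges w. mset_set {(u, v). left_in w p \<in> loop w L u \<and> right_in w p \<in> loop w L v})"

definition eps :: "(nat \<Rightarrow> nat) \<Rightarrow> nat \<Rightarrow> nat \<Rightarrow> int" where
  "eps \<sigma> u v = (if \<sigma> v > \<sigma> u \<or> (\<sigma> v = \<sigma> u \<and> v < u) then 1 else -1)"

definition web_inv :: "'e web \<Rightarrow> real \<Rightarrow> ('e \<Rightarrow> nat set) \<Rightarrow> (nat \<Rightarrow> nat) \<Rightarrow> int" where
  "web_inv w c L \<sigma> = (\<Sum>(u, v)\<in>#attacking_pairs w c L. eps \<sigma> u v)"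

text \<open>
  A formal power series in \<open>x\<^sub>1, x\<^sub>2, \<dots>\<close> is the function that assigns to each monomial its
  coefficient; the monomial \<open>x\<^sub>a x\<^sub>b \<cdots>\<close> is the multiset \<open>{#a, b, \<dots>#}\<close> of its indices.
\<close>

type_synonym series = "nat multiset \<Rightarrow> ratfun"

definition web_LLT :: "'e web \<Rightarrow> real \<Rightarrow> series" where
  "web_LLT w c M = 1 / qfact_comp (cut_thickness w c) *
     (\<Sum>L\<in>SLD w c.
        \<Sum>\<sigma> \<in> {\<sigma> \<in> labels w c \<rightarrow>\<^sub>E {0<..}. image_mset \<sigma> (mset_set (labels w c)) = M}.
          qvar powi web_inv w c L \<sigma>)"

definition is_partition :: "nat list \<Rightarrow> bool" where
  "is_partition lam \<longleftrightarrow> sorted_wrt (\<ge>) lam \<and> 0 \<notin> set lam"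

text \<open>Cells are (row, column), both counted from 1, in English notation.\<close>

definition diagram :: "nat list \<Rightarrow> (nat \<times> nat) set" where
  "diagram lam = {(i, j). 1 \<le> i \<and> i \<le> length lam \<and> 1 \<le> j \<and> j \<le> lam ! (i - 1)}"

definition SSYT :: "nat list \<Rightarrow> (nat \<times> nat \<Rightarrow> nat) set" where
  "SSYT lam = {T \<in> diagram lam \<rightarrow>\<^sub>E {0<..}.
     (\<forall>i j j'. (i, j) \<in> diagram lam \<and> (i, j') \<in> diagram lam \<and> j < j' \<longrightarrow> T (i, j) \<le> T (i, j')) \<and>
     (\<forall>i i' j. (i, j) \<in> diagram lam \<and> (i', j) \<in> diagram lam \<and> i < i' \<longrightarrow> T (i, j) < T (i', j))}"

definition SYT :: "nat list \<Rightarrow> (nat \<times> nat \<Rightarrow> nat) set" where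
  "SYT lam = {T \<in> extensional (diagram lam).
     bij_betw T (diagram lam) {1..sum_list lam} \<and>
     (\<forall>i j j'. (i, j) \<in> diagram lam \<and> (i, j') \<in> diagram lam \<and> j < j' \<longrightarrow> T (i, j) < T (i, j')) \<and>
     (\<forall>i i' j. (i, j) \<in> diagram lam \<and> (i', j) \<in> diagram lam \<and> i < i' \<longrightarrow> T (i, j) < T (i', j))}"

definition row_of :: "nat list \<Rightarrow> (nat \<times> nat \<Rightarrow> nat) \<Rightarrow> nat \<Rightarrow> nat" where
  "row_of lam T u = (THE i. \<exists>j. (i, j) \<in> diagram lam \<and> T (i, j) = u)"

definition schur :: "nat list \<Rightarrow> series" where
  "schur lam M = of_nat (card {T \<in> SSYT lam. image_mset T (mset_set (diagram lam)) = M})"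

definition schur_expansion :: "series \<Rightarrow> (nat list \<Rightarrow> ratfun) \<Rightarrow> bool" where
  "schur_expansion f a \<longleftrightarrow>
     finite {lam. a lam \<noteq> 0} \<and> (\<forall>lam. a lam \<noteq> 0 \<longrightarrow> is_partition lam) \<and>
     (\<forall>M. f M = (\<Sum>lam | a lam \<noteq> 0. a lam * schur lam M))"

text \<open>
  The coefficient of a Schur function in a symmetric function \<open>f\<close>: the symmetric functions are
  the series that have a Schur expansion, and the expansion is then unique.
\<close>

definition schur_coeff :: "series \<Rightarrow> nat list \<Rightarrow> ratfun" where
  "schur_coeff f lam = (THE a. schur_expansion f a) lam"

definition hook :: "nat \<Rightarrow> nat \<Rightarrow> nat list" where
  "hook n k = k # replicate (n - k) 1"

end

theory Submission imports Defs "HOL-Library.Function_Algebras" begin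

text \<open>
  Read a slice of the web as a word in the labels of its strands. Merges and splits, weighted by
  their attacking pairs, intertwine the Hecke algebra actions on words, so once around the annulus
  gives an endomorphism of a Hecke module whose diagonal entries are the weights of the loop
  decompositions. A monomial coefficient of the LLT function is a partial trace of this
  endomorphism. The sum of \<open>T\<^sub>\<beta> T\<^sub>\<beta>\<^sub>*\<close> over all shuffles \<open>\<beta>\<close> of \<open>a\<close> and \<open>b\<close> strands is central
  in the Hecke algebra; conjugation by the half twist exchanges \<open>a\<close> and \<open>b\<close>, whence exchanging
  neighbouring exponents does not change the trace and the LLT function is symmetric. It therefore
  has a unique Schur expansion, by the symmetry of Schur functions (Bender-Knuth involutions) and
  the unitriangularity of the Kostka matrix.

  Hook coefficients are read off from an alternating sum of monomial coefficients. On a generating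
  function of linear orders, inclusion-exclusion reduces this sum to the orders that ascend up to
  position \<open>k\<close> and never afterwards, with respect to columns for the cells of a tableau and to the
  reversed order for labels. Only the hook shape has such a standard tableau, and only one; the
  orders of the labels of this kind are the standard tableaux of hook shape.
\<close>

section \<open>Hecke algebra actions\<close>

text \<open>What makes the trace argument work is the choice of words. A place of a word is the rank
  of a label in a linear order of the labels, and the letter there is the horizontal position of its
  loop. Hecke operators move places and are the same at every height; merges and splits change
  letters, through monotone maps. One linear order at a time suffices because \<open>inv\<close>
  depends on \<sigma> only through its standardisation, where ties go to the larger label first. A
  block of equal values is therefore a descending run of labels, and two neighbouring blocks of
  sizes a and b form an unshuffling of one descending run. At a descent each generator only swaps,
  up to a power of q, and these powers cancel on the diagonal of a kernel that commutes with the
  action; this is how the sum of diagonal entries becomes the relative norm of the identity. The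
  identities between products of generators that occur hold already in the positive braid monoid,
  which is why generators are handled as words modulo \<open>braid_eq\<close>.\<close>

inductive braid_eq :: "nat \<Rightarrow> nat list \<Rightarrow> nat list \<Rightarrow> bool" for m :: nat where
  braid_refl: "braid_eq m u u"
| braid_sym: "braid_eq m u v \<Longrightarrow> braid_eq m v u"
| braid_trans: "braid_eq m u v \<Longrightarrow> braid_eq m v w \<Longrightarrow> braid_eq m u w"
| braid_far: "i < m \<Longrightarrow> j < m \<Longrightarrow> Suc i < j \<Longrightarrow> braid_eq m (u @ [i, j] @ v) (u @ [j, i] @ v)"
| braid_near: "Suc i < m \<Longrightarrow> braid_eq m (u @ [i, Suc i, i] @ v) (u @ [Suc i, i, Suc i] @ v)"

declare braid_eq.braid_refl [simp, intro]
declare braid_eq.braid_trans [trans]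

lemma braid_eq_append:
  assumes "braid_eq m u v"
  shows "braid_eq m (a @ u @ b) (a @ v @ b)"
  using assms
proof induction
  case (braid_far i j u v)
  then show ?case using braid_eq.braid_far[of i m j "a @ u" "v @ b"] by simp
next
  case (braid_near i u v)
  then show ?case using braid_eq.braid_near[of i m "a @ u" "v @ b"] by simp
qed (auto intro: braid_eq.braid_sym braid_eq.braid_trans)

lemma braid_eq_appendL: "braid_eq m u v \<Longrightarrow> braid_eq m (a @ u) (a @ v)"
  using braid_eq_append[of m u v a "[]"] by simp

lemma braid_eq_appendR: "braid_eq m u v \<Longrightarrow> braid_eq m (u @ b) (v @ b)"
  using braid_eq_append[of m u v "[]" b] by simp

lemma braid_eq_Cons: "braid_eq m u v \<Longrightarrow> braid_eq m (i # u) (i # v)"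
  using braid_eq_appendL[of m u v "[i]"] by simp

lemma braid_eq_rev: "braid_eq m u v \<Longrightarrow> braid_eq m (rev u) (rev v)"
proof (induction rule: braid_eq.induct)
  case (braid_far i j u v)
  then show ?case
    using braid_eq.braid_sym[OF braid_eq.braid_far[of i m j "rev v" "rev u"]] by simp
next
  case (braid_near i u v)
  then show ?case using braid_eq.braid_near[of i m "rev v" "rev u"] by simp
qed (auto intro: braid_eq.braid_sym braid_eq.braid_trans)

lemma braid_eq_swap:
  assumes "i < m" "j < m" "Suc i < j \<or> Suc j < i"
  shows "braid_eq m [i, j] [j, i]"
  using assms braid_eq.braid_far[of i m j "[]" "[]"] braid_eq.braid_sym[OF braid_eq.braid_far[of j m i "[]" "[]"]]
  by auto

lemma braid_eq_commute1:
  assumes "i < m" "\<forall>j\<in>set u. j < m \<and> (Suc i < j \<or> Suc j < i)"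
  shows "braid_eq m (i # u) (u @ [i])"
  using assms(2)
proof (induction u)
  case (Cons j u)
  have "braid_eq m ([] @ [i, j] @ u) ([] @ [j, i] @ u)"
    using Cons.prems assms(1) by (intro braid_eq_append braid_eq_swap) auto
  moreover have "braid_eq m (j # i # u) (j # u @ [i])"
    using Cons by (intro braid_eq_Cons) auto
  ultimately show ?case by (auto intro: braid_eq.braid_trans)
qed simp

lemma braid_eq_commute:
  assumes "\<forall>i\<in>set v. \<forall>j\<in>set u. i < m \<and> j < m \<and> (Suc i < j \<or> Suc j < i)"
  shows "braid_eq m (v @ u) (u @ v)"
  using assms
proof (induction v)
  case (Cons i v)
  have "braid_eq m (i # (v @ u)) (i # (u @ v))"
    using Cons by (intro braid_eq_Cons) auto
  moreover have "braid_eq m ((i # u) @ v) ((u @ [i]) @ v)"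
  proof (cases u)
    case Nil then show ?thesis by simp
  next
    case (Cons a list)
    show ?thesis using Cons.prems Cons
      by (intro braid_eq_appendR braid_eq_commute1) auto
  qed
  ultimately show ?case by (auto intro: braid_eq.braid_trans)
qed simp

text \<open>The final \<open>i\<close> commutes back past all letters above \<open>Suc i\<close>,
  one braid relation turns \<open>i, Suc i, i\<close> into \<open>Suc i, i, Suc i\<close>, and the
  leading \<open>Suc i\<close> commutes with everything below i.\<close>

lemma braid_eq_run_shift:
  assumes "r \<le> i" "Suc i < s" "s \<le> m"
  shows "braid_eq m ([r..<s] @ [i]) (Suc i # [r..<s])"
proof -
  have split: "[r..<s] = [r..<i] @ [i, Suc i] @ [Suc (Suc i)..<s]"
    using assms upt_add_eq_append[of r i "s - i"] by (simp add: upt_conv_Cons)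
  have "braid_eq m (([r..<i] @ [i, Suc i]) @ ([Suc (Suc i)..<s] @ [i]) @ []) 
          (([r..<i] @ [i, Suc i]) @ ([i] @ [Suc (Suc i)..<s]) @ [])"
    using assms by (intro braid_eq_append braid_eq_commute) auto
  also have "braid_eq m \<dots> ([r..<i] @ [Suc i, i, Suc i] @ [Suc (Suc i)..<s])"
    using assms braid_eq.braid_near[of i m "[r..<i]" "[Suc (Suc i)..<s]"] by simp
  also have "braid_eq m ([r..<i] @ [Suc i, i, Suc i] @ [Suc (Suc i)..<s])
               (([Suc i] @ [r..<i]) @ [i, Suc i] @ [Suc (Suc i)..<s])"
    using assms braid_eq_appendR[OF braid_eq_commute[of "[r..<i]" "[Suc i]" m],
        of "[i, Suc i] @ [Suc (Suc i)..<s]"] by auto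
  finally show ?thesis using split by simp
qed

lemma braid_eq_run_shift_list:
  assumes "\<forall>i\<in>set js. r \<le> i \<and> Suc i < s" "s \<le> m"
  shows "braid_eq m ([r..<s] @ js) (map Suc js @ [r..<s])"
  using assms(1)
proof (induction js)
  case (Cons i js)
  have "braid_eq m (([r..<s] @ [i]) @ js) ((Suc i # [r..<s]) @ js)"
    using Cons.prems assms by (intro braid_eq_appendR braid_eq_run_shift) auto
  moreover have "braid_eq m (Suc i # ([r..<s] @ js)) (Suc i # (map Suc js @ [r..<s]))"
    using Cons by (intro braid_eq_Cons) auto
  ultimately show ?case by (auto intro: braid_eq.braid_trans)
qed simp

lemma upt_r: "r < s \<Longrightarrow> [r..<s] = r # [Suc r..<s]"
  by (simp add: upt_conv_Cons)

section \<open>The half twist and its conjugation action\<close>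

fun half_twist :: "nat \<Rightarrow> nat \<Rightarrow> nat list" where
  "half_twist r 0 = []"
| "half_twist r (Suc N) = [r..<r + N] @ half_twist r N"

lemma set_half_twist: "set (half_twist r N) \<subseteq> {r..<r + N - 1}"
  by (induction r N rule: half_twist.induct) (auto dest!: subsetD)

text \<open>Here \<open>N\<close> counts strands, so the generators run from r to r + N - 2 and
  \<open>2 * r + N - 2 - i\<close> is the mirror image of i. In the induction the mirror image for
  one strand fewer is too small by one, and the run in front supplies the missing shift.\<close>

lemma half_twist_conj:
  assumes "r \<le> i" "Suc i < r + N" "r + N \<le> Suc m"
  shows "braid_eq m (half_twist r N @ [i]) ((2 * r + N - 2 - i) # half_twist r N)"
  using assms
proof (induction N arbitrary: i)
  case (Suc N)
  show ?case
  proof (cases "Suc i < r + N")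
    case True
    have "braid_eq m ([r..<r + N] @ (half_twist r N @ [i]))
            ([r..<r + N] @ ((2 * r + N - 2 - i) # half_twist r N))"
      using Suc True by (intro braid_eq_appendL) auto
    also have "\<dots> = ([r..<r + N] @ [2 * r + N - 2 - i]) @ half_twist r N" by simp
    also have "braid_eq m \<dots> ((Suc (2 * r + N - 2 - i) # [r..<r + N]) @ half_twist r N)"
      using Suc.prems True by (intro braid_eq_appendR braid_eq_run_shift) auto
    finally show ?thesis
      using Suc.prems True by (simp add: Suc_diff_le Suc_diff_Suc)
  next
    case False
    \<comment> \<open>The last generator lies outside the induction hypothesis. It commutes with the
      half twist on K strands and completes the second run to a copy of the first. From the product
      of these two equal runs the first letter r is split off; what follows it is a shifted run,
      which \<open>braid_eq_run_shift_list\<close> moves back to the other side.\<close>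
    then have i: "i = r + N - 1" "N \<ge> 1" using Suc.prems by auto
    then obtain K where N: "N = Suc K" by (cases N) auto
    have iK: "i = r + K" using i N by simp
    have "braid_eq m (([r..<r + Suc K] @ [r..<r + K]) @ half_twist r K @ [i])
            (([r..<r + Suc K] @ [r..<r + K]) @ [i] @ half_twist r K)"
      using set_half_twist[of r K] Suc.prems iK N
      by (intro braid_eq_appendL braid_eq_commute) (fastforce dest!: subsetD)
    also have "\<dots> = ([r..<r + Suc K] @ ([r..<r + K] @ [i])) @ half_twist r K"
      by simp
    also have "[r..<r + K] @ [i] = r # map Suc [r..<r + K]"
      using iK upt_r[of r "Suc (r + K)"] by (simp add: map_Suc_upt)
    also have "braid_eq m (([r..<r + Suc K] @ (r # map Suc [r..<r + K])) @ half_twist r K)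
                 ((r # [r..<r + Suc K] @ [r..<r + K]) @ half_twist r K)"
    proof (rule braid_eq_appendR)
      have "r # map Suc [r..<r + K] = [r..<r + Suc K]"
        using upt_r[of r "Suc (r + K)"] by (simp add: map_Suc_upt)
      then have "[r..<r + Suc K] @ (r # map Suc [r..<r + K]) = r # map Suc [r..<r + K] @ [r..<r + Suc K]"
        by (metis append_Cons)
      moreover have "braid_eq m (r # [r..<r + Suc K] @ [r..<r + K]) (r # map Suc [r..<r + K] @ [r..<r + Suc K])"
        using Suc.prems N by (intro braid_eq_Cons braid_eq_run_shift_list) auto
      ultimately show "braid_eq m ([r..<r + Suc K] @ (r # map Suc [r..<r + K]))
                         (r # [r..<r + Suc K] @ [r..<r + K])"
        by (metis braid_eq.braid_sym)
    qed
    finally show ?thesis using N iK by (simp add: upt_rec)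
  qed
qed simp

section \<open>Braid words for shuffles\<close>

abbreviation trues :: "bool list \<Rightarrow> nat" where "trues \<beta> \<equiv> count_list \<beta> True"

text \<open>A reduced word of the minimal coset representative that collects the True strands on the
  left and keeps the order within both kinds; the run takes a leading False past all True strands of
  the rest.\<close>

fun unshuffle_word :: "nat \<Rightarrow> bool list \<Rightarrow> nat list" where
  "unshuffle_word r [] = []"
| "unshuffle_word r (True # \<beta>) = unshuffle_word (Suc r) \<beta>"
| "unshuffle_word r (False # \<beta>) = unshuffle_word (Suc r) \<beta> @ [r..<r + trues \<beta>]"

lemma trues_le: "trues \<beta> \<le> length \<beta>"
  by (rule count_le_length)

lemma set_unshuffle_word: "set (unshuffle_word r \<beta>) \<subseteq> {r..<r + length \<beta> - 1}"
proof (induction r \<beta> rule: unshuffle_word.induct)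
  case (3 r \<beta>)
  then show ?case using trues_le[of \<beta>] by auto
qed auto

lemma unshuffle_word_Suc: "unshuffle_word (Suc r) \<beta> = map Suc (unshuffle_word r \<beta>)"
  by (induction r \<beta> rule: unshuffle_word.induct) (auto simp: map_Suc_upt)

lemma unshuffle_word_commute:
  assumes "r + length \<beta> \<le> Suc m" "i < m" "Suc i < r"
  shows "braid_eq m (i # unshuffle_word r \<beta>) (unshuffle_word r \<beta> @ [i])"
  using assms set_unshuffle_word[of r \<beta>] by (intro braid_eq_commute1) (fastforce dest!: subsetD)+

text \<open>Together with the next lemma this is Deodhar's dichotomy for a minimal coset
  representative d: a generator s either gives another representative s d, or it can be pulled
  through, s d = d s', with s' in the parabolic subgroup.\<close>

lemma unshuffle_word_TF:
  assumes "r + length (\<beta> @ [True, False] @ \<gamma>) \<le> Suc m"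
  shows "braid_eq m ((r + length \<beta>) # unshuffle_word r (\<beta> @ [True, False] @ \<gamma>))
           (unshuffle_word r (\<beta> @ [False, True] @ \<gamma>))"
  using assms
proof (induction \<beta> arbitrary: r)
  case Nil
  have "braid_eq m ((r # unshuffle_word (Suc (Suc r)) \<gamma>) @ [Suc r..<Suc r + trues \<gamma>])
          ((unshuffle_word (Suc (Suc r)) \<gamma> @ [r]) @ [Suc r..<Suc r + trues \<gamma>])"
    using Nil by (intro braid_eq_appendR unshuffle_word_commute) auto
  then show ?case by (simp add: upt_r del: upt_Suc)
next
  case (Cons b \<beta>)
  have IH: "braid_eq m ((Suc r + length \<beta>) # unshuffle_word (Suc r) (\<beta> @ [True, False] @ \<gamma>))
           (unshuffle_word (Suc r) (\<beta> @ [False, True] @ \<gamma>))"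
    using Cons.prems by (intro Cons.IH) simp
  show ?case
    using IH braid_eq_appendR[OF IH, of "[r..<r + (Suc (trues \<beta> + trues \<gamma>))]"]
    by (cases b) (simp_all del: upt_Suc)
qed

text \<open>Neighbouring strands of one kind stay neighbours after unshuffling, so their crossing
  can be performed on the other side of the word. The block in which j lies is recorded because it
  carries the induction: a further leading False adds a run that shifts a j of the left block and
  commutes with a j of the right block.\<close>

lemma unshuffle_word_eq:
  assumes "r + length (\<beta> @ [b, b] @ \<gamma>) \<le> Suc m"
  defines "a \<equiv> trues (\<beta> @ [b, b] @ \<gamma>)"
  shows "\<exists>j. (if b then r \<le> j \<and> Suc j < r + a else r + a \<le> j \<and> Suc j < r + length (\<beta> @ [b, b] @ \<gamma>)) \<and>
           braid_eq m ((r + length \<beta>) # unshuffle_word r (\<beta> @ [b, b] @ \<gamma>))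
             (unshuffle_word r (\<beta> @ [b, b] @ \<gamma>) @ [j])"
  using assms(1) unfolding a_def
proof (induction \<beta> arbitrary: r)
  case Nil
  have comm: "braid_eq m (r # unshuffle_word (Suc (Suc r)) \<gamma>) (unshuffle_word (Suc (Suc r)) \<gamma> @ [r])"
    using Nil by (intro unshuffle_word_commute) auto
  show ?case
  proof (cases b)
    case True
    then show ?thesis using comm by (intro exI[of _ r]) auto
  next
    case False
    let ?a = "trues \<gamma>" and ?p = "unshuffle_word (Suc (Suc r)) \<gamma>"
    have a: "?a \<le> length \<gamma>" by (rule trues_le)
    have "braid_eq m ((r # ?p) @ ([Suc r..<Suc r + ?a] @ [r..<r + ?a]))
            ((?p @ [r]) @ ([Suc r..<Suc r + ?a] @ [r..<r + ?a]))"
      by (rule braid_eq_appendR[OF comm])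
    also have "\<dots> = ?p @ ([r..<Suc (r + ?a)] @ [r..<r + ?a])"
      by (simp add: upt_r del: upt_Suc)
    \<comment> \<open>Two leading False strands give two runs; shifting one through the other leaves
      a crossing at r + a, the first place of the right block.\<close>
    also have "braid_eq m \<dots> (?p @ (map Suc [r..<r + ?a] @ [r..<Suc (r + ?a)]))"
      using Nil a by (intro braid_eq_appendL braid_eq_run_shift_list) auto
    finally have "braid_eq m (r # unshuffle_word r ([b, b] @ \<gamma>)) (unshuffle_word r ([b, b] @ \<gamma>) @ [r + ?a])"
      using False by (simp add: map_Suc_upt)
    then show ?thesis using a False by (intro exI[of _ "r + ?a"]) auto
  qed
next
  case (Cons b' \<beta>)
  let ?w = "\<beta> @ [b, b] @ \<gamma>"
  obtain j where j: "if b then Suc r \<le> j \<and> Suc j < Suc r + trues ?w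
      else Suc r + trues ?w \<le> j \<and> Suc j < Suc r + length ?w"
    and eq: "braid_eq m ((Suc r + length \<beta>) # unshuffle_word (Suc r) ?w)
               (unshuffle_word (Suc r) ?w @ [j])"
    using Cons.IH[of "Suc r"] Cons.prems by auto
  show ?case
  proof (cases b')
    case True
    then show ?thesis using eq j by (intro exI[of _ j]) (auto split: if_splits)
  next
    case False
    let ?a = "trues ?w"
    have a: "?a \<le> length ?w" by (rule trues_le)
    have 1: "braid_eq m (((Suc r + length \<beta>) # unshuffle_word (Suc r) ?w) @ [r..<r + ?a])
               ((unshuffle_word (Suc r) ?w @ [j]) @ [r..<r + ?a])"
      by (rule braid_eq_appendR[OF eq])
    have 2: "braid_eq m ([j] @ [r..<r + ?a]) ([r..<r + ?a] @ [if b then j - 1 else j])"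
    proof (cases b)
      case True
      then have "braid_eq m ([r..<r + ?a] @ [j - 1]) (Suc (j - 1) # [r..<r + ?a])"
        using j a Cons.prems by (intro braid_eq_run_shift) auto
      then show ?thesis using True j by (auto intro: braid_eq.braid_sym)
    next
      case False
      have "braid_eq m ([j] @ [r..<r + ?a]) ([r..<r + ?a] @ [j])"
        using j a Cons.prems False by (intro braid_eq_commute) auto
      then show ?thesis using False by simp
    qed
    have "braid_eq m ((r + length (b' # \<beta>)) # unshuffle_word r ((b' # \<beta>) @ [b, b] @ \<gamma>))
            (unshuffle_word r ((b' # \<beta>) @ [b, b] @ \<gamma>) @ [if b then j - 1 else j])"
      using False braid_eq.braid_trans[OF 1, of "unshuffle_word (Suc r) ?w @ [r..<r + ?a] @ [if b then j - 1 else j]"]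
        braid_eq_appendL[OF 2, of "unshuffle_word (Suc r) ?w"] by simp
    then show ?thesis using j a False by (intro exI[of _ "if b then j - 1 else j"]) (auto split: if_splits)
  qed
qed

lemma unshuffle_word_snoc_False: "unshuffle_word r (\<beta> @ [False]) = unshuffle_word r \<beta>"
  by (induction r \<beta> rule: unshuffle_word.induct) auto

text \<open>\<open>unshuffle_word\<close> recurses at the front of the list, whereas reflection
  reverses the list; hence the effect of a letter at the far end is needed. A final True has to pass
  every False strand.\<close>

lemma unshuffle_word_snoc_True:
  assumes "r + Suc (length \<beta>) \<le> Suc m"
  shows "braid_eq m (unshuffle_word r (\<beta> @ [True]))
           (unshuffle_word r \<beta> @ rev [r + trues \<beta>..<r + length \<beta>])"
  using assms
proof (induction r \<beta> rule: unshuffle_word.induct)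
  case (3 r \<beta>)
  let ?a = "trues \<beta>" and ?p = "unshuffle_word (Suc r) \<beta>"
  have a: "?a \<le> length \<beta>" by (rule trues_le)
  have "braid_eq m (unshuffle_word (Suc r) (\<beta> @ [True]) @ [r..<r + Suc ?a])
          ((?p @ rev [Suc r + ?a..<Suc r + length \<beta>]) @ [r..<r + Suc ?a])"
    using 3 by (intro braid_eq_appendR) auto
  also have "\<dots> = ?p @ (rev [Suc r + ?a..<Suc r + length \<beta>] @ [r..<r + ?a]) @ [r + ?a]"
    by simp
  also have "braid_eq m \<dots> (?p @ ([r..<r + ?a] @ rev [Suc r + ?a..<Suc r + length \<beta>]) @ [r + ?a])"
    using 3 by (intro braid_eq_append braid_eq_commute) auto
  also have "\<dots> = ?p @ [r..<r + ?a] @ rev [r + ?a..<r + length (False # \<beta>)]"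
    using a by (simp add: upt_r[of "r + ?a"] del: upt_Suc)
  finally show ?case by (simp del: upt_Suc)
qed (auto simp del: upt_Suc)

lemma upt_reflect: "map (\<lambda>i. c - i) [r..<r + a] = rev [Suc c - r - a..<Suc c - r]" if "r + a \<le> Suc c"
  using that
proof (induction a)
  case (Suc a)
  have *: "Suc c - r - a = Suc (c - r - a)" "Suc c - (r + a) = Suc (c - (r + a))"
    using Suc.prems by auto
  have "[Suc c - r - Suc a..<Suc c - r] = (c - r - a) # [Suc c - r - a..<Suc c - r]"
    using Suc.prems by (subst upt_r) (auto simp: * simp del: upt_Suc)
  then show ?case using Suc by simp
qed simp

text \<open>Reflection reverses the order of the strands, so the True strands are now collected on
  the right. Negating the letters makes this an unshuffling of the standard kind again.\<close>

lemma unshuffle_word_reflect: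
  assumes "r + length \<beta> \<le> Suc m"
  shows "braid_eq m (map (\<lambda>i. 2 * r + length \<beta> - 2 - i) (unshuffle_word r \<beta>))
           (unshuffle_word r (rev (map Not \<beta>)))"
  using assms
proof (induction \<beta>)
  case (Cons b \<beta>)
  let ?N = "length \<beta>"
  let ?g = "rev (map Not \<beta>)"
  have map: "map (\<lambda>i. 2 * r + length (b # \<beta>) - 2 - i) (unshuffle_word (Suc r) \<beta>)
     = map (\<lambda>i. 2 * r + ?N - 2 - i) (unshuffle_word r \<beta>)"
    using set_unshuffle_word[of r \<beta>] by (auto simp: unshuffle_word_Suc)
  have IH: "braid_eq m (map (\<lambda>i. 2 * r + length (b # \<beta>) - 2 - i) (unshuffle_word (Suc r) \<beta>)) (unshuffle_word r ?g)"
    unfolding map using Cons.prems by (intro Cons.IH) simp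
  show ?case
  proof (cases b)
    case True
    then show ?thesis using IH by (simp add: unshuffle_word_snoc_False)
  next
    case False
    have tr: "trues ?g = ?N - trues \<beta>"
    proof -
      have "trues (map Not \<gamma>) + trues \<gamma> = length \<gamma>" for \<gamma> by (induction \<gamma>) auto
      from this[of \<beta>] show ?thesis by simp
    qed
    have a: "trues \<beta> \<le> ?N" by (rule trues_le)
    have "map (\<lambda>i. 2 * r + length (b # \<beta>) - 2 - i) [r..<r + trues \<beta>]
        = rev [r + trues ?g..<r + length ?g]"
    proof (cases "?N = 0")
      case False
      then have "Suc (2 * r + ?N - 1) - r = r + ?N" "Suc (2 * r + ?N - 1) - r - trues \<beta> = r + (?N - trues \<beta>)"
        using a by auto
      then show ?thesis
        using a False upt_reflect[of r "trues \<beta>" "2 * r + ?N - 1"] by (simp only: tr) simp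
    qed simp
    then have "map (\<lambda>i. 2 * r + length (b # \<beta>) - 2 - i) (unshuffle_word r (b # \<beta>))
       = map (\<lambda>i. 2 * r + length (b # \<beta>) - 2 - i) (unshuffle_word (Suc r) \<beta>) @ rev [r + trues ?g..<r + length ?g]"
      using False by simp
    moreover have "braid_eq m \<dots> (unshuffle_word r ?g @ rev [r + trues ?g..<r + length ?g])"
      using IH by (rule braid_eq_appendR)
    moreover have "braid_eq m (unshuffle_word r ?g @ rev [r + trues ?g..<r + length ?g]) (unshuffle_word r (?g @ [True]))"
      using Cons.prems by (intro braid_eq.braid_sym[OF unshuffle_word_snoc_True]) auto
    ultimately show ?thesis using False by (auto intro: braid_eq.braid_trans)
  qed
qed simp

lemma trues_map_Not: "trues (map Not \<beta>) = length \<beta> - trues \<beta>"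
proof -
  have "trues (map Not \<beta>) + trues \<beta> = length \<beta>" by (induction \<beta>) auto
  then show ?thesis by simp
qed

section \<open>The relative norm and its symmetry\<close>

definition bool_words :: "nat \<Rightarrow> nat \<Rightarrow> bool list set" where
  "bool_words a b = {\<beta>. length \<beta> = a + b \<and> trues \<beta> = a}"

lemma finite_bool_words [simp]: "finite (bool_words a b)"
  by (rule finite_subset[OF _ finite_lists_length_eq[of UNIV "a + b"]]) (auto simp: bool_words_def)

lemma bij_betw_bool_words_reflect:
  "bij_betw (\<lambda>\<beta>. rev (map Not \<beta>)) (bool_words a b) (bool_words b a)"
  by (rule bij_betwI[of _ _ _ "\<lambda>\<beta>. rev (map Not \<beta>)"])
     (auto simp: bool_words_def rev_map comp_def trues_map_Not)

text \<open>The quadratic relation is T^2 = (q - 1/q) T + 1, and q - 1/q is the only scalar that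
  occurs; \<open>scale\<close> stands for multiplication by it, in place of a whole module
  structure. By this relation \<open>T i\<close> is onto, with \<open>T i v - scale v\<close> as a
  preimage of v.\<close>

locale hecke_action =
  fixes T :: "nat \<Rightarrow> 'v::ab_group_add \<Rightarrow> 'v" and scale :: "'v \<Rightarrow> 'v" and m :: nat
  assumes T_add: "T i (u + v) = T i u + T i v"
    and T_scale: "T i (scale v) = scale (T i v)"
    and T_quadratic: "i < m \<Longrightarrow> T i (T i v) = scale (T i v) + v"
    and T_commute: "i < m \<Longrightarrow> j < m \<Longrightarrow> Suc i < j \<Longrightarrow> T i (T j v) = T j (T i v)"
    and T_braid: "Suc i < m \<Longrightarrow> T i (T (Suc i) (T i v)) = T (Suc i) (T i (T (Suc i) v))"
begin

abbreviation act :: "nat list \<Rightarrow> 'v \<Rightarrow> 'v" where "act js v \<equiv> foldr T js v"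

lemma T_0 [simp]: "T i 0 = 0"
  using T_add[of i 0 0] by simp

lemma T_diff: "T i (u - v) = T i u - T i v"
  using T_add[of i "u - v" v] by simp

lemma T_sum: "T i (sum f A) = (\<Sum>x\<in>A. T i (f x))"
  by (induction A rule: infinite_finite_induct) (auto simp: T_add)

lemma act_add: "act js (u + v) = act js u + act js v"
  by (induction js) (auto simp: T_add)

lemma act_scale: "act js (scale v) = scale (act js v)"
  by (induction js) (auto simp: T_scale)

lemma act_sum: "act js (sum f A) = (\<Sum>x\<in>A. act js (f x))"
  by (induction js) (auto simp: T_sum)

lemma act_braid_eq: "braid_eq m u v \<Longrightarrow> act u x = act v x"
proof (induction arbitrary: x rule: braid_eq.induct)
  case (braid_far i j u v)
  then show ?case using T_commute[OF braid_far] by simp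
qed (simp_all add: T_braid)

lemma T_surj: "i < m \<Longrightarrow> \<exists>u. T i u = v"
  by (rule exI[of _ "T i v - scale v"]) (simp add: T_diff T_scale T_quadratic)

lemma act_surj: "\<forall>i\<in>set js. i < m \<Longrightarrow> \<exists>u. act js u = v"
proof (induction js arbitrary: v)
  case (Cons j js)
  then obtain w where "T j w = v" using T_surj[of j v] by auto
  moreover obtain u where "act js u = w" using Cons by auto
  ultimately show ?case by auto
qed auto

definition shuffle_act :: "nat \<Rightarrow> bool list \<Rightarrow> 'v \<Rightarrow> 'v" where
  "shuffle_act r \<beta> v = act (unshuffle_word r \<beta> @ rev (unshuffle_word r \<beta>)) v"

text \<open>The relative norm of the identity, from the parabolic subalgebra of the two blocks of
  sizes a and b to the Hecke algebra on the a + b strands starting at r.\<close>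

definition casimir :: "nat \<Rightarrow> nat \<Rightarrow> nat \<Rightarrow> 'v \<Rightarrow> 'v" where
  "casimir r a b v = (\<Sum>\<beta>\<in>bool_words a b. shuffle_act r \<beta> v)"

text \<open>The generator is pulled through the word by \<open>i w = w j\<close> and leaves through
  the reversed word by the reversed relation, so the auxiliary j disappears.\<close>

lemma shuffle_act_eq:
  assumes "r + length (\<beta> @ [b, b] @ \<gamma>) \<le> Suc m"
  shows "T (r + length \<beta>) (shuffle_act r (\<beta> @ [b, b] @ \<gamma>) v)
       = shuffle_act r (\<beta> @ [b, b] @ \<gamma>) (T (r + length \<beta>) v)"
proof -
  let ?w = "unshuffle_word r (\<beta> @ [b, b] @ \<gamma>)" and ?i = "r + length \<beta>"
  obtain j where j: "braid_eq m (?i # ?w) (?w @ [j])"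
    using unshuffle_word_eq[OF assms] by blast
  have "braid_eq m (?i # ?w @ rev ?w) (?w @ j # rev ?w)"
    using braid_eq_appendR[OF j, of "rev ?w"] by simp
  also have "braid_eq m \<dots> (?w @ rev ?w @ [?i])"
    using braid_eq_appendL[OF braid_eq.braid_sym[OF braid_eq_rev[OF j]], of ?w] by simp
  finally show ?thesis unfolding shuffle_act_def using act_braid_eq by fastforce
qed

lemma shuffle_act_TF:
  assumes "r + length (\<beta> @ [True, False] @ \<gamma>) \<le> Suc m"
  shows "shuffle_act r (\<beta> @ [False, True] @ \<gamma>) v
       = T (r + length \<beta>) (shuffle_act r (\<beta> @ [True, False] @ \<gamma>) (T (r + length \<beta>) v))"
proof -
  let ?w = "unshuffle_word r (\<beta> @ [True, False] @ \<gamma>)" and ?i = "r + length \<beta>"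
  let ?w' = "unshuffle_word r (\<beta> @ [False, True] @ \<gamma>)"
  have j: "braid_eq m (?i # ?w) ?w'"
    by (rule unshuffle_word_TF[OF assms])
  have "braid_eq m (?i # ?w @ rev ?w @ [?i]) (?w' @ rev ?w @ [?i])"
    using braid_eq_appendR[OF j, of "rev ?w @ [?i]"] by simp
  also have "braid_eq m \<dots> (?w' @ rev ?w')"
    using braid_eq_appendL[OF braid_eq_rev[OF j], of ?w'] by simp
  finally show ?thesis unfolding shuffle_act_def
    using act_braid_eq[of "?i # ?w @ rev ?w @ [?i]" "?w' @ rev ?w'" v] by simp
qed

lemma shuffle_act_add: "shuffle_act r \<beta> (u + v) = shuffle_act r \<beta> u + shuffle_act r \<beta> v"
  by (simp only: shuffle_act_def act_add)

lemma shuffle_act_scale: "shuffle_act r \<beta> (scale v) = scale (shuffle_act r \<beta> v)"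
  by (simp only: shuffle_act_def act_scale)

text \<open>Shuffles are grouped by the two letters that \<open>T i\<close> touches. Equal letters
  give a summand that commutes by itself. Unequal letters come in pairs x and T x T, and T (x + T x
  T) = (x + T x T) T, since the quadratic relation turns both sides into T x + x T plus q - 1/q
  times T x T.\<close>

lemma casimir_commute:
  assumes "r \<le> i" "Suc i < r + a + b" "r + a + b \<le> Suc m"
  shows "T i (casimir r a b v) = casimir r a b (T i v)"
proof -
  define p where "p = i - r"
  have i: "i = r + p" and p: "Suc p < a + b" using assms by (auto simp: p_def)
  define W where "W x y = {\<beta> \<in> bool_words a b. \<beta> ! p = x \<and> \<beta> ! Suc p = y}" for x y
  have decomp: "\<exists>\<gamma> \<delta>. \<beta> = \<gamma> @ [x, y] @ \<delta> \<and> length \<gamma> = p" if "\<beta> \<in> W x y" for \<beta> x y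
  proof (intro exI conjI)
    have "length \<beta> = a + b" using that by (auto simp: W_def bool_words_def)
    then have l: "p < length \<beta>" "Suc p < length \<beta>" using p by auto
    have "\<beta> = take p \<beta> @ \<beta> ! p # \<beta> ! Suc p # drop (Suc (Suc p)) \<beta>"
      unfolding Cons_nth_drop_Suc[OF l(2)] by (rule id_take_nth_drop[OF l(1)])
    then show "\<beta> = take p \<beta> @ [x, y] @ drop (Suc (Suc p)) \<beta>" using that by (simp add: W_def)
    show "length (take p \<beta>) = p" using l by simp
  qed
  have len: "length \<beta> = a + b" if "\<beta> \<in> W x y" for \<beta> x y
    using that by (auto simp: W_def bool_words_def)
  have WE: "\<gamma> @ [x, y] @ \<delta> \<in> W x' y' \<longleftrightarrow> x = x' \<and> y = y' \<and> length \<gamma> + 2 + length \<delta> = a + b \<and>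
      trues (\<gamma> @ [x, y] @ \<delta>) = a" if "length \<gamma> = p" for \<gamma> \<delta> x y x' y'
    using that by (auto simp: W_def bool_words_def nth_append)
  define sw where "sw \<beta> = \<beta>[p := \<beta> ! Suc p, Suc p := \<beta> ! p]" for \<beta> :: "bool list"
  have sw: "sw (\<gamma> @ [x, y] @ \<delta>) = \<gamma> @ [y, x] @ \<delta>" if "length \<gamma> = p" for \<gamma> \<delta> x y
    using that by (auto simp: sw_def nth_append list_update_append)
  have bij: "bij_betw sw (W True False) (W False True)"
  proof (rule bij_betwI[of _ _ _ sw])
    have swW: "sw \<beta> \<in> W y x \<and> sw (sw \<beta>) = \<beta>" if \<beta>: "\<beta> \<in> W x y" for \<beta> x y
    proof -
      from decomp[OF \<beta>] obtain \<gamma> \<delta> where d: "\<beta> = \<gamma> @ [x, y] @ \<delta>" "length \<gamma> = p" by blast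
      show ?thesis using \<beta> unfolding d(1) sw[OF d(2)] WE[OF d(2)] by auto
    qed
    show "sw \<in> W True False \<rightarrow> W False True" "sw \<in> W False True \<rightarrow> W True False"
      using swW by blast+
    show "sw (sw \<beta>) = \<beta>" if "\<beta> \<in> W True False" for \<beta> using swW[OF that] by blast
    show "sw (sw \<beta>) = \<beta>" if "\<beta> \<in> W False True" for \<beta> using swW[OF that] by blast
  qed
  have fin: "finite (W x y)" for x y
    by (rule finite_subset[of _ "bool_words a b"]) (auto simp: W_def)
  have union: "bool_words a b = (W True True \<union> W False False) \<union> (W True False \<union> W False True)"
    by (auto simp: W_def)
  have cas: "casimir r a b u = (\<Sum>\<beta>\<in>W True True \<union> W False False. shuffle_act r \<beta> u) +
     (\<Sum>\<beta>\<in>W True False. shuffle_act r \<beta> u + shuffle_act r (sw \<beta>) u)" for u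
  proof -
    have 1: "(W True True \<union> W False False) \<inter> (W True False \<union> W False True) = {}"
      "W True False \<inter> W False True = {}" by (auto simp: W_def)
    show ?thesis
      by (simp add: casimir_def union sum.union_disjoint[OF _ _ 1(1)] sum.union_disjoint[OF _ _ 1(2)]
          fin sum.distrib flip: sum.reindex_bij_betw[OF bij])
  qed
  have same: "T i (shuffle_act r \<beta> v) = shuffle_act r \<beta> (T i v)"
    if \<beta>: "\<beta> \<in> W True True \<union> W False False" for \<beta>
  proof -
    obtain x where x: "\<beta> \<in> W x x" using \<beta> by blast
    from decomp[OF this] obtain \<gamma> \<delta> where d: "\<beta> = \<gamma> @ [x, x] @ \<delta>" "length \<gamma> = p" by blast
    have "r + length \<beta> \<le> Suc m" using len[OF x] assms by simp
    then show ?thesis using shuffle_act_eq[of r \<gamma> x \<delta> v] unfolding d(1)[symmetric] d(2) i by simp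
  qed
  have pair: "T i (shuffle_act r \<beta> v + shuffle_act r (sw \<beta>) v)
      = shuffle_act r \<beta> (T i v) + shuffle_act r (sw \<beta>) (T i v)" if \<beta>: "\<beta> \<in> W True False" for \<beta>
  proof -
    from decomp[OF \<beta>] obtain \<gamma> \<delta> where d: "\<beta> = \<gamma> @ [True, False] @ \<delta>" "length \<gamma> = p" by blast
    have "r + length \<beta> \<le> Suc m" using len[OF \<beta>] assms by simp
    moreover have swb: "sw \<beta> = \<gamma> @ [False, True] @ \<delta>" using sw[OF d(2)] d(1) by simp
    ultimately have *: "shuffle_act r (sw \<beta>) u = T i (shuffle_act r \<beta> (T i u))" for u
      using shuffle_act_TF[of r \<gamma> \<delta> u] unfolding d(1)[symmetric] swb[symmetric] d(2) i by simp
    have "i < m" using assms by simp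
    then show ?thesis
      by (simp add: * T_add T_quadratic shuffle_act_add shuffle_act_scale T_scale)
  qed
  show ?thesis unfolding cas T_add T_sum using same pair[unfolded T_add] by simp
qed

lemma casimir_act_commute:
  assumes "\<forall>i\<in>set js. r \<le> i \<and> Suc i < r + a + b" "r + a + b \<le> Suc m"
  shows "act js (casimir r a b v) = casimir r a b (act js v)"
  using assms(1) by (induction js) (auto simp: casimir_commute assms(2))

lemma half_twist_conj_list:
  assumes "\<forall>i\<in>set js. r \<le> i \<and> Suc i < r + N" "r + N \<le> Suc m"
  shows "braid_eq m (half_twist r N @ js) (map (\<lambda>i. 2 * r + N - 2 - i) js @ half_twist r N)"
  using assms(1)
proof (induction js)
  case (Cons i js)
  have "braid_eq m ((half_twist r N @ [i]) @ js) (((2 * r + N - 2 - i) # half_twist r N) @ js)"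
    using Cons.prems assms(2) by (intro braid_eq_appendR half_twist_conj) auto
  also have "braid_eq m \<dots> ((2 * r + N - 2 - i) # (map (\<lambda>i. 2 * r + N - 2 - i) js @ half_twist r N))"
    using Cons by (simp add: braid_eq_Cons)
  finally show ?case by simp
qed simp

theorem casimir_sym:
  assumes "r + a + b \<le> Suc m"
  shows "casimir r a b v = casimir r b a v"
proof -
  let ?N = "a + b" and ?D = "half_twist r (a + b)"
  let ?f = "\<lambda>i. 2 * r + ?N - 2 - i"
  have D: "\<forall>i\<in>set ?D. r \<le> i \<and> Suc i < r + a + b"
    using set_half_twist[of r ?N] by fastforce
  have "\<forall>i\<in>set ?D. i < m" using D assms by auto
  \<comment> \<open>The half twist acts surjectively; writing v as an image under it allows the
    conjugation relations to be applied at u.\<close>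
  then obtain u where u: "v = act ?D u" using act_surj by metis
  have "act ?D (shuffle_act r \<beta> u) = shuffle_act r (rev (map Not \<beta>)) (act ?D u)"
    if "\<beta> \<in> bool_words a b" for \<beta>
  proof -
    have len: "length \<beta> = ?N" using that by (simp add: bool_words_def)
    let ?P = "unshuffle_word r \<beta>" and ?Q = "unshuffle_word r (rev (map Not \<beta>))"
    have "braid_eq m (?D @ (?P @ rev ?P)) (map ?f (?P @ rev ?P) @ ?D)"
      using set_unshuffle_word[of r \<beta>] len assms by (intro half_twist_conj_list) fastforce+
    also have "\<dots> = (map ?f ?P @ rev (map ?f ?P)) @ ?D" by (simp add: rev_map)
    also have "braid_eq m \<dots> ((?Q @ rev ?Q) @ ?D)"
    proof (rule braid_eq_appendR)
      have b: "braid_eq m (map ?f ?P) ?Q"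
        using unshuffle_word_reflect[of r \<beta> m] len assms by simp
      show "braid_eq m (map ?f ?P @ rev (map ?f ?P)) (?Q @ rev ?Q)"
        using braid_eq.braid_trans[OF braid_eq_appendR[OF b] braid_eq_appendL[OF braid_eq_rev[OF b]]] .
    qed
    finally show ?thesis unfolding shuffle_act_def using act_braid_eq by fastforce
  qed
  then have "act ?D (casimir r a b u) = (\<Sum>\<beta>\<in>bool_words a b. shuffle_act r (rev (map Not \<beta>)) v)"
    unfolding casimir_def act_sum u by (intro sum.cong) auto
  also have "\<dots> = casimir r b a v"
    unfolding casimir_def by (rule sum.reindex_bij_betw[OF bij_betw_bool_words_reflect])
  finally show ?thesis using casimir_act_commute[OF D assms, of u] u by simp
qed

end

section \<open>The action on words\<close>

definition swap_at :: "nat \<Rightarrow> 'a list \<Rightarrow> 'a list" where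
  "swap_at i xs = xs[i := xs ! Suc i, Suc i := xs ! i]"

lemma length_swap_at [simp]: "length (swap_at i xs) = length xs"
  by (simp add: swap_at_def)

lemma nth_swap_at: "Suc i < length xs \<Longrightarrow> j < length xs \<Longrightarrow>
    swap_at i xs ! j = (if j = i then xs ! Suc i else if j = Suc i then xs ! i else xs ! j)"
  by (auto simp: swap_at_def nth_list_update)

lemma swap_at_swap_at [simp]: "Suc i < length xs \<Longrightarrow> swap_at i (swap_at i xs) = xs"
  by (rule nth_equalityI) (auto simp: nth_swap_at)

lemma swap_at_append: "swap_at (length xs) (xs @ a # b # ys) = xs @ b # a # ys"
  by (simp add: swap_at_def nth_append list_update_append)

lemma map_swap_at: "Suc i < length xs \<Longrightarrow> map f (swap_at i xs) = swap_at i (map f xs)"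
  by (simp add: swap_at_def map_update)

text \<open>A diagonal rescaling of the usual place action on words. The factors q and 1/q are
  distributed such that splitting needs no weight, while merging carries exactly the factor q or 1/q
  that \<open>eps\<close> records. On words of a length other than n it is the scalar q, a root of
  the quadratic relation, so that the relations hold for all functions.\<close>

definition hecke_op :: "'f::field \<Rightarrow> nat \<Rightarrow> nat \<Rightarrow> ('a::linorder list \<Rightarrow> 'f) \<Rightarrow> 'a list \<Rightarrow> 'f" where
  "hecke_op q n i g xs =
     (if length xs \<noteq> n \<or> xs ! i = xs ! Suc i then q * g xs
      else if xs ! i < xs ! Suc i then (q - 1 / q) * g xs + q * g (swap_at i xs)
      else 1 / q * g (swap_at i xs))"

text \<open>The matrix transpose of \<open>hecke_op\<close>: the off-diagonal factors q and 1/q have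
  changed places. It acts on the second argument of a kernel.\<close>

definition hecke_op_transpose :: "'f::field \<Rightarrow> nat \<Rightarrow> nat \<Rightarrow> ('a::linorder list \<Rightarrow> 'f) \<Rightarrow> 'a list \<Rightarrow> 'f" where
  "hecke_op_transpose q n i g xs =
     (if length xs \<noteq> n \<or> xs ! i = xs ! Suc i then q * g xs
      else if xs ! i < xs ! Suc i then (q - 1 / q) * g xs + 1 / q * g (swap_at i xs)
      else q * g (swap_at i xs))"

lemma hecke_op_pair:
  assumes "length (xs @ a # b # ys) = n"
  shows "hecke_op q n (length xs) g (xs @ a # b # ys) =
    (if a = b then q * g (xs @ a # b # ys)
     else if a < b then (q - 1 / q) * g (xs @ a # b # ys) + q * g (xs @ b # a # ys)
     else 1 / q * g (xs @ b # a # ys))"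
  using assms by (auto simp: hecke_op_def swap_at_append nth_append)

lemma hecke_op_alt:
  "hecke_op q n i g xs =
     (if length xs \<noteq> n \<or> xs ! i = xs ! Suc i then q * g xs
      else if xs ! i < xs ! Suc i then q * g xs - inverse q * g xs + q * g (swap_at i xs)
      else inverse q * g (swap_at i xs))"
  by (simp add: hecke_op_def field_class.field_divide_inverse algebra_simps)

lemma hecke_op_transpose_alt:
  "hecke_op_transpose q n i g xs =
     (if length xs \<noteq> n \<or> xs ! i = xs ! Suc i then q * g xs
      else if xs ! i < xs ! Suc i then q * g xs - inverse q * g xs + inverse q * g (swap_at i xs)
      else q * g (swap_at i xs))"
  by (simp add: hecke_op_transpose_def field_class.field_divide_inverse algebra_simps)

lemma hecke_op_quadratic:
  assumes "q \<noteq> 0" "Suc i < n"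
  shows "hecke_op q n i (hecke_op q n i g) xs = (q - 1 / q) * hecke_op q n i g xs + g xs"
  using assms by (auto simp: hecke_op_def nth_swap_at field_simps)

lemma hecke_op_commute:
  fixes g :: "'b::linorder list \<Rightarrow> 'f::field"
  assumes "Suc i < j" "Suc j < n"
  shows "hecke_op q n i (hecke_op q n j g) xs = hecke_op q n j (hecke_op q n i g) xs"
proof (cases "length xs = n")
  case True
  have 1: "swap_at i (swap_at j xs) = swap_at j (swap_at i xs)"
    using assms True by (intro nth_equalityI) (auto simp: nth_swap_at)
  have 2: "swap_at i xs ! j = xs ! j" "swap_at i xs ! Suc j = xs ! Suc j"
    "swap_at j xs ! i = xs ! i" "swap_at j xs ! Suc i = xs ! Suc i"
    using assms True by (auto simp: nth_swap_at)
  show ?thesis by (simp add: hecke_op_alt 1 2 algebra_simps)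
qed (simp add: hecke_op_def)

lemma hecke_op_braid:
  assumes "q \<noteq> 0" "Suc (Suc i) < n"
  shows "hecke_op q n i (hecke_op q n (Suc i) (hecke_op q n i g)) xs
       = hecke_op q n (Suc i) (hecke_op q n i (hecke_op q n (Suc i) g)) xs"
proof (cases "length xs = n")
  case True
  define us where "us = take i xs"
  define vs where "vs = drop (Suc (Suc (Suc i))) xs"
  define a b c where "a = xs ! i" and "b = xs ! Suc i" and "c = xs ! Suc (Suc i)"
  have xs: "xs = us @ a # b # c # vs"
    using True assms(2) unfolding us_def vs_def a_def b_def c_def
    by (simp add: Cons_nth_drop_Suc)
  have us: "length us = i" using True assms(2) by (simp add: us_def)
  have len: "length us + 3 + length vs = n" using True xs by simp
  \<comment> \<open>Inverses become a letter p with p q = 1, so that every case below is a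
    polynomial identity modulo that relation.\<close>
  define p where "p = inverse q"
  have pq: "p * q = 1" "q * p = 1" "p * (q * t) = t" "q * (p * t) = t" for t
    using assms(1) by (auto simp: p_def field_simps)
  have p1: "hecke_op q n i h (us @ x # y # z # vs) =
    (if x = y then q * h (us @ x # y # z # vs)
     else if x < y then q * h (us @ x # y # z # vs) - p * h (us @ x # y # z # vs) + q * h (us @ y # x # z # vs)
     else p * h (us @ y # x # z # vs))" for h x y z
    using hecke_op_pair[of us x y "z # vs" n q h] len us
    by (simp add: p_def field_class.field_divide_inverse algebra_simps)
  have p2: "hecke_op q n (Suc i) h (us @ x # y # z # vs) =
    (if y = z then q * h (us @ x # y # z # vs)
     else if y < z then q * h (us @ x # y # z # vs) - p * h (us @ x # y # z # vs) + q * h (us @ x # z # y # vs)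
     else p * h (us @ x # z # y # vs))" for h x y z
    using hecke_op_pair[of "us @ [x]" y z "vs" n q h] len us
    by (simp add: p_def field_class.field_divide_inverse algebra_simps)
  have rules:
    "hecke_op q n i h (us @ x # x # z # vs) = q * h (us @ x # x # z # vs)"
    "x < y \<Longrightarrow> hecke_op q n i h (us @ x # y # z # vs) =
       q * h (us @ x # y # z # vs) - p * h (us @ x # y # z # vs) + q * h (us @ y # x # z # vs)"
    "y < x \<Longrightarrow> hecke_op q n i h (us @ x # y # z # vs) = p * h (us @ y # x # z # vs)"
    "hecke_op q n (Suc i) h (us @ x # y # y # vs) = q * h (us @ x # y # y # vs)"
    "y < z \<Longrightarrow> hecke_op q n (Suc i) h (us @ x # y # z # vs) =
       q * h (us @ x # y # z # vs) - p * h (us @ x # y # z # vs) + q * h (us @ x # z # y # vs)"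
    "z < y \<Longrightarrow> hecke_op q n (Suc i) h (us @ x # y # z # vs) = p * h (us @ x # z # y # vs)"
    for h x y z using p1[of h x y z] p1[of h x x z] p2[of h x y z] p2[of h x y y] by auto
  show ?thesis unfolding xs
    by (cases a b rule: linorder_cases; cases b c rule: linorder_cases; cases a c rule: linorder_cases)
       (simp_all add: rules algebra_simps pq)
qed (simp add: hecke_op_def)

lemma hecke_op_add: "hecke_op q n i (u + v) = hecke_op q n i u + hecke_op q n i v"
  by (rule ext) (simp add: hecke_op_def algebra_simps)

lemma hecke_op_mult: "hecke_op q n i (\<lambda>x. c * g x) = (\<lambda>x. c * hecke_op q n i g x)"
  by (rule ext) (simp add: hecke_op_def algebra_simps)

lemma hecke_action_hecke_op:
  assumes "q \<noteq> (0::'f::field)"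
  shows "hecke_action (hecke_op q n :: nat \<Rightarrow> ('a::linorder list \<Rightarrow> 'f) \<Rightarrow> _) (\<lambda>g x. (q - 1 / q) * g x) (n - 1)"
proof
  show "hecke_op q n i (\<lambda>x. (q - 1 / q) * v x) = (\<lambda>x. (q - 1 / q) * hecke_op q n i v x)"
    for i and v :: "'a list \<Rightarrow> 'f" by (rule hecke_op_mult)
  show "hecke_op q n i (hecke_op q n j v) = hecke_op q n j (hecke_op q n i v)"
    if "i < n - 1" "j < n - 1" "Suc i < j" for i j and v :: "'a list \<Rightarrow> 'f"
    using that by (intro ext hecke_op_commute) auto
  show "hecke_op q n i (hecke_op q n (Suc i) (hecke_op q n i v))
      = hecke_op q n (Suc i) (hecke_op q n i (hecke_op q n (Suc i) v))"
    if "Suc i < n - 1" for i and v :: "'a list \<Rightarrow> 'f"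
    using that assms by (intro ext hecke_op_braid) auto
qed (auto simp: fun_eq_iff hecke_op_add hecke_op_quadratic assms)

section \<open>Unshuffling a descending word\<close>

definition select :: "bool list \<Rightarrow> 'a list \<Rightarrow> 'a list" where
  "select \<beta> ys = map fst (filter snd (zip ys \<beta>))"

definition unshuffle :: "bool list \<Rightarrow> 'a list \<Rightarrow> 'a list" where
  "unshuffle \<beta> ys = select \<beta> ys @ select (map Not \<beta>) ys"

lemma select_simps [simp]:
  "select [] ys = []" "select \<beta> [] = []"
  "select (b # \<beta>) (y # ys) = (if b then y # select \<beta> ys else select \<beta> ys)"
  by (auto simp: select_def)

lemma length_select: "length \<beta> = length ys \<Longrightarrow> length (select \<beta> ys) = trues \<beta>"
  by (induction \<beta> ys rule: list_induct2) auto

lemma set_select: "set (select \<beta> ys) \<subseteq> set ys"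
  by (auto simp: select_def dest: set_zip_leftD)

lemma length_unshuffle: "length \<beta> = length ys \<Longrightarrow> length (unshuffle \<beta> ys) = length ys"
  using trues_le[of \<beta>] by (simp add: unshuffle_def length_select trues_map_Not)

text \<open>Since v exceeds all letters that it passes, every operator of the run meets a descent,
  where it only swaps, with a factor t. The operator is abstract in order to cover both
  \<open>hecke_op\<close>, with t = 1/q, and its transpose, with t = q.\<close>

lemma foldr_run_eval:
  fixes g :: "'a::linorder list \<Rightarrow> 'f::field"
  assumes S: "\<And>i g xs. length xs = n \<Longrightarrow> Suc i < n \<Longrightarrow> xs ! Suc i < xs ! i \<Longrightarrow> S i g xs = t * g (swap_at i xs)"
    and "length xs = r" "\<forall>a\<in>set as. a < v" "length (xs @ v # as @ ys) = n"
  shows "foldr S [r..<r + length as] g (xs @ v # as @ ys) = t ^ length as * g (xs @ as @ v # ys)"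
  using assms(2-)
proof (induction as arbitrary: xs r)
  case (Cons a as)
  have "foldr S [r..<r + length (a # as)] g (xs @ v # (a # as) @ ys)
      = S r (foldr S [Suc r..<Suc r + length as] g) (xs @ v # a # as @ ys)"
    by (simp add: upt_r del: upt_Suc)
  also have "\<dots> = t * foldr S [Suc r..<Suc r + length as] g ((xs @ [a]) @ v # as @ ys)"
    using Cons.prems by (subst S) (auto simp: nth_append swap_at_append)
  also have "\<dots> = t * (t ^ length as * g ((xs @ [a]) @ as @ v # ys))"
    using Cons.prems by (subst Cons.IH) auto
  finally show ?case by simp
qed simp

lemma foldr_unshuffle_eval:
  fixes g :: "'a::linorder list \<Rightarrow> 'f::field"
  assumes S: "\<And>i g xs. length xs = n \<Longrightarrow> Suc i < n \<Longrightarrow> xs ! Suc i < xs ! i \<Longrightarrow> S i g xs = t * g (swap_at i xs)"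
    and "length \<beta> = length ys" "length xs = r" "sorted_wrt (>) ys" "length (xs @ ys @ zs) = n"
  shows "foldr S (unshuffle_word r \<beta>) g (xs @ ys @ zs)
       = t ^ length (unshuffle_word r \<beta>) * g (xs @ unshuffle \<beta> ys @ zs)"
  using assms(2-)
proof (induction \<beta> ys arbitrary: r xs g rule: list_induct2)
  case Nil
  then show ?case by (simp add: unshuffle_def)
next
  case (Cons b \<beta> y ys)
  have IH: "foldr S (unshuffle_word (Suc r) \<beta>) h (xs @ (y # ys) @ zs)
       = t ^ length (unshuffle_word (Suc r) \<beta>) * h ((xs @ [y]) @ unshuffle \<beta> ys @ zs)" for h
    using Cons.IH[of "xs @ [y]" "Suc r" h] Cons.prems by simp
  show ?case
  proof (cases b)
    case True
    then show ?thesis using IH[of g] by (simp add: unshuffle_def)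
  next
    case False
    have "foldr S [r..<r + trues \<beta>] g (xs @ y # select \<beta> ys @ select (map Not \<beta>) ys @ zs)
       = t ^ trues \<beta> * g (xs @ select \<beta> ys @ y # select (map Not \<beta>) ys @ zs)"
      using foldr_run_eval[where S = S and n = n and t = t and xs = xs and r = r and g = g and as = "select \<beta> ys"
          and v = y and ys = "select (map Not \<beta>) ys @ zs", OF S]
        Cons.prems Cons.hyps set_select[of \<beta> ys] length_unshuffle[of \<beta> ys]
      by (auto simp: length_select unshuffle_def subset_iff)
    then show ?thesis using False IH[of "foldr S [r..<r + trues \<beta>] g"]
      by (simp add: unshuffle_def power_add)
  qed
qed

lemma hecke_op_desc: "length xs = n \<Longrightarrow> Suc i < n \<Longrightarrow> xs ! Suc i < xs ! i \<Longrightarrow>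
    hecke_op q n i g xs = 1 / q * g (swap_at i xs)"
  by (auto simp: hecke_op_def)

lemma hecke_op_transpose_desc: "length xs = n \<Longrightarrow> Suc i < n \<Longrightarrow> xs ! Suc i < xs ! i \<Longrightarrow>
    hecke_op_transpose q n i g xs = q * g (swap_at i xs)"
  by (auto simp: hecke_op_transpose_def)

lemma foldr_hecke_op_mult:
  "foldr (hecke_op q n) js (\<lambda>x. c * g x) = (\<lambda>x. c * foldr (hecke_op q n) js g x)"
  by (induction js) (simp_all add: hecke_op_mult)

section \<open>Kernels that commute with the Hecke action\<close>

lemma hecke_op_transpose_foldr:
  fixes k :: "'a::linorder list \<Rightarrow> 'b::linorder list \<Rightarrow> 'f::field"
  shows "hecke_op_transpose q n i (\<lambda>z. foldr (hecke_op q n) js (\<lambda>x. k x z) x) z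
    = foldr (hecke_op q n) js (\<lambda>x. hecke_op_transpose q n i (k x) z) x"
proof (induction js arbitrary: x)
  case (Cons j js)
  have "hecke_op_transpose q n i (\<lambda>z. hecke_op q n j (\<lambda>x. k' x z) x) z
    = hecke_op q n j (\<lambda>x. hecke_op_transpose q n i (k' x) z) x" for k' :: "'a list \<Rightarrow> 'b list \<Rightarrow> 'f"
    by (simp add: hecke_op_alt hecke_op_transpose_alt algebra_simps)
  from this[of "\<lambda>x z. foldr (hecke_op q n) js (\<lambda>x. k x z) x"] Cons show ?case
    by (simp add: comp_def)
qed simp

text \<open>Matrices k with T k = k T; multiplication by T from the right is written as the
  transpose acting on the second argument.\<close>

definition hecke_kernel :: "'f::field \<Rightarrow> nat \<Rightarrow> ('a::linorder list \<Rightarrow> 'a list \<Rightarrow> 'f) \<Rightarrow> bool" where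
  "hecke_kernel q n k \<longleftrightarrow> (\<forall>i x z. Suc i < n \<longrightarrow>
     hecke_op q n i (\<lambda>x. k x z) x = hecke_op_transpose q n i (k x) z)"

lemma hecke_kernel_foldr:
  assumes "hecke_kernel q n k" "\<forall>j\<in>set js. Suc j < n"
  shows "foldr (hecke_op_transpose q n) js (k x) z = foldr (hecke_op q n) (rev js) (\<lambda>x. k x z) x"
  using assms(2)
proof (induction js arbitrary: x z)
  case (Cons j js)
  have "foldr (hecke_op_transpose q n) (j # js) (k x) z
      = hecke_op_transpose q n j (\<lambda>z. foldr (hecke_op q n) (rev js) (\<lambda>x. k x z) x) z"
  proof -
    have "foldr (hecke_op_transpose q n) js (k x) = (\<lambda>z. foldr (hecke_op q n) (rev js) (\<lambda>x. k x z) x)"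
      using Cons by (intro ext) simp
    then show ?thesis by simp
  qed
  also have "\<dots> = foldr (hecke_op q n) (rev js) (\<lambda>x. hecke_op_transpose q n j (k x) z) x"
    by (rule hecke_op_transpose_foldr)
  also have "(\<lambda>x. hecke_op_transpose q n j (k x) z) = hecke_op q n j (\<lambda>x. k x z)"
    using assms(1) Cons.prems by (auto simp: hecke_kernel_def fun_eq_iff)
  finally show ?case by simp
qed simp

lemma sum_fun_apply: "(sum f A) x = (\<Sum>a\<in>A. f a x)"
  by (induction A rule: infinite_finite_induct) auto

text \<open>Both sides are values of a relative norm applied to one column of \<open>k\<close>,
  evaluated at the word whose window is descending, so \<open>casimir_sym\<close> applies.\<close>

theorem hecke_kernel_unshuffle_sym:
  fixes k :: "'a::linorder list \<Rightarrow> 'a list \<Rightarrow> 'f::field"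
  assumes "q \<noteq> 0" and k: "hecke_kernel q n k" and ys: "sorted_wrt (>) ys" "length ys = a + b"
    and len: "length (xs @ ys @ zs) = n"
  shows "(\<Sum>\<beta>\<in>bool_words a b. k (xs @ unshuffle \<beta> ys @ zs) (xs @ unshuffle \<beta> ys @ zs))
       = (\<Sum>\<beta>\<in>bool_words b a. k (xs @ unshuffle \<beta> ys @ zs) (xs @ unshuffle \<beta> ys @ zs))"
proof -
  interpret hecke_action "hecke_op q n :: nat \<Rightarrow> ('a list \<Rightarrow> 'f) \<Rightarrow> _" "\<lambda>g x. (q - 1 / q) * g x" "n - 1"
    by (rule hecke_action_hecke_op[OF assms(1)])
  let ?r = "length xs" and ?y = "xs @ ys @ zs"
  \<comment> \<open>An entry at an unshuffled word is carried to the descending word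
    \<open>?y\<close>. In the second argument the transposed operators do this at the cost of q^l,
    with l the length of \<open>?w\<close>; in the first argument the operators themselves do it at
    the cost of q^(-l). Because k commutes with the action, the transposed operators can be moved to
    the first argument in reversed order, and T_\<beta> T_\<beta>* appears.\<close>
  have diag: "k (xs @ unshuffle \<beta> ys @ zs) (xs @ unshuffle \<beta> ys @ zs) = shuffle_act ?r \<beta> (\<lambda>x. k x ?y) ?y"
    if "length \<beta> = length ys" for \<beta>
  proof -
    let ?w = "unshuffle_word ?r \<beta>" and ?u = "xs @ unshuffle \<beta> ys @ zs"
    have w: "\<forall>j\<in>set ?w. Suc j < n"
      using set_unshuffle_word[of ?r \<beta>] that len by fastforce
    have "foldr (hecke_op_transpose q n) ?w (k x) ?y = q ^ length ?w * k x ?u" for x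
      by (rule foldr_unshuffle_eval) (use that ys len in \<open>auto simp: hecke_op_transpose_desc\<close>)
    then have 1: "foldr (hecke_op q n) (rev ?w) (\<lambda>x. k x ?y) = (\<lambda>x. q ^ length ?w * k x ?u)"
      using hecke_kernel_foldr[OF k w, of _ ?y] by (simp add: fun_eq_iff)
    have "foldr (hecke_op q n) ?w (\<lambda>x. k x ?u) ?y = (1 / q) ^ length ?w * k ?u ?u"
      by (rule foldr_unshuffle_eval) (use that ys len in \<open>auto simp: hecke_op_desc\<close>)
    then show ?thesis using assms(1)
      by (simp add: shuffle_act_def 1 foldr_hecke_op_mult power_one_over)
  qed
  have "(\<Sum>\<beta>\<in>bool_words c d. k (xs @ unshuffle \<beta> ys @ zs) (xs @ unshuffle \<beta> ys @ zs))
      = casimir ?r c d (\<lambda>x. k x ?y) ?y" if "c + d = a + b" for c d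
    unfolding casimir_def sum_fun_apply using that ys diag
    by (intro sum.cong) (auto simp: bool_words_def)
  from this[of a b] this[of b a] show ?thesis
    using casimir_sym[of ?r a b "\<lambda>x. k x ?y"] len ys(2) by (simp add: add.commute)
qed

section \<open>Merges and splits as Hecke module maps\<close>

text \<open>In the web, letters are horizontal positions and places are ranks, so the factor of a
  merged pair is q to the power \<open>eps\<close> of the left and the right loop.\<close>

definition pair_weight :: "'f::field \<Rightarrow> ('a::linorder \<Rightarrow> 'b) \<Rightarrow> 'a \<Rightarrow> 'a \<Rightarrow> 'f" where
  "pair_weight q \<phi> x y = (if \<phi> x = \<phi> y \<and> x < y then q else if \<phi> x = \<phi> y \<and> y < x then 1 / q else 1)"

definition merge_weight :: "'f::field \<Rightarrow> ('a::linorder \<Rightarrow> 'b) \<Rightarrow> 'a list \<Rightarrow> 'f" where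
  "merge_weight q \<phi> xs = (\<Prod>(i, j)\<in>{(i, j). i < j \<and> j < length xs}. pair_weight q \<phi> (xs ! i) (xs ! j))"

lemma finite_index_pairs [simp]: "finite {(i, j). i < j \<and> j < (n::nat)}"
  by (rule finite_subset[of _ "{..<n} \<times> {..<n}"]) auto

text \<open>The transposition of places permutes all pairs other than (i, i + 1), so only the factor
  of that pair changes.\<close>

lemma merge_weight_swap_at:
  assumes i: "Suc i < length xs"
  shows "merge_weight q \<phi> (swap_at i xs) * pair_weight q \<phi> (xs ! i) (xs ! Suc i)
       = merge_weight q \<phi> xs * pair_weight q \<phi> (xs ! Suc i) (xs ! i)"
proof -
  let ?n = "length xs"
  define P where "P = {(r, s). r < s \<and> s < ?n} - {(i, Suc i)}"
  define t where "t r = (if r = i then Suc i else if r = Suc i then i else r)" for r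
  have P: "{(r, s). r < s \<and> s < ?n} = insert (i, Suc i) P" "(i, Suc i) \<notin> P" "finite P"
    using i by (auto simp: P_def)
  have tt: "t (t r) = r" for r by (auto simp: t_def)
  have tP: "(t r, t s) \<in> P" if "(r, s) \<in> P" for r s
    using that i by (auto simp: P_def t_def)
  have nth: "swap_at i xs ! r = xs ! t r" if "r < ?n" for r
    using that i by (auto simp: nth_swap_at t_def)
  have "(\<Prod>(r, s)\<in>P. pair_weight q \<phi> (swap_at i xs ! r) (swap_at i xs ! s))
      = (\<Prod>(r, s)\<in>P. pair_weight q \<phi> (xs ! r) (xs ! s))"
    by (rule prod.reindex_bij_witness[of _ "\<lambda>(r, s). (t r, t s)" "\<lambda>(r, s). (t r, t s)"])
       (auto simp: tt tP, auto simp: nth P_def)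
  then show ?thesis
    using i by (simp add: merge_weight_def P nth_swap_at)
qed

definition merge_op :: "'f::field \<Rightarrow> nat \<Rightarrow> 'a::linorder set \<Rightarrow> ('a \<Rightarrow> 'b) \<Rightarrow> ('b list \<Rightarrow> 'f) \<Rightarrow> 'a list \<Rightarrow> 'f" where
  "merge_op q n X \<phi> h xs =
     (if length xs = n \<and> set xs \<subseteq> X then merge_weight q \<phi> xs * h (map \<phi> xs) else 0)"

text \<open>Functions are pushed forward along \<open>map \<psi>\<close>, whereas
  \<open>merge_op\<close> pulls them back. In the web \<open>S\<close> fixes how many strands sit at
  each position, so that its words span a permutation module.\<close>

definition split_op :: "'a list set \<Rightarrow> ('a \<Rightarrow> 'b) \<Rightarrow> ('a list \<Rightarrow> 'f::field) \<Rightarrow> 'b list \<Rightarrow> 'f" where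
  "split_op S \<psi> g ys = (\<Sum>xs | xs \<in> S \<and> map \<psi> xs = ys. g xs)"

lemma set_swap_at: "Suc i < length xs \<Longrightarrow> set (swap_at i xs) = set xs"
  by (simp add: swap_at_def)

text \<open>If the two letters merge, the merged word has a repetition, on which T is the scalar q;
  before merging, the weights q and 1/q of the two orders form an eigenvector of T for q. If they do
  not merge, monotonicity of \<phi> keeps ascents ascents, and the swap does not change the
  weight.\<close>

lemma hecke_op_merge_op:
  fixes \<phi> :: "'a::linorder \<Rightarrow> 'b::linorder"
  assumes "q \<noteq> 0" "mono_on X \<phi>" "Suc i < n"
  shows "hecke_op q n i (merge_op q n X \<phi> h) = merge_op q n X \<phi> (hecke_op q n i h)"
proof
  fix xs
  show "hecke_op q n i (merge_op q n X \<phi> h) xs = merge_op q n X \<phi> (hecke_op q n i h) xs"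
  proof (cases "length xs = n \<and> set xs \<subseteq> X")
    case False
    then show ?thesis using assms(3) by (auto simp: hecke_op_def merge_op_def set_swap_at)
  next
    case True
    then have i: "Suc i < length xs" and X: "xs ! i \<in> X" "xs ! Suc i \<in> X" using assms(3) by auto
    have swap_same: "swap_at i ys = ys" if "ys ! i = ys ! Suc i" "Suc i < length ys" for ys :: "'b list"
      using that by (intro nth_equalityI) (auto simp: nth_swap_at)
    note w = merge_weight_swap_at[OF i, of q \<phi>]
    show ?thesis
    proof (cases "\<phi> (xs ! i) = \<phi> (xs ! Suc i)")
      case eq: True
      then have "hecke_op q n i h (map \<phi> xs) = q * h (map \<phi> xs)"
        using i by (simp add: hecke_op_def)
      moreover have "map \<phi> (swap_at i xs) = map \<phi> xs"
        using i eq by (simp add: map_swap_at swap_same)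
      ultimately show ?thesis
        using True w eq assms(1) i
        by (cases "xs ! i" "xs ! Suc i" rule: linorder_cases)
           (auto simp: hecke_op_def merge_op_def set_swap_at pair_weight_def field_simps)
    next
      case neq: False
      then have "merge_weight q \<phi> (swap_at i xs) = merge_weight q \<phi> xs"
        using w by (simp add: pair_weight_def)
      moreover have "xs ! i < xs ! Suc i \<longleftrightarrow> \<phi> (xs ! i) < \<phi> (xs ! Suc i)"
        using mono_onD[OF assms(2) X] mono_onD[OF assms(2) X(2,1)] neq
        by (metis leD leI order_less_le)
      ultimately show ?thesis
        using True neq i by (auto simp: hecke_op_def merge_op_def set_swap_at map_swap_at algebra_simps)
    qed
  qed
qed

text \<open>Over a word with a repetition the fibre is stable under the swap, and summing T over an
  ascent and its swapped descent gives column sums (q - 1/q) + 1/q = q and q. Over any other word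
  the swap carries fibre to fibre, and monotonicity of \<psi> makes ascents above and below
  agree.\<close>

lemma hecke_op_split_op:
  fixes \<psi> :: "'a::linorder \<Rightarrow> 'b::linorder"
  assumes "q \<noteq> 0" "mono_on X \<psi>" "Suc i < n"
    and S: "finite S" "\<And>xs. xs \<in> S \<Longrightarrow> length xs = n \<and> set xs \<subseteq> X" "\<And>xs. xs \<in> S \<Longrightarrow> swap_at i xs \<in> S"
  shows "hecke_op q n i (split_op S \<psi> g) = split_op S \<psi> (hecke_op q n i g)"
proof
  fix ys
  define F where "F zs = {xs \<in> S. map \<psi> xs = zs}" for zs
  have fin: "finite (F zs)" for zs using S(1) by (simp add: F_def)
  have lenF: "length xs = n" if "xs \<in> F zs" for xs zs using that S(2) by (auto simp: F_def)
  have sF: "split_op S \<psi> h zs = sum h (F zs)" for h :: "'a list \<Rightarrow> _" and zs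
    by (simp add: split_op_def F_def)
  show "hecke_op q n i (split_op S \<psi> g) ys = split_op S \<psi> (hecke_op q n i g) ys"
  proof (cases "length ys = n")
    case False
    then have "F ys = {}" using S(2) by (auto simp: F_def)
    then show ?thesis using False by (simp add: hecke_op_def sF)
  next
    case len: True
    have swF: "swap_at i xs \<in> F (swap_at i zs)" "swap_at i (swap_at i xs) = xs" if "xs \<in> F zs" for xs zs
      using that assms(3) S by (auto simp: F_def map_swap_at)
    have sw2: "swap_at i (swap_at i ys) = ys" using len assms(3) by simp
    have bij: "bij_betw (swap_at i) (F ys) (F (swap_at i ys))"
      by (rule bij_betwI[of _ _ _ "swap_at i"]) (use swF swF[of _ "swap_at i ys", unfolded sw2] in auto)
    have nth: "ys ! i = \<psi> (xs ! i)" "ys ! Suc i = \<psi> (xs ! Suc i)" "xs ! i \<in> X" "xs ! Suc i \<in> X"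
      if "xs \<in> F ys" for xs using that assms(3) S(2)[of xs] by (auto simp: F_def)
    show ?thesis
    proof (cases "ys ! i = ys ! Suc i")
      case eq: True
      then have sys: "swap_at i ys = ys"
        using len assms(3) by (intro nth_equalityI) (auto simp: nth_swap_at)
      define A D E where "A = {xs \<in> F ys. xs ! i < xs ! Suc i}" and "D = {xs \<in> F ys. xs ! Suc i < xs ! i}"
        and "E = {xs \<in> F ys. xs ! i = xs ! Suc i}"
      have finA: "finite A" "finite D" "finite E" using fin by (auto simp: A_def D_def E_def)
      have F: "F ys = E \<union> (A \<union> D)" "E \<inter> (A \<union> D) = {}" "A \<inter> D = {}" by (auto simp: A_def D_def E_def)
      have bijA: "bij_betw (swap_at i) A D" and bijD: "bij_betw (swap_at i) D A"
        by (rule bij_betwI[of _ _ _ "swap_at i"];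
            use swF[of _ ys, unfolded sys] assms(3) lenF in \<open>auto simp: A_def D_def nth_swap_at\<close>)+
      have "(\<Sum>xs\<in>A. hecke_op q n i g xs) = (\<Sum>xs\<in>A. (q - 1 / q) * g xs + q * g (swap_at i xs))"
        using lenF by (intro sum.cong) (auto simp: A_def hecke_op_def)
      also have "\<dots> = (q - 1 / q) * sum g A + q * sum g D"
        by (simp add: sum.distrib sum_distrib_left flip: sum.reindex_bij_betw[OF bijA])
      finally have 1: "(\<Sum>xs\<in>A. hecke_op q n i g xs) = (q - 1 / q) * sum g A + q * sum g D" .
      have "(\<Sum>xs\<in>D. hecke_op q n i g xs) = (\<Sum>xs\<in>D. 1 / q * g (swap_at i xs))"
      proof (rule sum.cong[OF refl])
        fix xs assume "xs \<in> D"
        then show "hecke_op q n i g xs = 1 / q * g (swap_at i xs)"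
          using assms(3) lenF[of xs ys] by (intro hecke_op_desc) (simp_all add: D_def)
      qed
      also have "\<dots> = 1 / q * sum g A"
        by (simp only: sum.reindex_bij_betw[OF bijD, symmetric] sum_distrib_left)
      finally have 2: "(\<Sum>xs\<in>D. hecke_op q n i g xs) = 1 / q * sum g A" .
      have 3: "(\<Sum>xs\<in>E. hecke_op q n i g xs) = q * sum g E"
        by (simp add: E_def hecke_op_def sum_distrib_left)
      have "hecke_op q n i (split_op S \<psi> g) ys = q * split_op S \<psi> g ys"
        using eq by (simp add: hecke_op_def)
      then show ?thesis
        by (simp add: sF F sum.union_disjoint finA 1 2 3 algebra_simps)
    next
      case neq: False
      have asc: "xs ! i < xs ! Suc i \<longleftrightarrow> ys ! i < ys ! Suc i" "xs ! i \<noteq> xs ! Suc i" if "xs \<in> F ys" for xs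
      proof -
        have "xs ! i \<le> xs ! Suc i \<Longrightarrow> ys ! i \<le> ys ! Suc i" "xs ! Suc i \<le> xs ! i \<Longrightarrow> ys ! Suc i \<le> ys ! i"
          unfolding nth(1,2)[OF that]
          by (rule mono_onD[OF assms(2) nth(3,4)[OF that]], assumption,
              rule mono_onD[OF assms(2) nth(4,3)[OF that]], assumption)
        note le = this
        show "xs ! i \<noteq> xs ! Suc i" using le neq by (metis order_refl order_antisym)
        show "xs ! i < xs ! Suc i \<longleftrightarrow> ys ! i < ys ! Suc i" using le neq by (meson antisym_conv less_le_not_le linear)
      qed
      have sw: "split_op S \<psi> g (swap_at i ys) = (\<Sum>xs\<in>F ys. g (swap_at i xs))"
        by (simp only: sF sum.reindex_bij_betw[OF bij, symmetric])
      show ?thesis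
      proof (cases "ys ! i < ys ! Suc i")
        case True
        then have "split_op S \<psi> (hecke_op q n i g) ys = (\<Sum>xs\<in>F ys. (q - 1 / q) * g xs + q * g (swap_at i xs))"
          unfolding sF by (intro sum.cong) (auto simp: hecke_op_def lenF asc)
        then show ?thesis using True neq len
          by (simp add: hecke_op_def sw sum.distrib sum_distrib_left) (simp add: sF sum_distrib_left)
      next
        case False
        then have "split_op S \<psi> (hecke_op q n i g) ys = (\<Sum>xs\<in>F ys. 1 / q * g (swap_at i xs))"
          unfolding sF by (intro sum.cong) (auto simp: hecke_op_def lenF asc)
        then show ?thesis using False neq len
          by (simp add: hecke_op_def sw sum_divide_distrib)
      qed
    qed
  qed
qed

text \<open>The matrix of K is read off from indicator functions. \<open>hecke_op\<close> sends an
  indicator to a combination of at most two indicators, and the coefficients \<open>c\<close> and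
  \<open>d\<close> are those of the transpose.\<close>

lemma hecke_kernelI:
  fixes K :: "('a::linorder list \<Rightarrow> 'f::field) \<Rightarrow> 'a list \<Rightarrow> 'f"
  assumes "q \<noteq> 0" and comm: "\<And>i g. Suc i < n \<Longrightarrow> hecke_op q n i (K g) = K (hecke_op q n i g)"
    and lin: "\<And>c d g h x. K (\<lambda>y. c * g y + d * h y) x = c * K g x + d * K h x"
    and len: "\<And>g x. length x \<noteq> n \<Longrightarrow> K g x = 0"
  shows "hecke_kernel q n (\<lambda>x z. if length z = n then K (\<lambda>y. of_bool (y = z)) x else 0)"
  unfolding hecke_kernel_def
proof (intro allI impI)
  fix i and x z :: "'a list"
  assume i: "Suc i < n"
  let ?\<delta> = "\<lambda>z y. of_bool (y = z) :: 'f"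
  show "hecke_op q n i (\<lambda>x. if length z = n then K (?\<delta> z) x else 0) x
      = hecke_op_transpose q n i (\<lambda>z. if length z = n then K (?\<delta> z) x else 0) z"
  proof (cases "length z = n \<and> length x = n")
    case False
    then show ?thesis using len by (auto simp: hecke_op_def hecke_op_transpose_def)
  next
    case True
    have sw: "swap_at i y = z \<longleftrightarrow> y = swap_at i z" if "length y = n" for y
      using that True i swap_at_swap_at[of i y] swap_at_swap_at[of i z] by metis
    have eq: "swap_at i z = z" if "z ! i = z ! Suc i"
      using that True i by (intro nth_equalityI) (auto simp: nth_swap_at)
    define c where "c = (if z ! i = z ! Suc i then q else if z ! i < z ! Suc i then q - 1 / q else 0)"
    define d where "d = (if z ! i = z ! Suc i then 0 else if z ! i < z ! Suc i then 1 / q else q)"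
    have "hecke_op q n i (?\<delta> z) = (\<lambda>y. c * ?\<delta> z y + d * ?\<delta> (swap_at i z) y)"
    proof
      fix y
      have nz: "swap_at i z ! i = z ! Suc i" "swap_at i z ! Suc i = z ! i"
        using True i by (auto simp: nth_swap_at)
      show "hecke_op q n i (?\<delta> z) y = c * ?\<delta> z y + d * ?\<delta> (swap_at i z) y"
      proof (cases "length y = n")
        case False
        then have "y \<noteq> z" "y \<noteq> swap_at i z" using True by auto
        then show ?thesis using False by (simp add: hecke_op_def)
      next
        case ly: True
        have neq: "z ! i \<noteq> z ! Suc i \<Longrightarrow> swap_at i z \<noteq> z" using nz by metis
        consider "y = z" | "y = swap_at i z" "y \<noteq> z" | "y \<noteq> z" "y \<noteq> swap_at i z" by blast
        then show ?thesis
        proof cases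
          case 1
          then show ?thesis using ly eq neq
            by (cases "z ! i = z ! Suc i") (auto simp: hecke_op_def c_def d_def)
        next
          case 2
          then have "z ! i \<noteq> z ! Suc i" using eq by auto
          moreover have "swap_at i y = z" using 2 True i by simp
          ultimately show ?thesis using ly 2 nz
            by (auto simp: hecke_op_def c_def d_def)
        next
          case 3
          then show ?thesis using ly sw[OF ly] by (auto simp: hecke_op_def)
        qed
      qed
    qed
    then have "hecke_op q n i (K (?\<delta> z)) x = c * K (?\<delta> z) x + d * K (?\<delta> (swap_at i z)) x"
      using comm[OF i, of "?\<delta> z"] lin by simp
    moreover have "hecke_op q n i (\<lambda>x. if length z = n then K (?\<delta> z) x else 0) x = hecke_op q n i (K (?\<delta> z)) x"
      using True by simp
    ultimately show ?thesis
      using True by (simp add: hecke_op_transpose_def c_def d_def)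
  qed
qed

section \<open>Strands of an annular web\<close>

lemma frac_eq_iff: "frac x = frac y \<longleftrightarrow> (\<exists>k. x = y + of_int k)" for x y :: real
proof
  assume "frac x = frac y"
  then have "x = y + of_int (\<lfloor>x\<rfloor> - \<lfloor>y\<rfloor>)" by (simp add: frac_def)
  then show "\<exists>k. x = y + of_int k" by blast
qed auto

lemma frac_eq_add: "frac x = frac y \<Longrightarrow> frac (x + d) = frac (y + d)" for x y :: real
  unfolding frac_eq_iff by force

lemma finite_frac_eq: "finite {s::real. a \<le> s \<and> s \<le> b \<and> frac s = c}"
proof (rule finite_subset)
  show "{s. a \<le> s \<and> s \<le> b \<and> frac s = c} \<subseteq> (\<lambda>k. of_int k + c) ` {\<lfloor>a\<rfloor>..\<lfloor>b\<rfloor>}"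
  proof clarify
    fix s assume "a \<le> s" "s \<le> b" "c = frac s"
    then show "s \<in> (\<lambda>k. of_int k + frac s) ` {\<lfloor>a\<rfloor>..\<lfloor>b\<rfloor>}"
      by (intro image_eqI[of _ _ "\<lfloor>s\<rfloor>"]) (auto simp: frac_def floor_mono)
  qed
qed simp

lemma continuous_on_frac_compose:
  fixes f :: "real \<Rightarrow> real"
  assumes f: "continuous_on {0..1} f" and eq: "f 0 = f 1"
  shows "continuous_on UNIV (\<lambda>t. f (frac t))"
proof -
  let ?g = "\<lambda>t. f (frac t)"
  have unit: "continuous_on {of_int k..of_int k + 1} ?g" for k
  proof -
    have "continuous_on {of_int k..of_int k + 1} (\<lambda>t. f (t - of_int k))"
      by (intro continuous_on_compose2[OF f] continuous_intros) auto
    moreover have "?g t = f (t - of_int k)" if "t \<in> {of_int k..of_int k + 1}" for t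
    proof (cases "t = of_int k + 1")
      case True
      then have "frac t = 0" by (simp add: frac_eq_0_iff[THEN iffD2])
      then show ?thesis using True eq by simp
    next
      case False
      then have "\<lfloor>t\<rfloor> = k" using that by (intro floor_unique) auto
      then show ?thesis by (simp add: frac_def)
    qed
    ultimately show ?thesis by (subst continuous_on_cong) auto
  qed
  have "isCont ?g t" for t
  proof -
    let ?k = "\<lfloor>t\<rfloor>"
    have un: "{of_int (?k - 1)..of_int (?k - 1) + 1} \<union> {of_int ?k..of_int ?k + 1} = {of_int ?k - 1..of_int ?k + 1 :: real}"
      by auto
    have "continuous_on {of_int ?k - 1..of_int ?k + 1} ?g"
      unfolding un[symmetric] by (intro continuous_on_closed_Un unit) auto
    moreover have "t \<in> interior {of_int ?k - 1..of_int ?k + 1}"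
      by (simp add: interior_atLeastAtMost_real) linarith
    ultimately show ?thesis by (rule continuous_on_interior)
  qed
  then show ?thesis by (intro continuous_at_imp_continuous_on) auto
qed

section \<open>Edges as strands over the universal cover\<close>

definition is_layer :: "'e web \<Rightarrow> real \<Rightarrow> real \<Rightarrow> real \<Rightarrow> bool" where
  "is_layer w y z y' \<longleftrightarrow> y < z \<and> z < y' \<and> (\<forall>t. y \<le> t \<and> t \<le> y' \<and> t \<noteq> z \<longrightarrow> frac t \<notin> snd ` vertices w)"

definition slots :: "'e web \<Rightarrow> real \<Rightarrow> real set" where
  "slots w t = cut_positions w (frac t)"

definition slot_edge :: "'e web \<Rightarrow> real \<Rightarrow> real \<Rightarrow> 'e" where
  "slot_edge w t x = edge_at w (x, frac t)"

context annular_web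
begin

definition circle :: "'e \<Rightarrow> bool" where
  "circle e \<longleftrightarrow> tail w e \<notin> vertices w"

definition period :: "'e \<Rightarrow> real" where
  "period e = high w e - low w e"

text \<open>
  A circle is continued periodically, so that a strand can be followed past the base point where
  it is cut open.
\<close>

definition curve :: "'e \<Rightarrow> real \<Rightarrow> real" where
  "curve e s = (if circle e then xpos w e (low w e + period e * frac ((s - low w e) / period e)) else xpos w e s)"

definition curve_dom :: "'e \<Rightarrow> real set" where
  "curve_dom e = (if circle e then UNIV else {low w e..high w e})"

text \<open>The heights at which the strand is not at a vertex. The base point of a circle counts as
  inner, being an artefact of the parametrisation.\<close>

definition curve_inner :: "'e \<Rightarrow> real set" where
  "curve_inner e = (if circle e then UNIV else {low w e<..<high w e})"

lemma period_pos: "e \<in> edges w \<Longrightarrow> period e > 0"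
  using edge_upward by (simp add: period_def)

lemma circle_ends:
  assumes "e \<in> edges w" "circle e"
  shows "xpos w e (high w e) = xpos w e (low w e)" "\<exists>k. period e = of_int k"
proof -
  have "head w e = tail w e" using assms edge_ends by (auto simp: circle_def)
  then have "xpos w e (high w e) = xpos w e (low w e)" "frac (high w e) = frac (low w e)"
    by (auto simp: head_def tail_def edge_point_def)
  then show "xpos w e (high w e) = xpos w e (low w e)" "\<exists>k. period e = of_int k"
    by (auto simp: frac_eq_iff period_def)
qed

lemma noncircle_ends:
  assumes "e \<in> edges w" "\<not> circle e"
  shows "tail w e \<in> vertices w" "head w e \<in> vertices w"
  using assms edge_ends by (auto simp: circle_def)

lemma continuous_on_curve:
  assumes "e \<in> edges w"
  shows "continuous_on (curve_dom e) (curve e)"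
proof (cases "circle e")
  case True
  let ?f = "\<lambda>u. xpos w e (low w e + period e * u)"
  have "low w e + period e * u \<in> {low w e..high w e}" if "u \<in> {0..1}" for u
  proof -
    have "0 \<le> period e * u" "period e * u \<le> period e * 1"
      using that period_pos[OF assms] by (auto intro!: mult_left_mono simp del: mult_1_right)
    moreover have "period e * 1 = high w e - low w e" by (simp add: period_def)
    ultimately show ?thesis by simp
  qed
  then have "continuous_on {0..1} ?f"
    by (intro continuous_on_compose2[OF edge_continuous[OF assms]] continuous_intros) auto
  moreover have "?f 0 = ?f 1" using circle_ends(1)[OF assms True] by (simp add: period_def)
  ultimately have "continuous_on UNIV (\<lambda>t. ?f (frac t))" by (rule continuous_on_frac_compose)
  then have "continuous_on UNIV (\<lambda>s. ?f (frac ((s - low w e) / period e)))"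
    by (rule continuous_on_compose2) (use period_pos[OF assms] in \<open>auto intro!: continuous_intros\<close>)
  then show ?thesis using True by (simp add: curve_def[abs_def] curve_dom_def)
next
  case False
  then show ?thesis using edge_continuous[OF assms] by (simp add: curve_def[abs_def] curve_dom_def)
qed

text \<open>Embeddedness is available on \<open>edge_dom\<close> only, which for a circle is a
  single period, so heights on the periodic continuation are reduced to it. The reduction preserves
  the point of the annulus because the period of a circle is an integer.\<close>

lemma curve_inner_reduce:
  assumes e: "e \<in> edges w" and s: "s \<in> curve_inner e"
  obtains s0 j where "s0 \<in> edge_dom w e" "curve e s = xpos w e s0" "frac s0 = frac s"
    "s = s0 + of_int j * period e" "\<not> circle e \<Longrightarrow> s = s0"
proof (cases "circle e")
  case True
  define j where "j = \<lfloor>(s - low w e) / period e\<rfloor>"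
  define s0 where "s0 = low w e + period e * frac ((s - low w e) / period e)"
  have p: "period e > 0" using period_pos[OF e] .
  have s0: "s = s0 + of_int j * period e" using p by (simp add: s0_def j_def frac_def field_simps)
  obtain k where "period e = of_int k" using circle_ends(2)[OF e True] by blast
  then have "s = s0 + of_int (j * k)" using s0 by simp
  then have fr: "frac s0 = frac s" by (simp only: frac_add_of_int_right)
  have "s0 - low w e < period e"
    using mult_strict_left_mono[OF frac_lt_1[of "(s - low w e) / period e"] p] by (simp add: s0_def)
  moreover have "low w e \<le> s0" using p by (simp add: s0_def)
  ultimately have "s0 \<in> edge_dom w e"
    using True by (simp add: edge_dom_def circle_def period_def)
  moreover have "curve e s = xpos w e s0" using True by (simp add: curve_def s0_def)
  ultimately show ?thesis using that s0 fr True by blast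
next
  case False
  then show ?thesis using that[of s 0] s by (simp add: curve_def curve_inner_def edge_dom_def circle_def)
qed

lemma curve_edge_dom:
  assumes e: "e \<in> edges w" and s: "s \<in> edge_dom w e"
  shows "s \<in> curve_inner e" "curve e s = xpos w e s"
proof -
  show "s \<in> curve_inner e" using s by (auto simp: edge_dom_def curve_inner_def circle_def)
  show "curve e s = xpos w e s"
  proof (cases "circle e")
    case True
    then have "0 \<le> (s - low w e) / period e" "(s - low w e) / period e < 1"
      using s period_pos[OF e] by (auto simp: edge_dom_def circle_def period_def)
    then have "frac ((s - low w e) / period e) = (s - low w e) / period e" by (simp add: frac_eq)
    then show ?thesis using True period_pos[OF e] by (simp add: curve_def)
  qed (simp add: curve_def)
qed

lemma curve_periodic:
  assumes "e \<in> edges w" "circle e"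
  shows "curve e (s + of_int j * period e) = curve e s"
proof -
  have "(s + of_int j * period e - low w e) / period e = (s - low w e) / period e + of_int j"
    using period_pos[OF assms(1)] by (simp add: field_simps)
  then show ?thesis using assms(2) by (simp add: curve_def)
qed

text \<open>Two heights on a circle may denote the same point and differ by periods. The third claim
  covers this case: after any common shift d the two strands still agree.\<close>

lemma curve_inj:
  assumes e: "e \<in> edges w" "e' \<in> edges w" and s: "s \<in> curve_inner e" "s' \<in> curve_inner e'"
    and eq: "curve e s = curve e' s'" "frac s = frac s'"
  shows "e = e'" "\<not> circle e \<Longrightarrow> s = s'" "curve e (s + d) = curve e' (s' + d)"
proof -
  obtain s0 j where s0: "s0 \<in> edge_dom w e" "curve e s = xpos w e s0" "frac s0 = frac s"
    "s = s0 + of_int j * period e" "\<not> circle e \<Longrightarrow> s = s0"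
    using curve_inner_reduce[OF e(1) s(1)] by blast
  obtain s1 k where s1: "s1 \<in> edge_dom w e'" "curve e' s' = xpos w e' s1" "frac s1 = frac s'"
    "s' = s1 + of_int k * period e'" "\<not> circle e' \<Longrightarrow> s' = s1"
    using curve_inner_reduce[OF e(2) s(2)] by blast
  have "(e, s0) = (e', s1)"
    using inj_onD[OF edges_embedded, of "(e, s0)" "(e', s1)"] e s0 s1 eq
    by (auto simp: edge_point_def)
  then show 1: "e = e'" "\<not> circle e \<Longrightarrow> s = s'" using s0 s1 by auto
  show "curve e (s + d) = curve e' (s' + d)"
  proof (cases "circle e")
    case True
    have "s + d = (s0 + d) + of_int j * period e" "s' + d = (s0 + d) + of_int k * period e"
      using s0 s1 \<open>(e, s0) = (e', s1)\<close> by auto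
    then show ?thesis using curve_periodic[OF e(1) True] 1 by metis
  qed (use 1 in auto)
qed

lemma curve_avoids_vertices:
  assumes "e \<in> edges w" "s \<in> curve_inner e"
  shows "(curve e s, frac s) \<notin> vertices w"
proof -
  obtain s0 where "s0 \<in> edge_dom w e" "curve e s = xpos w e s0" "frac s0 = frac s"
    using curve_inner_reduce[OF assms] by blast
  then show ?thesis using edges_avoid_vertices[OF assms(1), of s0] by (simp add: edge_point_def)
qed

lemma curve_end:
  assumes "e \<in> edges w" "s \<in> curve_dom e" "s \<notin> curve_inner e"
  shows "\<not> circle e" "s = low w e \<or> s = high w e" "(curve e s, frac s) \<in> vertices w"
proof -
  show nc: "\<not> circle e" using assms by (auto simp: curve_dom_def curve_inner_def)
  then show s: "s = low w e \<or> s = high w e"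
    using assms by (auto simp: curve_dom_def curve_inner_def)
  have "(xpos w e (low w e), frac (low w e)) \<in> vertices w" "(xpos w e (high w e), frac (high w e)) \<in> vertices w"
    using noncircle_ends[OF assms(1) nc] by (simp_all add: head_def tail_def edge_point_def)
  then show "(curve e s, frac s) \<in> vertices w" using nc s by (auto simp: curve_def)
qed

lemma slots_eq: "slots w t = {curve e s |e s. e \<in> edges w \<and> s \<in> curve_inner e \<and> frac s = frac t}"
proof (intro set_eqI iffI)
  fix x assume "x \<in> slots w t"
  then obtain e s where "e \<in> edges w" "s \<in> edge_dom w e" "xpos w e s = x" "frac s = frac t"
    by (auto simp: slots_def cut_positions_def edge_point_def)
  then show "x \<in> {curve e s |e s. e \<in> edges w \<and> s \<in> curve_inner e \<and> frac s = frac t}"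
    using curve_edge_dom[of e s] by force
next
  fix x assume "x \<in> {curve e s |e s. e \<in> edges w \<and> s \<in> curve_inner e \<and> frac s = frac t}"
  then obtain e s where "e \<in> edges w" "s \<in> curve_inner e" "x = curve e s" "frac s = frac t" by blast
  moreover from this obtain s0 where "s0 \<in> edge_dom w e" "curve e s = xpos w e s0" "frac s0 = frac s"
    using curve_inner_reduce[of e s] by blast
  ultimately show "x \<in> slots w t"
    by (auto simp: slots_def cut_positions_def edge_point_def)
qed

lemma slotsE:
  assumes "x \<in> slots w t"
  obtains e s where "e \<in> edges w" "s \<in> curve_inner e" "frac s = frac t" "x = curve e s"
  using assms by (auto simp: slots_eq)

lemma slotsI: "e \<in> edges w \<Longrightarrow> s \<in> curve_inner e \<Longrightarrow> frac s = frac t \<Longrightarrow> curve e s \<in> slots w t"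
  by (auto simp: slots_eq)

lemma finite_slots: "finite (slots w t)"
proof -
  have "slots w t \<subseteq> (\<Union>e\<in>edges w. xpos w e ` {s. low w e \<le> s \<and> s \<le> high w e \<and> frac s = frac t})"
    by (auto simp: slots_def cut_positions_def edge_point_def edge_dom_def split: if_splits)
  then show ?thesis
    by (rule finite_subset) (use finite_edges finite_frac_eq in blast)
qed

lemma slot_edge_curve:
  assumes "e \<in> edges w" "s \<in> curve_inner e" "frac s = frac t"
  shows "slot_edge w t (curve e s) = e"
  unfolding slot_edge_def edge_at_def
proof (rule the_equality)
  obtain s0 where "s0 \<in> edge_dom w e" "curve e s = xpos w e s0" "frac s0 = frac s"
    using curve_inner_reduce[OF assms(1,2)] by blast
  then show "e \<in> edges w \<and> (\<exists>y\<in>edge_dom w e. edge_point w e y = (curve e s, frac t))"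
    using assms by (auto simp: edge_point_def)
next
  fix e' assume "e' \<in> edges w \<and> (\<exists>y\<in>edge_dom w e'. edge_point w e' y = (curve e s, frac t))"
  then obtain s' where s': "e' \<in> edges w" "s' \<in> edge_dom w e'" "xpos w e' s' = curve e s" "frac s' = frac t"
    by (auto simp: edge_point_def)
  then show "e' = e"
    using curve_inj(1)[of e' e s' s] curve_edge_dom[of e' s'] assms by auto
qed

lemma slot_edge_in_edges: "x \<in> slots w t \<Longrightarrow> slot_edge w t x \<in> edges w"
  by (metis slotsE slot_edge_curve)

text \<open>Well defined, since distinct strands meet only at vertices.\<close>

definition transport :: "real \<Rightarrow> real \<Rightarrow> real \<Rightarrow> real" where
  "transport t d x = (THE x'. \<exists>e s. e \<in> edges w \<and> s \<in> curve_inner e \<and> frac s = frac t \<and> x = curve e s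
     \<and> x' = curve e (s + d))"

lemma transport_curve:
  assumes "e \<in> edges w" "s \<in> curve_inner e" "frac s = frac t"
  shows "transport t d (curve e s) = curve e (s + d)"
  unfolding transport_def
proof (rule the_equality)
  show "\<exists>e' s'. e' \<in> edges w \<and> s' \<in> curve_inner e' \<and> frac s' = frac t \<and> curve e s = curve e' s'
     \<and> curve e (s + d) = curve e' (s' + d)"
    using assms by blast
next
  fix x' assume "\<exists>e' s'. e' \<in> edges w \<and> s' \<in> curve_inner e' \<and> frac s' = frac t \<and> curve e s = curve e' s'
     \<and> x' = curve e' (s' + d)"
  then obtain e' s' where "e' \<in> edges w" "s' \<in> curve_inner e'" "frac s' = frac t" "curve e s = curve e' s'"
    "x' = curve e' (s' + d)" by blast
  then show "x' = curve e (s + d)"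
    using curve_inj(3)[of e e' s s' d] assms by simp
qed

end

section \<open>Strands within one layer\<close>

context annular_web
begin

lemma noncircle_head:
  assumes "e \<in> edges w" "head w e \<in> vertices w"
  shows "\<not> circle e"
  using assms edge_ends[of e] by (auto simp: circle_def)

lemma noncircle_tail:
  assumes "tail w e \<in> vertices w"
  shows "\<not> circle e"
  using assms by (auto simp: circle_def)

context
  fixes y z y' :: real
  assumes layer: "is_layer w y z y'"
begin

lemma layer_less: "y < z" "z < y'"
  using layer by (auto simp: is_layer_def)

lemma layer_noncritical: "y \<le> t \<Longrightarrow> t \<le> y' \<Longrightarrow> t \<noteq> z \<Longrightarrow> v \<in> vertices w \<Longrightarrow> snd v \<noteq> frac t"
  using layer unfolding is_layer_def by (metis imageI)

lemma edge_end_critical: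
  assumes "e \<in> edges w" "\<not> circle e" "s = low w e \<or> s = high w e" "frac s = frac t" "y \<le> t" "t \<le> y'"
  shows "t = z"
  using assms noncircle_ends[of e] layer_noncritical[of t] unfolding head_def tail_def edge_point_def
  by (metis snd_conv)

text \<open>Within the layer an edge can end only at height z, and \<open>side\<close> says that the
  way from t to u does not run into z, though it may start there.\<close>

lemma strand_stays_inner:
  assumes e: "e \<in> edges w" "s \<in> curve_inner e" "frac s = frac t" and t: "y \<le> t" "t \<le> y'"
    and u: "y \<le> u" "u \<le> y'" and side: "(t \<le> u \<and> (u < z \<or> z \<le> t)) \<or> (u \<le> t \<and> (z < u \<or> t \<le> z))"
  shows "s + (u - t) \<in> curve_inner e"
proof (cases "circle e")
  case False
  then have s: "low w e < s" "s < high w e" using e by (auto simp: curve_inner_def)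
  have crit: "t + (x - s) = z" if "x = low w e \<or> x = high w e" "y \<le> t + (x - s)" "t + (x - s) \<le> y'" for x
    using edge_end_critical[OF e(1) False, of x "t + (x - s)"] frac_eq_add[OF e(3), of "x - s"] that by simp
  have "s + (u - t) < high w e"
  proof (rule ccontr)
    assume "\<not> ?thesis"
    then show False using crit[of "high w e"] s t u side by auto
  qed
  moreover have "low w e < s + (u - t)"
  proof (rule ccontr)
    assume "\<not> ?thesis"
    then show False using crit[of "low w e"] s t u side by auto
  qed
  ultimately show ?thesis using False by (simp add: curve_inner_def)
qed (simp add: curve_inner_def)

lemma strand_reaches:
  assumes e: "e \<in> edges w" "s \<in> curve_inner e" "frac s = frac t" and t: "y \<le> t" "t \<le> y'" "t \<noteq> z"
    and u: "t \<le> u \<and> u \<le> z \<or> z \<le> u \<and> u \<le> t"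
  shows "s + (u - t) \<in> curve_dom e"
proof (cases "circle e")
  case False
  then have s: "low w e < s" "s < high w e" using e by (auto simp: curve_inner_def)
  have crit: "t + (x - s) = z" if "x = low w e \<or> x = high w e" "y \<le> t + (x - s)" "t + (x - s) \<le> y'" for x
    using edge_end_critical[OF e(1) False, of x "t + (x - s)"] frac_eq_add[OF e(3), of "x - s"] that by simp
  have "s + (u - t) \<le> high w e"
  proof (rule ccontr)
    assume "\<not> ?thesis"
    then show False using crit[of "high w e"] s t u layer_less by auto
  qed
  moreover have "low w e \<le> s + (u - t)"
  proof (rule ccontr)
    assume "\<not> ?thesis"
    then show False using crit[of "low w e"] s t u layer_less by auto
  qed
  ultimately show ?thesis using False by (simp add: curve_dom_def)
qed (simp add: curve_dom_def)

text \<open>Two strands that start apart can meet only at a vertex, by the intermediate value theorem.\<close>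

lemma transport_mono:
  assumes x: "x1 \<in> slots w t" "x2 \<in> slots w t" "x1 < x2" and t: "y \<le> t" "t \<le> y'" "t \<noteq> z"
    and u: "t \<le> u \<and> u \<le> z \<or> z \<le> u \<and> u \<le> t"
  shows "transport t (u - t) x1 \<le> transport t (u - t) x2"
    and "u \<noteq> z \<Longrightarrow> transport t (u - t) x1 < transport t (u - t) x2"
proof -
  obtain e1 s1 where 1: "e1 \<in> edges w" "s1 \<in> curve_inner e1" "frac s1 = frac t" "x1 = curve e1 s1"
    using slotsE[OF x(1)] .
  obtain e2 s2 where 2: "e2 \<in> edges w" "s2 \<in> curve_inner e2" "frac s2 = frac t" "x2 = curve e2 s2"
    using slotsE[OF x(2)] .
  define f where "f v = curve e2 (s2 + (v - t)) - curve e1 (s1 + (v - t))" for v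
  define S where "S = {min t u..max t u}"
  have S: "t \<le> v \<and> v \<le> z \<or> z \<le> v \<and> v \<le> t" if "v \<in> S" for v
    using that u layer_less by (auto simp: S_def min_def max_def split: if_splits)
  have "continuous_on S f" unfolding f_def
    by (intro continuous_on_diff continuous_on_compose2[OF continuous_on_curve[OF 1(1)]]
        continuous_on_compose2[OF continuous_on_curve[OF 2(1)]] continuous_intros;
        use S strand_reaches[OF 1(1-3) t] strand_reaches[OF 2(1-3) t] in blast)
  then have conn: "connected (f ` S)"
    by (rule connected_continuous_image) (simp add: S_def)
  have ft: "f t > 0" using x(3) 1 2 by (simp add: f_def)
  \<comment> \<open>Strands that meet at an inner point coincide after every shift, in particular at
    height t, where they are apart.\<close>
  have nz: "f v \<noteq> 0" if v: "v \<in> S" "v \<noteq> z" for v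
  proof
    assume 0: "f v = 0"
    have "s1 + (v - t) \<in> curve_inner e1" "s2 + (v - t) \<in> curve_inner e2"
      using strand_stays_inner[OF 1(1-3) t(1,2), of v] strand_stays_inner[OF 2(1-3) t(1,2), of v]
        S[OF v(1)] v(2) t layer_less by auto
    moreover have "frac (s1 + (v - t)) = frac (s2 + (v - t))" using 1 2 by (intro frac_eq_add) simp
    ultimately have "curve e1 (s1 + (v - t) + (t - v)) = curve e2 (s2 + (v - t) + (t - v))"
      using curve_inj(3)[of e1 e2 "s1 + (v - t)" "s2 + (v - t)" "t - v"] 0 1 2 by (simp add: f_def)
    then show False using x(3) 1 2 by simp
  qed
  have uS: "u \<in> S" "t \<in> S" by (auto simp: S_def)
  have pos: "f u > 0" if "u \<noteq> z \<or> f u < 0"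
  proof (rule ccontr)
    assume n: "\<not> f u > 0"
    then have "0 \<in> f ` S"
      using connectedD_interval[OF conn imageI[OF uS(1)] imageI[OF uS(2)], of 0] ft by auto
    then obtain v where v: "v \<in> S" "f v = 0" by auto
    then have "v = z" using nz by blast
    then have "u = z" using v S[OF v(1)] u t by (auto simp: S_def min_def max_def split: if_splits)
    then show False using that v \<open>v = z\<close> by simp
  qed
  have tr: "transport t (u - t) x1 = curve e1 (s1 + (u - t))" "transport t (u - t) x2 = curve e2 (s2 + (u - t))"
    using transport_curve 1 2 by auto
  show "transport t (u - t) x1 \<le> transport t (u - t) x2" using pos unfolding tr f_def by force
  show "transport t (u - t) x1 < transport t (u - t) x2" if "u \<noteq> z" using pos that unfolding tr f_def by force
qed

lemma transport_mono_on:
  assumes "t = y \<or> t = y'"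
  shows "mono_on (slots w t) (transport t (z - t))"
proof (rule mono_onI)
  fix r s assume "r \<in> slots w t" "s \<in> slots w t" "r \<le> s"
  then show "transport t (z - t) r \<le> transport t (z - t) s"
    using transport_mono(1)[of r t s z] assms layer_less by (cases "r = s") auto
qed

text \<open>At the critical height a strand either runs on or ends at a vertex. The last clause of
  each alternative recovers the slot from the edge, which makes the maps from slots to edges
  injective on fibres.\<close>

lemma transport_cases:
  assumes x: "x \<in> slots w t" and t: "t = y \<or> t = y'"
  obtains s where "slot_edge w t x \<in> edges w" "s \<in> curve_inner (slot_edge w t x)" "frac s = frac z"
      "transport t (z - t) x = curve (slot_edge w t x) s" "x = curve (slot_edge w t x) (s + (t - z))"
  | v where "v \<in> vertices w" "snd v = frac z" "transport t (z - t) x = fst v"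
      "slot_edge w t x \<in> (if t = y then in_edges w v else out_edges w v)"
      "x = curve (slot_edge w t x) ((if t = y then high w (slot_edge w t x) else low w (slot_edge w t x)) + (t - z))"
proof -
  obtain e s where e: "e \<in> edges w" "s \<in> curve_inner e" "frac s = frac t" "x = curve e s"
    using slotsE[OF x] .
  have se: "slot_edge w t x = e" using slot_edge_curve e by simp
  have dom: "s + (z - t) \<in> curve_dom e"
    using strand_reaches[OF e(1-3), of z] t layer_less by auto
  have tr: "transport t (z - t) x = curve e (s + (z - t))" using transport_curve e by simp
  have fr: "frac (s + (z - t)) = frac z" using frac_eq_add[OF e(3), of "z - t"] by simp
  show ?thesis
  proof (cases "s + (z - t) \<in> curve_inner e")
    case True
    then show ?thesis using that(1)[of "s + (z - t)"] e se tr fr by simp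
  next
    case False
    note en = curve_end[OF e(1) dom False]
    have s: "low w e < s" "s < high w e" using e(2) en(1) by (auto simp: curve_inner_def)
    have hl: "s + (z - t) = (if t = y then high w e else low w e)"
      using en(2) s t layer_less by auto
    have v: "(if t = y then head w e else tail w e) = (curve e (s + (z - t)), frac z)"
      using hl en(1) fr by (auto simp: head_def tail_def edge_point_def curve_def split: if_splits)
    show ?thesis
    proof (rule that(2)[of "(curve e (s + (z - t)), frac z)"])
      show "slot_edge w t x \<in> (if t = y then in_edges w (curve e (s + (z - t)), frac z) else out_edges w (curve e (s + (z - t)), frac z))"
        using v e(1) by (auto simp: se in_edges_def out_edges_def)
      have "x = curve e (s + (z - t) + (t - z))" using e by simp
      then show "x = curve (slot_edge w t x) ((if t = y then high w (slot_edge w t x) else low w (slot_edge w t x)) + (t - z))"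
        using hl unfolding se by metis
    qed (use en fr tr in auto)
  qed
qed

lemma fiber_inner:
  assumes e: "e \<in> edges w" "s \<in> curve_inner e" "frac s = frac z" and t: "t = y \<or> t = y'"
  shows "{x \<in> slots w t. transport t (z - t) x = curve e s} = {curve e (s + (t - z))}"
    and "slot_edge w t (curve e (s + (t - z))) = e"
proof -
  have inn: "s + (t - z) \<in> curve_inner e"
    using strand_stays_inner[OF e, of t] t layer_less by auto
  have fr: "frac (s + (t - z)) = frac t" using frac_eq_add[OF e(3), of "t - z"] by simp
  show "slot_edge w t (curve e (s + (t - z))) = e" using slot_edge_curve[OF e(1) inn fr] .
  show "{x \<in> slots w t. transport t (z - t) x = curve e s} = {curve e (s + (t - z))}"
  proof (intro set_eqI iffI)
    fix x assume "x \<in> {x \<in> slots w t. transport t (z - t) x = curve e s}"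
    then have x: "x \<in> slots w t" and tr: "transport t (z - t) x = curve e s" by auto
    show "x \<in> {curve e (s + (t - z))}"
      using x t
    proof (cases rule: transport_cases)
      case (1 s')
      then have "curve (slot_edge w t x) (s' + (t - z)) = curve e (s + (t - z))"
        using curve_inj(3)[of "slot_edge w t x" e s' s "t - z"] e tr by simp
      then show ?thesis using 1 by simp
    next
      case (2 v)
      then have "v = (curve e s, frac s)" using tr e by (auto simp: prod_eq_iff)
      then show ?thesis using curve_avoids_vertices[OF e(1,2)] 2(1) by simp
    qed
  next
    fix x assume "x \<in> {curve e (s + (t - z))}"
    then show "x \<in> {x \<in> slots w t. transport t (z - t) x = curve e s}"
      using slotsI[OF e(1) inn fr] transport_curve[OF e(1) inn fr, of "z - t"] by simp
  qed
qed

lemma vertex_edge_slot: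
  assumes v: "v \<in> vertices w" "snd v = frac z" and t: "t = y \<or> t = y'"
    and e: "e \<in> (if t = y then in_edges w v else out_edges w v)"
  defines "h \<equiv> if t = y then high w e else low w e"
  shows "curve e (h + (t - z)) \<in> slots w t" "slot_edge w t (curve e (h + (t - z))) = e"
    "transport t (z - t) (curve e (h + (t - z))) = fst v" "\<not> circle e"
    "h + (t - z) \<in> curve_inner e" "frac (h + (t - z)) = frac t" "e \<in> edges w"
proof -
  have tyy: "y \<noteq> y'" using layer_less by simp
  show ee: "e \<in> edges w" using e by (auto simp: in_edges_def out_edges_def split: if_splits)
  show nc: "\<not> circle e"
    using e v noncircle_head[of e] noncircle_tail[of e]
    by (auto simp: in_edges_def out_edges_def split: if_splits)
  have hv: "xpos w e h = fst v" "frac h = frac z"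
    using e v by (auto simp: h_def in_edges_def out_edges_def head_def tail_def edge_point_def prod_eq_iff split: if_splits)
  have lh: "low w e < high w e" using edge_upward[OF ee] .
  have crit: "z + (x - h) = z" if "x = low w e \<or> x = high w e" "y \<le> z + (x - h)" "z + (x - h) \<le> y'" for x
    using edge_end_critical[OF ee nc, of x "z + (x - h)"] frac_eq_add[OF hv(2), of "x - h"] that by simp
  show inn: "h + (t - z) \<in> curve_inner e"
  proof -
    \<comment> \<open>If the edge were so short that its other end also lay in this half of the
      layer, that end would have to be at height z as well, against
      \<open>low w e < high w e\<close>.\<close>
    have "t = y \<Longrightarrow> \<not> y \<le> z + (low w e - high w e)" "t = y' \<Longrightarrow> \<not> z + (high w e - low w e) \<le> y'"
      using crit[of "low w e"] crit[of "high w e"] lh layer_less t by (auto simp: h_def)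
    then show ?thesis using t nc layer_less tyy by (auto simp: curve_inner_def h_def)
  qed
  show fr: "frac (h + (t - z)) = frac t" using frac_eq_add[OF hv(2), of "t - z"] by simp
  show "curve e (h + (t - z)) \<in> slots w t" using slotsI[OF ee inn fr] .
  show "slot_edge w t (curve e (h + (t - z))) = e" using slot_edge_curve[OF ee inn fr] .
  show "transport t (z - t) (curve e (h + (t - z))) = fst v"
    using transport_curve[OF ee inn fr, of "z - t"] hv nc by (simp add: curve_def)
qed

text \<open>The inverse follows an incident edge from the vertex back to height t.\<close>

lemma fiber_vertex:
  assumes v: "v \<in> vertices w" "snd v = frac z" and t: "t = y \<or> t = y'"
  shows "bij_betw (slot_edge w t) {x \<in> slots w t. transport t (z - t) x = fst v}
           (if t = y then in_edges w v else out_edges w v)" (is "bij_betw _ ?F ?E")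
proof -
  define g where "g e = curve e ((if t = y then high w e else low w e) + (t - z))" for e
  have F: "slot_edge w t x \<in> ?E \<and> x = g (slot_edge w t x)" if x: "x \<in> ?F" for x
  proof -
    have x': "x \<in> slots w t" "transport t (z - t) x = fst v" using x by auto
    show ?thesis using x'(1) t
    proof (cases rule: transport_cases)
      case (1 s)
      then have "v = (curve (slot_edge w t x) s, frac s)" using x' v by (auto simp: prod_eq_iff)
      then show ?thesis using curve_avoids_vertices[OF 1(1,2)] v(1) by simp
    next
      case (2 v')
      then have "v' = v" using x' v by (auto simp: prod_eq_iff)
      then show ?thesis using 2 by (auto simp: g_def)
    qed
  qed
  show ?thesis
  proof (rule bij_betwI[of _ _ _ g])
    show "slot_edge w t \<in> ?F \<rightarrow> ?E" using F by blast
    show "g \<in> ?E \<rightarrow> ?F" using vertex_edge_slot[OF v t] by (auto simp: g_def)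
    show "g (slot_edge w t x) = x" if "x \<in> ?F" for x using F[OF that] by simp
    show "slot_edge w t (g e) = e" if "e \<in> ?E" for e using vertex_edge_slot(2)[OF v t that] by (simp add: g_def)
  qed
qed

text \<open>\<open>enters_left_of\<close> only looks at heights close to the vertex. Strict
  monotonicity of \<open>transport\<close> at all heights below z carries the order of the slots at
  y up to there.\<close>

lemma enters_left_of_fiber:
  assumes v: "v \<in> vertices w" "snd v = frac z" and x: "x1 \<in> slots w y" "x2 \<in> slots w y" "x1 < x2"
    "transport y (z - y) x1 = fst v" "transport y (z - y) x2 = fst v"
  shows "enters_left_of w (slot_edge w y x1) (slot_edge w y x2)"
proof -
  let ?e1 = "slot_edge w y x1" and ?e2 = "slot_edge w y x2"
  have E: "?e1 \<in> in_edges w v" "?e2 \<in> in_edges w v"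
    using bij_betwE[OF fiber_vertex[OF v, of y]] x by auto
  have x12: "x = curve (slot_edge w y x) (high w (slot_edge w y x) + (y - z))"
    if "x \<in> slots w y" "transport y (z - y) x = fst v" for x
  proof -
    have "y = y \<or> y = y'" by simp
    from that(1) this show ?thesis
    proof (cases rule: transport_cases)
      case (1 s)
      then have "v = (curve (slot_edge w y x) s, frac s)" using that v by (auto simp: prod_eq_iff)
      then show ?thesis using curve_avoids_vertices[OF 1(1,2)] v(1) by simp
    qed auto
  qed
  have tr: "transport y (z - h - y) x = xpos w (slot_edge w y x) (high w (slot_edge w y x) - h)"
    if "x \<in> slots w y" "transport y (z - y) x = fst v" "slot_edge w y x \<in> in_edges w v" for x h
  proof -
    let ?e = "slot_edge w y x"
    have "transport y (z - h - y) (curve ?e (high w ?e + (y - z))) = curve ?e (high w ?e + (y - z) + (z - h - y))"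
      using vertex_edge_slot[OF v, of y ?e] that(3) by (intro transport_curve) auto
    then show ?thesis
      using x12[OF that(1,2)] vertex_edge_slot(4)[OF v, of y ?e] that(3) by (simp add: curve_def)
  qed
  have "xpos w ?e1 (high w ?e1 - h) < xpos w ?e2 (high w ?e2 - h)" if "0 < h" "h < z - y" for h
    using transport_mono(2)[OF x(1-3), of "z - h"] tr[OF x(1,4) E(1), of h] tr[OF x(2,5) E(2), of h] that layer_less
    by auto
  then show ?thesis
    unfolding enters_left_of_def eventually_at_right_field using layer_less by (intro exI[of _ "z - y"]) auto
qed

lemma left_right_in:
  assumes v: "v \<in> merges w" "snd v = frac z" and x: "x1 \<in> slots w y" "x2 \<in> slots w y" "x1 < x2"
    "transport y (z - y) x1 = fst v" "transport y (z - y) x2 = fst v"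
  shows "left_in w v = slot_edge w y x1" "right_in w v = slot_edge w y x2"
    "in_edges w v = {slot_edge w y x1, slot_edge w y x2}" "slot_edge w y x1 \<noteq> slot_edge w y x2"
proof -
  let ?e1 = "slot_edge w y x1" and ?e2 = "slot_edge w y x2"
  have vv: "v \<in> vertices w" using v by (simp add: merges_def)
  note bij = fiber_vertex[OF vv v(2), of y]
  have E: "?e1 \<in> in_edges w v" "?e2 \<in> in_edges w v" using bij_betwE[OF bij] x by auto
  show ne: "?e1 \<noteq> ?e2" using bij_betw_imp_inj_on[OF bij] x by (auto dest: inj_onD)
  show ins: "in_edges w v = {?e1, ?e2}"
  proof -
    have "card (in_edges w v) = 2" using v by (simp add: merges_def)
    then obtain a b where "in_edges w v = {a, b}" by (auto simp: card_2_iff)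
    then show ?thesis using E ne by auto
  qed
  have l: "enters_left_of w ?e1 ?e2" using enters_left_of_fiber[OF vv v(2) x] .
  have nl: "\<not> enters_left_of w ?e2 ?e1"
  proof
    assume "enters_left_of w ?e2 ?e1"
    then have "\<forall>\<^sub>F h in at_right (0::real). False"
      using l unfolding enters_left_of_def by eventually_elim simp
    then show False by simp
  qed
  have "(\<exists>b. in_edges w v = {a, b} \<and> enters_left_of w a b) \<longleftrightarrow> a = ?e1" for a
    unfolding ins doubleton_eq_iff using l nl by blast
  then show "left_in w v = ?e1" by (simp add: left_in_def)
  have "(\<exists>a. in_edges w v = {a, b} \<and> enters_left_of w a b) \<longleftrightarrow> b = ?e2" for b
    unfolding ins doubleton_eq_iff using l nl by blast
  then show "right_in w v = ?e2" by (simp add: right_in_def)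
qed

end

end

section \<open>Cutting the annulus into layers\<close>

locale layered_web = annular_web w for w :: "'e web" +
  fixes c :: real and m :: nat and Y Z :: "nat \<Rightarrow> real"
  assumes m_pos: "0 < m"
    and frac_c: "frac c = c"
    and Y_first: "Y 0 = c" and Y_last: "Y m = c + 1"
    and layers: "i < m \<Longrightarrow> is_layer w (Y i) (Z i) (Y (Suc i))"
    and vertex_height: "v \<in> vertices w \<Longrightarrow> \<exists>i<m. frac (Z i) = snd v"
    and Z_inj: "i < m \<Longrightarrow> j < m \<Longrightarrow> frac (Z i) = frac (Z j) \<Longrightarrow> i = j"

lemma frac_eq_same_unit:
  fixes s t c :: real
  assumes "frac s = frac t" "c < s" "s < c + 1" "c < t" "t < c + 1"
  shows "s = t"
proof -
  obtain k where k: "s = t + of_int k" using assms(1) by (auto simp: frac_eq_iff)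
  then have "\<bar>of_int k :: real\<bar> < 1" using assms by auto
  then show ?thesis using k by (simp add: abs_if split: if_splits)
qed

text \<open>The critical heights are lifted to the interval from c to c + 1 and sorted, and the
  levels separating them are midpoints of neighbours. A critical height may carry several vertices,
  or none.\<close>

lemma (in annular_web) layers_exist:
  assumes "radial_cut w c"
  obtains m Y Z where "layered_web w c m Y Z"
proof -
  have c: "0 \<le> c" "c < 1" "\<And>v. v \<in> vertices w \<Longrightarrow> snd v \<noteq> c"
    using assms by (auto simp: radial_cut_def)
  define lift where "lift h = (if c < h then h else h + 1)" for h :: real
  \<comment> \<open>The extra height c + 1/2 keeps the list of critical heights nonempty when the
    web consists of circles only.\<close>
  define C where "C = insert (c + 1 / 2) (lift ` snd ` vertices w)"
  have snd_v: "0 \<le> snd v" "snd v < 1" if "v \<in> vertices w" for v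
    using that vertices_annulus by (auto simp: annulus_def)
  have lift: "frac (lift (snd v)) = snd v" "c < lift (snd v)" "lift (snd v) < c + 1" if "v \<in> vertices w" for v
    using snd_v[OF that] c(1,2) c(3)[OF that] by (auto simp: lift_def frac_1_eq frac_eq)
  have C: "finite C" "C \<noteq> {}" "\<And>z. z \<in> C \<Longrightarrow> c < z \<and> z < c + 1"
    using finite_vertices lift by (auto simp: C_def)
  define zs where "zs = sorted_list_of_set C"
  define m where "m = length zs"
  have zs: "set zs = C" "sorted zs" "distinct zs" using C by (auto simp: zs_def)
  have m: "0 < m" using zs C by (auto simp: m_def)
  have zs_less: "zs ! i < zs ! j" if "i < j" "j < m" for i j
    using that zs sorted_nth_mono[of zs i j] nth_eq_iff_index_eq[of zs i j] by (auto simp: m_def order_less_le)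
  define Y where "Y i = (if i = 0 then c else if i < m then (zs ! (i - 1) + zs ! i) / 2 else c + 1)" for i
  have zc: "c < zs ! i" "zs ! i < c + 1" if "i < m" for i
    using that C(3)[of "zs ! i"] zs by (auto simp: m_def)
  have YZ: "Y i < zs ! i" if "i < m" for i
    using that zc[OF that] zs_less[of "i - 1" i] by (auto simp: Y_def)
  have ZY: "zs ! i < Y (Suc i)" if "i < m" for i
    using that zc[OF that] zs_less[of i "Suc i"] by (auto simp: Y_def)
  have Yc: "c \<le> Y i" "Y i \<le> c + 1" for i
  proof -
    have "c \<le> Y i \<and> Y i \<le> c + 1"
    proof (cases "0 < i \<and> i < m")
      case True
      then have "i < m" "i - 1 < m" by auto
      from zc[OF this(1)] zc[OF this(2)] True show ?thesis by (simp add: Y_def)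
    qed (auto simp: Y_def)
    then show "c \<le> Y i" "Y i \<le> c + 1" by auto
  qed
  have "layered_web w c m Y (\<lambda>i. zs ! i)"
  proof
    show "0 < m" "Y 0 = c" "Y m = c + 1" using m by (auto simp: Y_def)
    show "frac c = c" using c by (simp add: frac_eq)
    show "is_layer w (Y i) (zs ! i) (Y (Suc i))" if i: "i < m" for i
      unfolding is_layer_def
    proof (intro conjI allI impI notI)
      show "Y i < zs ! i" "zs ! i < Y (Suc i)" using YZ ZY i by auto
      fix t assume t: "Y i \<le> t \<and> t \<le> Y (Suc i) \<and> t \<noteq> zs ! i" and "frac t \<in> snd ` vertices w"
      then obtain v where v: "v \<in> vertices w" "frac t = snd v" by auto
      have "frac c = c" "frac (c + 1) = c" using c by (auto simp: frac_eq frac_1_eq)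
      then have "t \<noteq> c" "t \<noteq> c + 1" using v(2) c(3)[OF v(1)] by metis+
      then have "c < t" "t < c + 1" using t Yc[of i] Yc[of "Suc i"] by auto
      then have "t = lift (snd v)"
        using frac_eq_same_unit[of t "lift (snd v)" c] lift[OF v(1)] v(2) by simp
      then have "t \<in> set zs" using v zs by (auto simp: C_def)
      then obtain j where j: "j < m" "t = zs ! j" by (auto simp: in_set_conv_nth m_def)
      show False
      proof (cases i j rule: linorder_cases)
        case less
        then have "Y (Suc i) < zs ! j"
          using j zs_less[of "Suc i" j] YZ[of "Suc i"] by (cases "Suc i = j") auto
        then show False using t j by simp
      next
        case greater
        then have "zs ! j < Y i"
        proof -
          have i1: "i - 1 < m" "Suc (i - 1) = i" using i greater by auto
          have "zs ! j \<le> zs ! (i - 1)"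
          proof -
            have "j = i - 1 \<or> j < i - 1" using greater by linarith
            then show ?thesis using zs_less[OF _ i1(1)] by (auto intro: less_imp_le)
          qed
          then show ?thesis using ZY[OF i1(1)] i1(2) by simp
        qed
        then show False using t j by simp
      qed (use t j in auto)
    qed
    show "\<exists>i<m. frac (zs ! i) = snd v" if "v \<in> vertices w" for v
    proof -
      have "lift (snd v) \<in> set zs" using that zs by (auto simp: C_def)
      then show ?thesis using lift(1)[OF that] by (auto simp: in_set_conv_nth m_def)
    qed
    show "i = j" if "i < m" "j < m" "frac (zs ! i) = frac (zs ! j)" for i j
    proof -
      have "zs ! i = zs ! j" using frac_eq_same_unit[OF that(3)] zc that by auto
      then show ?thesis using zs(3) that by (simp add: nth_eq_iff_index_eq m_def)
    qed
  qed
  then show ?thesis using that by blast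
qed

section \<open>Levels and the fibres between them\<close>

context layered_web
begin

definition lev :: "nat \<Rightarrow> real set" where "lev k = slots w (Y k)"
definition lev_edge :: "nat \<Rightarrow> real \<Rightarrow> 'e" where "lev_edge k = slot_edge w (Y k)"
text \<open>\<open>up\<close> follows the strands of level k to the critical height above,
  \<open>down\<close> those of level k + 1 to the same height from the other side. A merge is a
  point with two slots in its fibre under \<open>up\<close>, a split one with two slots under
  \<open>down\<close>.\<close>

definition up :: "nat \<Rightarrow> real \<Rightarrow> real" where "up k = transport (Y k) (Z k - Y k)"
definition down :: "nat \<Rightarrow> real \<Rightarrow> real" where "down k = transport (Y (Suc k)) (Z k - Y (Suc k))"

definition up_fiber :: "nat \<Rightarrow> real \<Rightarrow> real set" where
  "up_fiber k p = {x \<in> lev k. up k x = p}"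
definition down_fiber :: "nat \<Rightarrow> real \<Rightarrow> real set" where
  "down_fiber k p = {x \<in> lev (Suc k). down k x = p}"

lemma finite_lev [simp]: "finite (lev k)"
  by (simp add: lev_def finite_slots)

lemma up_mono_on: "k < m \<Longrightarrow> mono_on (lev k) (up k)"
  using transport_mono_on[OF layers] by (simp add: lev_def up_def)

lemma down_mono_on: "k < m \<Longrightarrow> mono_on (lev (Suc k)) (down k)"
  using transport_mono_on[OF layers] by (simp add: lev_def down_def)

lemma lev_last: "lev m = lev 0" "lev_edge m = lev_edge 0"
  by (auto simp: lev_def lev_edge_def slots_def slot_edge_def[abs_def] Y_first Y_last frac_1_eq)

lemma lev_edge_in_edges: "x \<in> lev k \<Longrightarrow> lev_edge k x \<in> edges w"
  by (simp add: lev_def lev_edge_def slot_edge_in_edges)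

lemma Y_less: "k < m \<Longrightarrow> Y k < Z k" "k < m \<Longrightarrow> Z k < Y (Suc k)"
  using layer_less[OF layers] by auto

lemma fibers_inner:
  assumes "k < m" "e \<in> edges w" "s \<in> curve_inner e" "frac s = frac (Z k)"
  shows "up_fiber k (curve e s) = {curve e (s + (Y k - Z k))}"
    "down_fiber k (curve e s) = {curve e (s + (Y (Suc k) - Z k))}"
    "lev_edge k (curve e (s + (Y k - Z k))) = e"
    "lev_edge (Suc k) (curve e (s + (Y (Suc k) - Z k))) = e"
  using fiber_inner[OF layers[OF assms(1)] assms(2-4)]
  by (auto simp: up_fiber_def down_fiber_def up_def down_def lev_def lev_edge_def)

lemma fibers_vertex:
  assumes "k < m" "v \<in> vertices w" "snd v = frac (Z k)"
  shows "bij_betw (lev_edge k) (up_fiber k (fst v)) (in_edges w v)"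
    "bij_betw (lev_edge (Suc k)) (down_fiber k (fst v)) (out_edges w v)"
  using fiber_vertex[OF layers[OF assms(1)] assms(2,3), of "Y k"]
    fiber_vertex[OF layers[OF assms(1)] assms(2,3), of "Y (Suc k)"] Y_less[OF assms(1)]
  by (auto simp: up_fiber_def down_fiber_def up_def down_def lev_def lev_edge_def)

lemma fiber_cases:
  assumes "k < m" "up_fiber k p \<noteq> {} \<or> down_fiber k p \<noteq> {}"
  obtains x x' where "up_fiber k p = {x}" "down_fiber k p = {x'}" "lev_edge k x = lev_edge (Suc k) x'"
  | v where "v \<in> vertices w" "snd v = frac (Z k)" "p = fst v"
      "bij_betw (lev_edge k) (up_fiber k p) (in_edges w v)"
      "bij_betw (lev_edge (Suc k)) (down_fiber k p) (out_edges w v)"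
proof -
  obtain t x where t: "t = Y k \<or> t = Y (Suc k)" and x: "x \<in> slots w t" "transport t (Z k - t) x = p"
    using assms(2) by (auto simp: up_fiber_def down_fiber_def up_def down_def lev_def)
  from layers[OF assms(1)] x(1) t show ?thesis
  proof (cases rule: transport_cases)
    case (1 s)
    note f = fibers_inner[OF assms(1) 1(1-3)]
    have "p = curve (slot_edge w t x) s" using 1 x by simp
    then show ?thesis using that(1)[OF f(1,2)[folded \<open>p = _\<close>]] f(3,4) by metis
  next
    case (2 v)
    then have "p = fst v" using x by simp
    then show ?thesis using that(2)[OF 2(1,2)] fibers_vertex[OF assms(1) 2(1,2)] by blast
  qed
qed

text \<open>A form of the label condition that treats merges and splits alike.\<close>

definition balanced_at :: "('e \<Rightarrow> 'a set) \<Rightarrow> real \<times> real \<Rightarrow> bool" where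
  "balanced_at L v \<longleftrightarrow> disjoint_family_on L (in_edges w v) \<and> disjoint_family_on L (out_edges w v) \<and>
     \<Union> (L ` in_edges w v) = \<Union> (L ` out_edges w v)"

lemma balanced_at_iff:
  assumes "v \<in> vertices w"
  shows "balanced_at L v \<longleftrightarrow> (\<forall>e a b. a \<noteq> b \<and>
        (in_edges w v = {a, b} \<and> out_edges w v = {e} \<or>
         in_edges w v = {e} \<and> out_edges w v = {a, b}) \<longrightarrow>
        L e = L a \<union> L b \<and> L a \<inter> L b = {})"
proof -
  have two: "\<exists>a b. a \<noteq> b \<and> A = {a, b}" if "card A = 2" for A :: "'e set"
    using that by (auto simp: card_2_iff)
  have one: "\<exists>e. A = {e}" if "card A = 1" for A :: "'e set"
    using that card_1_singletonE by metis
  obtain a b e where ab: "a \<noteq> b"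
    "in_edges w v = {a, b} \<and> out_edges w v = {e} \<or> in_edges w v = {e} \<and> out_edges w v = {a, b}"
  proof (cases "v \<in> merges w")
    case True
    then have "card (in_edges w v) = 2" "card (out_edges w v) = 1" by (auto simp: merges_def)
    then show ?thesis using that two[of "in_edges w v"] one[of "out_edges w v"] by auto
  next
    case False
    then have "card (in_edges w v) = 1" "card (out_edges w v) = 2"
      using vertex_trivalent[OF assms] by (auto simp: splits_def)
    then show ?thesis using that one[of "in_edges w v"] two[of "out_edges w v"] by auto
  qed
  have disj: "disjoint_family_on L {a, b} \<longleftrightarrow> L a \<inter> L b = {}" "disjoint_family_on L {e}"
    using ab(1) by (auto simp: disjoint_family_on_def)
  have bal: "balanced_at L v \<longleftrightarrow> L e = L a \<union> L b \<and> L a \<inter> L b = {}"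
    using ab(2) by (elim disjE conjE; simp add: balanced_at_def disj; blast)
  have key: "a' \<noteq> b' \<and> (in_edges w v = {a', b'} \<and> out_edges w v = {e'} \<or>
       in_edges w v = {e'} \<and> out_edges w v = {a', b'}) \<longleftrightarrow>
     e' = e \<and> (a' = a \<and> b' = b \<or> a' = b \<and> b' = a)" for a' b' e'
    using ab by (elim disjE conjE; simp add: doubleton_eq_iff) blast+
  show ?thesis unfolding bal key by blast
qed

lemma balanced_fibers:
  assumes bal: "\<And>v. v \<in> vertices w \<Longrightarrow> balanced_at L v" and k: "k < m"
  shows "(\<Union>x\<in>up_fiber k p. L (lev_edge k x)) = (\<Union>x\<in>down_fiber k p. L (lev_edge (Suc k) x))"
    and "disjoint_family_on (\<lambda>x. L (lev_edge (Suc k) x)) (down_fiber k p)"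
proof -
  have "(\<Union>x\<in>up_fiber k p. L (lev_edge k x)) = (\<Union>x\<in>down_fiber k p. L (lev_edge (Suc k) x)) \<and>
    disjoint_family_on (\<lambda>x. L (lev_edge (Suc k) x)) (down_fiber k p)"
  proof (cases "up_fiber k p \<noteq> {} \<or> down_fiber k p \<noteq> {}")
    case True
    from k True show ?thesis
    proof (cases rule: fiber_cases)
      case (1 x x')
      then show ?thesis by (simp add: disjoint_family_on_def)
    next
      case (2 v)
      have "(\<Union>x\<in>up_fiber k p. L (lev_edge k x)) = \<Union> (L ` in_edges w v)"
        "(\<Union>x\<in>down_fiber k p. L (lev_edge (Suc k) x)) = \<Union> (L ` out_edges w v)"
        unfolding bij_betw_imp_surj_on[OF 2(4), symmetric] bij_betw_imp_surj_on[OF 2(5), symmetric]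
        by (simp_all add: image_image)
      moreover have "disjoint_family_on (\<lambda>x. L (lev_edge (Suc k) x)) (down_fiber k p)"
        unfolding disjoint_family_on_def
      proof (intro ballI impI)
        fix x y assume xy: "x \<in> down_fiber k p" "y \<in> down_fiber k p" "x \<noteq> y"
        then have "lev_edge (Suc k) x \<noteq> lev_edge (Suc k) y"
          using bij_betw_imp_inj_on[OF 2(5)] by (auto dest: inj_onD)
        then show "L (lev_edge (Suc k) x) \<inter> L (lev_edge (Suc k) y) = {}"
          using bal[OF 2(1)] bij_betwE[OF 2(5)] xy by (auto simp: balanced_at_def disjoint_family_on_def)
      qed
      ultimately show ?thesis using bal[OF 2(1)] by (simp add: balanced_at_def)
    qed
  qed (auto simp: disjoint_family_on_def)
  then show "(\<Union>x\<in>up_fiber k p. L (lev_edge k x)) = (\<Union>x\<in>down_fiber k p. L (lev_edge (Suc k) x))"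
    and "disjoint_family_on (\<lambda>x. L (lev_edge (Suc k) x)) (down_fiber k p)" by auto
qed

text \<open>Each fibre conserves labels, so the partition at the cut propagates upwards. For
  disjointness, a label at two slots above comes from a single slot below; both slots then lie over
  the same point, where balance keeps their labels apart.\<close>

lemma level_partition:
  assumes bal: "\<And>v. v \<in> vertices w \<Longrightarrow> balanced_at L v"
    and base: "disjoint_family_on (\<lambda>x. L (lev_edge 0 x)) (lev 0)" "(\<Union>x\<in>lev 0. L (lev_edge 0 x)) = U"
    and "k \<le> m"
  shows "disjoint_family_on (\<lambda>x. L (lev_edge k x)) (lev k) \<and> (\<Union>x\<in>lev k. L (lev_edge k x)) = U"
  using \<open>k \<le> m\<close>
proof (induction k)
  case 0
  then show ?case using base by simp
next
  case (Suc k)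
  then have k: "k < m" and IH: "disjoint_family_on (\<lambda>x. L (lev_edge k x)) (lev k)"
    "(\<Union>x\<in>lev k. L (lev_edge k x)) = U" by auto
  note bf = balanced_fibers[OF bal k]
  have below: "\<exists>x'\<in>lev k. up k x' = down k x \<and> u \<in> L (lev_edge k x')"
    if "x \<in> lev (Suc k)" "u \<in> L (lev_edge (Suc k) x)" for x u
    using bf(1)[of "down k x"] that by (auto simp: up_fiber_def down_fiber_def)
  have above: "\<exists>x'\<in>lev (Suc k). u \<in> L (lev_edge (Suc k) x')"
    if "x \<in> lev k" "u \<in> L (lev_edge k x)" for x u
    using bf(1)[of "up k x"] that by (auto simp: up_fiber_def down_fiber_def)
  have "(\<Union>x\<in>lev (Suc k). L (lev_edge (Suc k) x)) = U"
    using IH(2) below above by fastforce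
  moreover have "disjoint_family_on (\<lambda>x. L (lev_edge (Suc k) x)) (lev (Suc k))"
    unfolding disjoint_family_on_def
  proof (intro ballI impI equals0I)
    fix x y u assume xy: "x \<in> lev (Suc k)" "y \<in> lev (Suc k)" "x \<noteq> y"
      and u: "u \<in> L (lev_edge (Suc k) x) \<inter> L (lev_edge (Suc k) y)"
    obtain x' where x': "x' \<in> lev k" "up k x' = down k x" "u \<in> L (lev_edge k x')"
      using below xy u by blast
    obtain y' where y': "y' \<in> lev k" "up k y' = down k y" "u \<in> L (lev_edge k y')"
      using below xy u by blast
    have "x' = y'" using IH(1) x' y' by (auto simp: disjoint_family_on_def)
    then have "down k x = down k y" using x' y' by simp
    then show False
      using bf(2)[of "down k x"] xy u by (auto simp: disjoint_family_on_def down_fiber_def)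
  qed
  ultimately show ?case by simp
qed

text \<open>A circle is continued over all heights and therefore meets the cut; any other edge is
  met at the level just above its tail.\<close>

lemma edge_has_slot:
  assumes "e \<in> edges w"
  shows "\<exists>k\<le>m. \<exists>x\<in>lev k. lev_edge k x = e"
proof (cases "circle e")
  case True
  then have "Y 0 \<in> curve_inner e" by (simp add: curve_inner_def)
  then show ?thesis
    using slotsI[OF assms _ refl, of "Y 0"] slot_edge_curve[OF assms _ refl, of "Y 0"]
    by (auto simp: lev_def lev_edge_def)
next
  case False
  then have v: "tail w e \<in> vertices w" using noncircle_ends assms by simp
  then obtain k where k: "k < m" "frac (Z k) = snd (tail w e)" using vertex_height by blast
  have "e \<in> out_edges w (tail w e)" using assms by (simp add: out_edges_def)
  then have "e \<in> lev_edge (Suc k) ` down_fiber k (fst (tail w e))"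
    using bij_betw_imp_surj_on[OF fibers_vertex(2)[OF k(1) v]] k by simp
  then show ?thesis using k by (auto simp: down_fiber_def intro!: exI[of _ "Suc k"])
qed

end

section \<open>Loop decompositions as closed paths\<close>

lemma sum_list_take_Suc: "j < length \<alpha> \<Longrightarrow> sum_list (take (Suc j) \<alpha>) = sum_list (take j \<alpha>) + (\<alpha> ! j :: nat)"
  by (simp add: take_Suc_conv_app_nth)

lemma sum_list_take_mono: "i \<le> j \<Longrightarrow> sum_list (take i \<alpha>) \<le> (sum_list (take j \<alpha>) :: nat)"
  by (metis le_add1 le_add_diff_inverse sum_list_append take_add)

lemma disjoint_family_on_imageI:
  assumes "\<And>x y. x \<in> A \<Longrightarrow> y \<in> A \<Longrightarrow> x \<noteq> y \<Longrightarrow> L (f x) \<inter> L (f y) = {}"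
  shows "disjoint_family_on L (f ` A)"
  unfolding disjoint_family_on_def using assms by blast

lemma card_block: "j < length \<alpha> \<Longrightarrow> card (block \<alpha> j) = \<alpha> ! j"
  by (simp add: block_def sum_list_take_Suc)

lemma block_less:
  assumes "j < j'" "u \<in> block \<alpha> j" "v \<in> block \<alpha> j'"
  shows "u < v"
  using assms sum_list_take_mono[of "Suc j" j' \<alpha>] by (auto simp: block_def)

lemma Union_block: "(\<Union>j<length \<alpha>. block \<alpha> j) = {1..sum_list \<alpha>}"
proof -
  have "k \<le> length \<alpha> \<Longrightarrow> (\<Union>j<k. block \<alpha> j) = {1..sum_list (take k \<alpha>)}" for k
  proof (induction k)
    case (Suc k)
    then have "(\<Union>j<Suc k. block \<alpha> j) = {1..sum_list (take k \<alpha>)} \<union> block \<alpha> k"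
      by (simp add: lessThan_Suc Un_commute)
    also have "\<dots> = {1..sum_list (take (Suc k) \<alpha>)}"
      using sum_list_take_mono[of k "Suc k" \<alpha>] by (auto simp: block_def)
    finally show ?case .
  qed simp
  from this[of "length \<alpha>"] show ?thesis by simp
qed

section \<open>Labels at the cut\<close>

context layered_web
begin

definition home :: "nat \<Rightarrow> real" where
  "home u = sorted_list_of_set (lev 0) !
     (THE j. j < length (cut_thickness w c) \<and> u \<in> block (cut_thickness w c) j)"

lemma cut_edges_lev: "cut_edges w c = map (lev_edge 0) (sorted_list_of_set (lev 0))"
  by (simp add: cut_edges_def lev_def lev_edge_def slots_def slot_edge_def[abs_def] Y_first frac_c)

lemma length_cut: "length (cut_edges w c) = length (sorted_list_of_set (lev 0))"
  "length (cut_thickness w c) = length (sorted_list_of_set (lev 0))"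
  by (auto simp: cut_edges_lev cut_thickness_def)

lemma cut_thickness_nth:
  "j < length (cut_thickness w c) \<Longrightarrow> cut_thickness w c ! j = thickness w (lev_edge 0 (sorted_list_of_set (lev 0) ! j))"
  by (simp add: cut_thickness_def cut_edges_lev)

lemma home_block:
  assumes "j < length (cut_thickness w c)" "u \<in> block (cut_thickness w c) j"
  shows "home u = sorted_list_of_set (lev 0) ! j"
proof -
  have "(THE j. j < length (cut_thickness w c) \<and> u \<in> block (cut_thickness w c) j) = j"
    using assms block_less[of _ _ u "cut_thickness w c" u] by (intro the_equality) (auto, metis linorder_neqE_nat order_less_irrefl)
  then show ?thesis by (simp add: home_def)
qed

lemma labels_block:
  assumes "u \<in> labels w c"
  obtains j where "j < length (cut_thickness w c)" "u \<in> block (cut_thickness w c) j"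
    "home u = sorted_list_of_set (lev 0) ! j"
  using assms home_block Union_block[of "cut_thickness w c"] unfolding labels_def by blast

lemma block_subset_labels: "j < length (cut_thickness w c) \<Longrightarrow> block (cut_thickness w c) j \<subseteq> labels w c"
  using Union_block[of "cut_thickness w c"] unfolding labels_def by blast

lemma home_in_lev: "u \<in> labels w c \<Longrightarrow> home u \<in> lev 0"
  by (metis finite_lev labels_block length_cut(2) nth_mem set_sorted_list_of_set)

lemma sorted_lev_inj:
  "i < length (cut_thickness w c) \<Longrightarrow> j < length (cut_thickness w c) \<Longrightarrow>
     sorted_list_of_set (lev 0) ! i = sorted_list_of_set (lev 0) ! j \<longleftrightarrow> i = j"
  by (simp add: length_cut nth_eq_iff_index_eq)

lemma home_fiber:
  assumes "j < length (cut_thickness w c)"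
  shows "{u \<in> labels w c. home u = sorted_list_of_set (lev 0) ! j} = block (cut_thickness w c) j"
proof (intro set_eqI iffI)
  fix u assume "u \<in> {u \<in> labels w c. home u = sorted_list_of_set (lev 0) ! j}"
  then show "u \<in> block (cut_thickness w c) j"
    using labels_block[of u] sorted_lev_inj[OF _ assms] by (metis (mono_tags, lifting) mem_Collect_eq)
next
  fix u assume "u \<in> block (cut_thickness w c) j"
  then show "u \<in> {u \<in> labels w c. home u = sorted_list_of_set (lev 0) ! j}"
    using home_block[OF assms] block_subset_labels[OF assms] by auto
qed

lemma home_mono: "mono_on (labels w c) home"
proof (rule mono_onI)
  fix u v assume uv: "u \<in> labels w c" "v \<in> labels w c" "u \<le> v"
  obtain i where i: "i < length (cut_thickness w c)" "u \<in> block (cut_thickness w c) i"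
    "home u = sorted_list_of_set (lev 0) ! i" using labels_block[OF uv(1)] .
  obtain j where j: "j < length (cut_thickness w c)" "v \<in> block (cut_thickness w c) j"
    "home v = sorted_list_of_set (lev 0) ! j" using labels_block[OF uv(2)] .
  have "i \<le> j" using block_less[of j i v "cut_thickness w c" u] i j uv(3) by force
  then show "home u \<le> home v" using i j by (simp add: sorted_nth_mono length_cut)
qed

lemma lev_0_nth:
  assumes "s \<in> lev 0"
  obtains j where "j < length (cut_thickness w c)" "s = sorted_list_of_set (lev 0) ! j"
  using assms by (metis finite_lev in_set_conv_nth length_cut(2) set_sorted_list_of_set)

lemma SLD_iff:
  "L \<in> SLD w c \<longleftrightarrow> L \<in> edges w \<rightarrow>\<^sub>E Pow (labels w c) \<and>
     (\<forall>s\<in>lev 0. L (lev_edge 0 s) = {u \<in> labels w c. home u = s}) \<and>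
     (\<forall>e\<in>edges w. card (L e) = thickness w e) \<and> (\<forall>v\<in>vertices w. balanced_at L v)"
proof -
  have "(\<forall>j<length (cut_edges w c). L (cut_edges w c ! j) = block (cut_thickness w c) j) \<longleftrightarrow>
    (\<forall>s\<in>lev 0. L (lev_edge 0 s) = {u \<in> labels w c. home u = s})" (is "?A \<longleftrightarrow> ?B")
  proof
    assume A: ?A
    show ?B
    proof
      fix s assume "s \<in> lev 0"
      then obtain j where j: "j < length (cut_thickness w c)" "s = sorted_list_of_set (lev 0) ! j"
        using lev_0_nth by blast
      then show "L (lev_edge 0 s) = {u \<in> labels w c. home u = s}"
        using A home_fiber[OF j(1)] by (simp add: length_cut cut_edges_lev)
    qed
  next
    assume B: ?B
    show ?A
    proof (intro allI impI)
      fix j assume j: "j < length (cut_edges w c)"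
      then have "sorted_list_of_set (lev 0) ! j \<in> lev 0"
        by (metis finite_lev length_cut(1) nth_mem set_sorted_list_of_set)
      then show "L (cut_edges w c ! j) = block (cut_thickness w c) j"
        using B j home_fiber[of j] by (simp add: length_cut cut_edges_lev)
    qed
  qed
  note base = this
  have vert: "(\<forall>v\<in>vertices w. balanced_at L v) \<longleftrightarrow> (\<forall>v\<in>vertices w. \<forall>e a b. a \<noteq> b \<and>
        (in_edges w v = {a, b} \<and> out_edges w v = {e} \<or>
         in_edges w v = {e} \<and> out_edges w v = {a, b}) \<longrightarrow>
        L e = L a \<union> L b \<and> L a \<inter> L b = {})"
    by (rule ball_cong[OF refl balanced_at_iff])
  show ?thesis unfolding SLD_def mem_Collect_eq base vert ..
qed

lemma SLD_partition:
  assumes L: "L \<in> SLD w c" and k: "k \<le> m"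
  shows "disjoint_family_on (\<lambda>s. L (lev_edge k s)) (lev k)" "(\<Union>s\<in>lev k. L (lev_edge k s)) = labels w c"
proof -
  have base: "\<forall>s\<in>lev 0. L (lev_edge 0 s) = {u \<in> labels w c. home u = s}" using L by (simp add: SLD_iff)
  have "disjoint_family_on (\<lambda>s. L (lev_edge 0 s)) (lev 0)" "(\<Union>s\<in>lev 0. L (lev_edge 0 s)) = labels w c"
    using base home_in_lev by (auto simp: disjoint_family_on_def)
  then show "disjoint_family_on (\<lambda>s. L (lev_edge k s)) (lev k)" "(\<Union>s\<in>lev k. L (lev_edge k s)) = labels w c"
    using level_partition[of L "labels w c" k] L k by (auto simp: SLD_iff)
qed

section \<open>Positions of the loops at the levels\<close>

definition loop_pos :: "('e \<Rightarrow> nat set) \<Rightarrow> nat \<Rightarrow> nat \<Rightarrow> real" where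
  "loop_pos L k u = (THE s. s \<in> lev k \<and> u \<in> L (lev_edge k s))"

lemma loop_pos_eq:
  assumes "L \<in> SLD w c" "k \<le> m" "s \<in> lev k" "u \<in> L (lev_edge k s)"
  shows "loop_pos L k u = s"
  unfolding loop_pos_def using assms SLD_partition(1)[OF assms(1,2)]
  by (intro the_equality) (auto simp: disjoint_family_on_def)

lemma loop_pos:
  assumes "L \<in> SLD w c" "k \<le> m" "u \<in> labels w c"
  shows "loop_pos L k u \<in> lev k" "u \<in> L (lev_edge k (loop_pos L k u))"
proof -
  obtain s where "s \<in> lev k" "u \<in> L (lev_edge k s)" using SLD_partition(2)[OF assms(1,2)] assms(3) by blast
  then show "loop_pos L k u \<in> lev k" "u \<in> L (lev_edge k (loop_pos L k u))"
    using loop_pos_eq[OF assms(1,2)] by auto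
qed

lemma SLD_subset_labels: "L \<in> SLD w c \<Longrightarrow> e \<in> edges w \<Longrightarrow> L e \<subseteq> labels w c"
  by (auto simp: SLD_def)

lemma loop_pos_step:
  assumes L: "L \<in> SLD w c" and k: "k < m" and u: "u \<in> labels w c"
  shows "down k (loop_pos L (Suc k) u) = up k (loop_pos L k u)"
proof -
  let ?p = "up k (loop_pos L k u)"
  have "u \<in> (\<Union>s\<in>up_fiber k ?p. L (lev_edge k s))"
    using loop_pos[OF L _ u, of k] k by (auto simp: up_fiber_def)
  also have "\<dots> = (\<Union>s\<in>down_fiber k ?p. L (lev_edge (Suc k) s))"
    using L by (intro balanced_fibers(1) k) (auto simp: SLD_iff)
  finally obtain s where s: "s \<in> down_fiber k ?p" "u \<in> L (lev_edge (Suc k) s)" by blast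
  then have "loop_pos L (Suc k) u = s"
    using loop_pos_eq[OF L, of "Suc k" s u] k by (auto simp: down_fiber_def)
  then show ?thesis using s by (simp add: down_fiber_def)
qed

lemma loop_pos_ends:
  assumes "L \<in> SLD w c" "u \<in> labels w c"
  shows "loop_pos L 0 u = home u" "loop_pos L m u = home u"
proof -
  have "u \<in> L (lev_edge 0 (home u))" using assms home_in_lev by (auto simp: SLD_iff)
  then show "loop_pos L 0 u = home u" "loop_pos L m u = home u"
    using loop_pos_eq[OF assms(1)] home_in_lev[OF assms(2)] lev_last by auto
qed

text \<open>The basis of the permutation module at level k: place r holds the position of the loop
  whose label has rank r, and thicknesses prescribe the multiplicities of positions.\<close>

definition states :: "nat \<Rightarrow> real list set" where
  "states k = {a. length a = sum_list (cut_thickness w c) \<and> set a \<subseteq> lev k \<and>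
     (\<forall>s\<in>lev k. count_list a s = thickness w (lev_edge k s))}"

text \<open>Entries beyond k are fixed to \<open>[]\<close>, so a path is determined by its states
  up to k and there are finitely many paths.\<close>

definition state_paths :: "nat \<Rightarrow> real list \<Rightarrow> (nat \<Rightarrow> real list) set" where
  "state_paths k a = {p. p 0 = a \<and> (\<forall>i<k. p (Suc i) \<in> states (Suc i) \<and> map (down i) (p (Suc i)) = map (up i) (p i)) \<and>
     (\<forall>i>k. p i = [])}"

lemma count_list_map_distinct:
  assumes "distinct xs"
  shows "count_list (map f xs) s = card {x \<in> set xs. f x = s}"
proof -
  have "count_list (map f xs) s = length (filter (\<lambda>x. f x = s) xs)"
    by (induction xs) auto
  also have "\<dots> = card (set (filter (\<lambda>x. f x = s) xs))"
    using assms by (intro distinct_card[symmetric]) simp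
  finally show ?thesis by simp
qed

definition path_of :: "nat list \<Rightarrow> ('e \<Rightarrow> nat set) \<Rightarrow> nat \<Rightarrow> real list" where
  "path_of xs L k = (if k \<le> m then map (loop_pos L k) xs else [])"

definition label_perms :: "nat list set" where
  "label_perms = {xs. distinct xs \<and> set xs = labels w c}"

lemma label_perms_length: "xs \<in> label_perms \<Longrightarrow> length xs = sum_list (cut_thickness w c)"
  using distinct_card[of xs] by (auto simp: label_perms_def labels_def)

lemma loop_pos_fiber:
  assumes "L \<in> SLD w c" "k \<le> m" "s \<in> lev k"
  shows "{u \<in> labels w c. loop_pos L k u = s} = L (lev_edge k s)"
  using assms loop_pos[OF assms(1,2)] loop_pos_eq[OF assms(1-3)] SLD_subset_labels[OF assms(1)] lev_edge_in_edges[OF assms(3)]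
  by blast

lemma path_of_state:
  assumes "L \<in> SLD w c" "xs \<in> label_perms" "k \<le> m"
  shows "path_of xs L k \<in> states k"
  using assms label_perms_length[OF assms(2)] loop_pos(1)[OF assms(1,3)] loop_pos_fiber[OF assms(1,3)] lev_edge_in_edges
  by (auto simp: path_of_def states_def label_perms_def count_list_map_distinct SLD_iff)

lemma path_of_in_paths:
  assumes L: "L \<in> SLD w c" and xs: "xs \<in> label_perms"
  shows "path_of xs L \<in> state_paths m (map home xs)" "path_of xs L m = map home xs"
proof -
  have s: "set xs = labels w c" using xs by (simp add: label_perms_def)
  show "path_of xs L m = map home xs" using s loop_pos_ends[OF L] by (simp add: path_of_def)
  have "path_of xs L 0 = map home xs" using s loop_pos_ends[OF L] by (simp add: path_of_def)
  moreover have "map (down i) (path_of xs L (Suc i)) = map (up i) (path_of xs L i)" if "i < m" for i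
    using that s loop_pos_step[OF L that] by (simp add: path_of_def)
  ultimately show "path_of xs L \<in> state_paths m (map home xs)"
    using path_of_state[OF L xs] by (auto simp: state_paths_def path_of_def)
qed

text \<open>The level heights, continued periodically to the universal cover.\<close>

definition ext_height :: "int \<Rightarrow> real" where
  "ext_height i = Y (nat (i mod int m)) + of_int (i div int m)"

lemma index_decomp:
  obtains k d where "k < m" "i = int k + int m * d"
proof (rule that[of "nat (i mod int m)" "i div int m"])
  show "nat (i mod int m) < m" using m_pos by (simp add: nat_less_iff)
qed (use m_pos in simp)

lemma index_simps: "k < m \<Longrightarrow> nat ((int k + int m * d) mod int m) = k" "k < m \<Longrightarrow> (int k + int m * d) div int m = d"
  by simp_all

text \<open>The case k = m is included: its index is that of level 0 one turn further up.\<close>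

lemma ext_height_eq: "k \<le> m \<Longrightarrow> ext_height (int k + int m * d) = Y k + of_int d"
proof (cases "k = m")
  case True
  have "int m + int m * d = int 0 + int m * (d + 1)" by (simp add: algebra_simps)
  then show ?thesis
    using True m_pos index_simps[of 0 "d + 1"] by (simp only: ext_height_def) (simp add: Y_first Y_last)
qed (simp add: ext_height_def index_simps)

lemma ext_height_less_Suc: "ext_height i < ext_height (i + 1)"
proof -
  obtain k d where i: "k < m" "i = int k + int m * d" using index_decomp .
  have i1: "i + 1 = int (Suc k) + int m * d" using i by simp
  have "ext_height (i + 1) = Y (Suc k) + of_int d" unfolding i1 using i by (intro ext_height_eq) simp
  then show ?thesis using i ext_height_eq[of k d] Y_less[of k] by simp
qed

lemma ext_height_mono: "i \<le> j \<Longrightarrow> ext_height i \<le> ext_height j"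
proof (induction j rule: int_ge_induct)
  case (step j)
  then show ?case using ext_height_less_Suc[of j] by simp
qed simp

section \<open>From closed paths back to loop decompositions\<close>

definition closed_paths :: "nat list \<Rightarrow> (nat \<Rightarrow> real list) set" where
  "closed_paths xs = {p \<in> state_paths m (map home xs). p m = map home xs}"

definition ranks_at :: "(nat \<Rightarrow> real list) \<Rightarrow> nat \<Rightarrow> real \<Rightarrow> nat set" where
  "ranks_at p k s = {r. r < sum_list (cut_thickness w c) \<and> p k ! r = s}"

lemma home_state: "xs \<in> label_perms \<Longrightarrow> map home xs \<in> states 0"
proof -
  assume xs: "xs \<in> label_perms"
  have "card {u \<in> labels w c. home u = s} = thickness w (lev_edge 0 s)" if s: "s \<in> lev 0" for s
  proof -
    obtain j where j: "j < length (cut_thickness w c)" "s = sorted_list_of_set (lev 0) ! j"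
      using lev_0_nth[OF s] .
    then show ?thesis using home_fiber[OF j(1)] card_block[OF j(1)] by (simp add: cut_thickness_nth)
  qed
  then show ?thesis using xs label_perms_length[OF xs] home_in_lev
    by (auto simp: states_def label_perms_def count_list_map_distinct)
qed

context
  fixes xs p
  assumes xs: "xs \<in> label_perms" and p: "p \<in> closed_paths xs"
begin

lemma path_state: "k \<le> m \<Longrightarrow> p k \<in> states k"
  using p home_state[OF xs] by (cases k) (auto simp: closed_paths_def state_paths_def)

lemma path_length: "k \<le> m \<Longrightarrow> length (p k) = sum_list (cut_thickness w c)"
  using path_state by (auto simp: states_def)

lemma path_in_lev: "k \<le> m \<Longrightarrow> r < sum_list (cut_thickness w c) \<Longrightarrow> p k ! r \<in> lev k"
  using path_state[of k] by (auto simp: states_def)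

lemma path_step: "k < m \<Longrightarrow> r < sum_list (cut_thickness w c) \<Longrightarrow> down k (p (Suc k) ! r) = up k (p k ! r)"
  using p path_length[of k] path_length[of "Suc k"] unfolding closed_paths_def state_paths_def
  by (auto dest!: arg_cong[where f = "\<lambda>a. a ! r"] spec[of _ k])

lemma path_ends: "p 0 = map home xs" "p m = map home xs"
  using p by (auto simp: closed_paths_def state_paths_def)

lemma ranks_at_fibers:
  assumes "k < m"
  shows "(\<Union>s\<in>up_fiber k q. ranks_at p k s) = (\<Union>s\<in>down_fiber k q. ranks_at p (Suc k) s)"
  using path_step[OF assms] path_in_lev[of k] path_in_lev[of "Suc k"] assms
  by (auto simp: ranks_at_def up_fiber_def down_fiber_def)

text \<open>Both fibres over the point of the edge at the critical height are single slots, so no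
  strand can join or leave.\<close>

lemma ranks_at_inner_step:
  assumes k: "k < m" and e: "e \<in> edges w" "Y k + of_int d \<in> curve_inner e" "Y (Suc k) + of_int d \<in> curve_inner e"
  shows "ranks_at p k (curve e (Y k + of_int d)) = ranks_at p (Suc k) (curve e (Y (Suc k) + of_int d))"
proof -
  have z: "Z k + of_int d \<in> curve_inner e" using e Y_less[OF k] by (auto simp: curve_inner_def split: if_splits)
  have "frac (Z k + of_int d) = frac (Z k)" by simp
  note f = fibers_inner(1,2)[OF k e(1) z this]
  show ?thesis using ranks_at_fibers[OF k, of "curve e (Z k + of_int d)"] unfolding f by (simp add: add.commute)
qed

lemma ranks_at_ext_step:
  assumes e: "e \<in> edges w" "ext_height i \<in> curve_inner e" "ext_height (i + 1) \<in> curve_inner e"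
  shows "ranks_at p (nat (i mod int m)) (curve e (ext_height i))
       = ranks_at p (nat ((i + 1) mod int m)) (curve e (ext_height (i + 1)))"
proof -
  obtain k d where i: "k < m" "i = int k + int m * d" using index_decomp .
  have i1: "i + 1 = int (Suc k) + int m * d" using i by simp
  have h: "ext_height i = Y k + of_int d" "ext_height (i + 1) = Y (Suc k) + of_int d"
    using i(1) ext_height_eq[of k d] ext_height_eq[of "Suc k" d] unfolding i1 by (simp_all add: i(2))
  have "ranks_at p (nat ((i + 1) mod int m)) s = ranks_at p (Suc k) s" for s
  proof (cases "Suc k = m")
    case True
    then have "i + 1 = int 0 + int m * (d + 1)" using i by (simp add: algebra_simps)
    then have "nat ((i + 1) mod int m) = 0" using m_pos index_simps(1)[of 0 "d + 1"] by simp
    then show ?thesis using True path_ends by (simp add: ranks_at_def)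
  next
    case False
    then have "nat ((i + 1) mod int m) = Suc k" unfolding i1 using i(1) by (intro index_simps(1)) simp
    then show ?thesis by simp
  qed
  then show ?thesis
    using ranks_at_inner_step[OF i(1) e(1), of d] e i index_simps(1)[OF i(1), of d] h by simp
qed

lemma ranks_at_edge_mono:
  assumes e: "e \<in> edges w" "ext_height i \<in> curve_inner e" "ext_height j \<in> curve_inner e" "i \<le> j"
  shows "ranks_at p (nat (i mod int m)) (curve e (ext_height i))
       = ranks_at p (nat (j mod int m)) (curve e (ext_height j))"
  using e(4,3)
proof (induction j rule: int_ge_induct)
  case (step j)
  have "ext_height j \<in> curve_inner e"
    using e(2) step.prems ext_height_mono[OF step.hyps] ext_height_less_Suc[of j]
    by (auto simp: curve_inner_def split: if_splits)
  then show ?case using step ranks_at_ext_step[OF e(1), of j] by simp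
qed simp

lemma lev_ext_height:
  assumes k: "k \<le> m" and s: "s \<in> lev k"
  obtains i where "ext_height i \<in> curve_inner (lev_edge k s)" "s = curve (lev_edge k s) (ext_height i)"
    "ranks_at p (nat (i mod int m)) t = ranks_at p k t"
proof -
  obtain e \<sigma> where e: "e \<in> edges w" "\<sigma> \<in> curve_inner e" "frac \<sigma> = frac (Y k)" "s = curve e \<sigma>"
    using s slotsE unfolding lev_def by metis
  have le: "lev_edge k s = e" using slot_edge_curve[OF e(1-3)] e(4) by (simp add: lev_edge_def)
  obtain d where d: "\<sigma> = Y k + of_int d" using e(3) by (auto simp: frac_eq_iff)
  let ?i = "int k + int m * d"
  have h: "ext_height ?i = \<sigma>" using d ext_height_eq[OF k] by simp
  have "p (nat (?i mod int m)) = p k"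
  proof (cases "k = m")
    case True
    have "?i = int 0 + int m * (d + 1)" using True by (simp add: algebra_simps)
    then show ?thesis using True m_pos index_simps(1)[of 0 "d + 1"] path_ends by simp
  next
    case False
    then show ?thesis using k index_simps(1)[of k d] by simp
  qed
  then show ?thesis using that[of ?i] e le h by (simp add: ranks_at_def)
qed

text \<open>An edge may cross the same level many times while winding around the annulus. Its
  crossings are compared step by step along the indices of \<open>ext_height\<close>, and the step
  from level m to level 0 uses that the path is closed. Hence an edge has one well-defined set of
  ranks.\<close>

lemma ranks_at_edge_const:
  assumes "k \<le> m" "s \<in> lev k" "k' \<le> m" "s' \<in> lev k'" "lev_edge k s = lev_edge k' s'"
  shows "ranks_at p k s = ranks_at p k' s'"
proof -
  obtain i where i: "ext_height i \<in> curve_inner (lev_edge k s)" "s = curve (lev_edge k s) (ext_height i)"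
    "ranks_at p (nat (i mod int m)) s = ranks_at p k s" using lev_ext_height[OF assms(1,2)] by metis
  obtain j where j: "ext_height j \<in> curve_inner (lev_edge k' s')" "s' = curve (lev_edge k' s') (ext_height j)"
    "ranks_at p (nat (j mod int m)) s' = ranks_at p k' s'" using lev_ext_height[OF assms(3,4)] by metis
  have e: "lev_edge k s \<in> edges w" using lev_edge_in_edges[OF assms(2)] .
  have "ranks_at p (nat (i mod int m)) (curve (lev_edge k s) (ext_height i))
      = ranks_at p (nat (j mod int m)) (curve (lev_edge k s) (ext_height j))"
  proof (cases "i \<le> j")
    case True
    then show ?thesis using ranks_at_edge_mono[OF e i(1) j(1)[folded assms(5)]] by blast
  next
    case False
    then have "j \<le> i" by simp
    then show ?thesis using ranks_at_edge_mono[OF e j(1)[folded assms(5)] i(1)] by metis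
  qed
  then show ?thesis using i j assms(5) by metis
qed

text \<open>The inverse image of the path p under \<open>path_of xs\<close>.\<close>

definition labelling_of :: "'e \<Rightarrow> nat set" where
  "labelling_of = (\<lambda>e\<in>edges w. {xs ! r |r k s. k \<le> m \<and> s \<in> lev k \<and> lev_edge k s = e \<and> r \<in> ranks_at p k s})"

lemma labelling_of_lev:
  assumes "k \<le> m" "s \<in> lev k"
  shows "labelling_of (lev_edge k s) = (\<lambda>r. xs ! r) ` ranks_at p k s"
proof -
  have "labelling_of (lev_edge k s) = {xs ! r |r k' s'. k' \<le> m \<and> s' \<in> lev k' \<and> lev_edge k' s' = lev_edge k s \<and> r \<in> ranks_at p k' s'}"
    using lev_edge_in_edges[OF assms(2)] by (simp add: labelling_of_def)
  also have "\<dots> = {xs ! r |r. r \<in> ranks_at p k s}"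
    using ranks_at_edge_const[OF _ _ assms] assms by blast
  finally show ?thesis by blast
qed

lemma xs_inj: "inj_on (\<lambda>r. xs ! r) {..<sum_list (cut_thickness w c)}"
  using xs label_perms_length[OF xs] by (auto simp: inj_on_def label_perms_def nth_eq_iff_index_eq)

lemma labelling_of_disjoint:
  assumes "k \<le> m" "s \<in> lev k" "s' \<in> lev k" "s \<noteq> s'"
  shows "labelling_of (lev_edge k s) \<inter> labelling_of (lev_edge k s') = {}"
  unfolding labelling_of_lev[OF assms(1,2)] labelling_of_lev[OF assms(1,3)]
  using assms(4) inj_onD[OF xs_inj] by (auto simp: ranks_at_def)

lemma labelling_of_balanced:
  assumes "v \<in> vertices w"
  shows "balanced_at labelling_of v"
proof -
  obtain k where k: "k < m" "snd v = frac (Z k)" using vertex_height[OF assms] by metis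
  note b = fibers_vertex[OF k(1) assms k(2)]
  have lev: "up_fiber k (fst v) \<subseteq> lev k" "down_fiber k (fst v) \<subseteq> lev (Suc k)"
    by (auto simp: up_fiber_def down_fiber_def)
  have 1: "(\<Union>e\<in>in_edges w v. labelling_of e) = (\<Union>s\<in>up_fiber k (fst v). (\<lambda>r. xs ! r) ` ranks_at p k s)"
    unfolding bij_betw_imp_surj_on[OF b(1), symmetric] image_image
    using lev k labelling_of_lev[of k] by (intro SUP_cong) auto
  have 2: "(\<Union>e\<in>out_edges w v. labelling_of e) = (\<Union>s\<in>down_fiber k (fst v). (\<lambda>r. xs ! r) ` ranks_at p (Suc k) s)"
    unfolding bij_betw_imp_surj_on[OF b(2), symmetric] image_image
    using lev k labelling_of_lev[of "Suc k"] by (intro SUP_cong) auto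
  have "\<Union> (labelling_of ` in_edges w v) = \<Union> (labelling_of ` out_edges w v)"
    unfolding 1 2 using ranks_at_fibers[OF k(1), of "fst v"] by (simp only: image_UN[symmetric])
  moreover have "disjoint_family_on labelling_of (in_edges w v)"
    unfolding bij_betw_imp_surj_on[OF b(1), symmetric]
    by (rule disjoint_family_on_imageI, rule labelling_of_disjoint) (use lev k in auto)
  moreover have "disjoint_family_on labelling_of (out_edges w v)"
    unfolding bij_betw_imp_surj_on[OF b(2), symmetric]
    by (rule disjoint_family_on_imageI, rule labelling_of_disjoint) (use lev k in auto)
  ultimately show ?thesis by (simp add: balanced_at_def)
qed

lemma labelling_of_SLD: "labelling_of \<in> SLD w c"
  unfolding SLD_iff
proof (intro conjI ballI)
  have xn: "xs ! r \<in> labels w c" if "r < sum_list (cut_thickness w c)" for r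
    using that xs label_perms_length[OF xs] nth_mem[of r xs] by (simp add: label_perms_def)
  show "labelling_of \<in> edges w \<rightarrow>\<^sub>E Pow (labels w c)"
    using xn by (auto simp: labelling_of_def ranks_at_def)
  show "balanced_at labelling_of v" if "v \<in> vertices w" for v using labelling_of_balanced[OF that] .
  show "labelling_of (lev_edge 0 s) = {u \<in> labels w c. home u = s}" if s: "s \<in> lev 0" for s
  proof -
    have "(\<lambda>r. xs ! r) ` ranks_at p 0 s = {u \<in> set xs. home u = s}"
      using label_perms_length[OF xs] by (auto simp: ranks_at_def path_ends in_set_conv_nth)
    then show ?thesis using labelling_of_lev[OF le0 s] xs by (simp add: label_perms_def)
  qed
  show "card (labelling_of e) = thickness w e" if e: "e \<in> edges w" for e
  proof -
    obtain k s where k: "k \<le> m" "s \<in> lev k" "lev_edge k s = e" using edge_has_slot[OF e] by blast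
    have "card (labelling_of e) = card (ranks_at p k s)"
      unfolding k(3)[symmetric] labelling_of_lev[OF k(1,2)]
      by (intro card_image inj_on_subset[OF xs_inj]) (auto simp: ranks_at_def)
    also have "\<dots> = count_list (p k) s"
    proof -
      have "p k = map (\<lambda>r. p k ! r) [0..<sum_list (cut_thickness w c)]"
        using path_length[OF k(1)] by (metis map_nth)
      then show ?thesis
        using count_list_map_distinct[of "[0..<sum_list (cut_thickness w c)]" "\<lambda>r. p k ! r" s]
        by (simp add: ranks_at_def)
    qed
    also have "\<dots> = thickness w e" using path_state[OF k(1)] k by (simp add: states_def)
    finally show ?thesis .
  qed
qed

lemma path_of_labelling_of: "path_of xs labelling_of = p"
proof
  fix k
  show "path_of xs labelling_of k = p k"
  proof (cases "k \<le> m")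
    case True
    have "loop_pos labelling_of k (xs ! r) = p k ! r" if "r < sum_list (cut_thickness w c)" for r
      using that True path_in_lev[OF True that] labelling_of_lev[OF True path_in_lev[OF True that]]
      by (intro loop_pos_eq labelling_of_SLD) (auto simp: ranks_at_def)
    then show ?thesis using True path_length[OF True] label_perms_length[OF xs]
      by (auto simp: path_of_def intro: nth_equalityI)
  next
    case False
    then show ?thesis using p by (simp add: path_of_def closed_paths_def state_paths_def)
  qed
qed

end

text \<open>Every edge meets some level, so the positions at the levels determine all label sets; a
  preimage of a closed path is \<open>labelling_of\<close>.\<close>

lemma bij_betw_SLD_closed_paths:
  assumes xs: "xs \<in> label_perms"
  shows "bij_betw (path_of xs) (SLD w c) (closed_paths xs)"
proof -
  have "L e = L' e" if L: "L \<in> SLD w c" "L' \<in> SLD w c" and eq: "path_of xs L = path_of xs L'" for L L' e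
  proof (cases "e \<in> edges w")
    case False
    then show ?thesis using L by (auto simp: SLD_iff PiE_def extensional_def)
  next
    case True
    then obtain k s where k: "k \<le> m" "s \<in> lev k" "lev_edge k s = e" using edge_has_slot by blast
    have "map (loop_pos L k) xs = map (loop_pos L' k) xs"
      using eq k by (metis path_of_def)
    then have "loop_pos L k u = loop_pos L' k u" if "u \<in> labels w c" for u
      using that xs by (auto simp: label_perms_def)
    then have "{u \<in> labels w c. loop_pos L k u = s} = {u \<in> labels w c. loop_pos L' k u = s}" by auto
    then show ?thesis using loop_pos_fiber[OF L(1) k(1,2)] loop_pos_fiber[OF L(2) k(1,2)] k(3) by simp
  qed
  then have "inj_on (path_of xs) (SLD w c)" by (intro inj_onI ext)
  moreover have "path_of xs ` SLD w c = closed_paths xs"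
    using path_of_in_paths[OF _ xs] path_of_labelling_of[OF xs] labelling_of_SLD[OF xs]
    by (force simp: closed_paths_def image_iff)
  ultimately show ?thesis by (simp add: bij_betw_def)
qed

end

section \<open>Weights of loop decompositions\<close>

lemma power_int_sum:
  assumes "q \<noteq> (0 :: 'f::field)"
  shows "q powi (\<Sum>x\<in>A. f x) = (\<Prod>x\<in>A. q powi f x)"
  by (induction A rule: infinite_finite_induct) (auto simp: power_int_add assms)

definition label_rank :: "'a list \<Rightarrow> 'a \<Rightarrow> nat" where
  "label_rank xs u = (THE r. r < length xs \<and> xs ! r = u)"

lemma label_rank_nth: "distinct xs \<Longrightarrow> r < length xs \<Longrightarrow> label_rank xs (xs ! r) = r"
  unfolding label_rank_def by (intro the_equality) (auto simp: nth_eq_iff_index_eq)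

lemma nth_label_rank:
  assumes "distinct xs" "u \<in> set xs"
  shows "label_rank xs u < length xs" "xs ! label_rank xs u = u"
  using assms by (auto simp: in_set_conv_nth label_rank_nth)

text \<open>Pairs of places, ordered by rank, are re-indexed as pairs of labels ordered by their
  value under f. Pairs with equal values drop out by \<open>h\<close>.\<close>

lemma prod_index_pairs:
  fixes f :: "'a \<Rightarrow> 'k::linorder" and h :: "'a \<Rightarrow> 'a \<Rightarrow> 'f::field"
  assumes d: "distinct xs" and h: "\<And>u v. f u = f v \<Longrightarrow> h u v = 1"
  shows "(\<Prod>(i, j)\<in>{(i, j). i < j \<and> j < length xs}. h (xs ! i) (xs ! j)) =
    (\<Prod>(u, v)\<in>{(u, v). u \<in> set xs \<and> v \<in> set xs \<and> f u < f v}. if label_rank xs u < label_rank xs v then h u v else h v u)"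
proof -
  let ?P = "{(i, j). i < j \<and> j < length xs \<and> f (xs ! i) \<noteq> f (xs ! j)}"
  have "(\<Prod>(i, j)\<in>{(i, j). i < j \<and> j < length xs}. h (xs ! i) (xs ! j)) = (\<Prod>(i, j)\<in>?P. h (xs ! i) (xs ! j))"
    by (rule prod.mono_neutral_right) (auto simp: h)
  also have "\<dots> = (\<Prod>(u, v)\<in>{(u, v). u \<in> set xs \<and> v \<in> set xs \<and> f u < f v}. if label_rank xs u < label_rank xs v then h u v else h v u)"
  proof (rule prod.reindex_bij_witness[of _ "\<lambda>(u, v). (min (label_rank xs u) (label_rank xs v), max (label_rank xs u) (label_rank xs v))"
        "\<lambda>(i, j). if f (xs ! i) < f (xs ! j) then (xs ! i, xs ! j) else (xs ! j, xs ! i)"])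
    fix a assume a: "a \<in> ?P"
    then obtain i j where ij: "a = (i, j)" "i < j" "j < length xs" "f (xs ! i) \<noteq> f (xs ! j)" by blast
    have r: "label_rank xs (xs ! i) = i" "label_rank xs (xs ! j) = j" using label_rank_nth[OF d] ij by auto
    show "(case case a of (i, j) \<Rightarrow> if f (xs ! i) < f (xs ! j) then (xs ! i, xs ! j) else (xs ! j, xs ! i) of
            (u, v) \<Rightarrow> (min (label_rank xs u) (label_rank xs v), max (label_rank xs u) (label_rank xs v))) = a"
      using ij r by (simp add: min_def max_def)
    show "(case a of (i, j) \<Rightarrow> if f (xs ! i) < f (xs ! j) then (xs ! i, xs ! j) else (xs ! j, xs ! i)) \<in>
       {(u, v). u \<in> set xs \<and> v \<in> set xs \<and> f u < f v}"
      using ij by auto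
    show "(case case a of (i, j) \<Rightarrow> if f (xs ! i) < f (xs ! j) then (xs ! i, xs ! j) else (xs ! j, xs ! i) of
            (u, v) \<Rightarrow> if label_rank xs u < label_rank xs v then h u v else h v u) = (case a of (i, j) \<Rightarrow> h (xs ! i) (xs ! j))"
      using ij r by simp
  next
    fix b assume b: "b \<in> {(u, v). u \<in> set xs \<and> v \<in> set xs \<and> f u < f v}"
    then obtain u v where uv: "b = (u, v)" "u \<in> set xs" "v \<in> set xs" "f u < f v" by blast
    note nu = nth_label_rank[OF d uv(2)] and nv = nth_label_rank[OF d uv(3)]
    have ne: "label_rank xs u \<noteq> label_rank xs v" using nu nv uv by (metis order_less_irrefl)
    show "(case case b of (u, v) \<Rightarrow> (min (label_rank xs u) (label_rank xs v), max (label_rank xs u) (label_rank xs v)) of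
       (i, j) \<Rightarrow> if f (xs ! i) < f (xs ! j) then (xs ! i, xs ! j) else (xs ! j, xs ! i)) = b"
      using uv nu nv by (auto simp: min_def max_def)
    show "(case b of (u, v) \<Rightarrow> (min (label_rank xs u) (label_rank xs v), max (label_rank xs u) (label_rank xs v))) \<in> ?P"
      using uv nu nv ne by (auto simp: min_def max_def)
  qed
  finally show ?thesis .
qed

text \<open>The two orders exchange their roles: \<open>merge_weight\<close> lists pairs by rank and
  weighs them by position, whereas attacking pairs are listed by position, left before right, and
  weighed by rank, which is what \<open>eps\<close> does.\<close>

lemma merge_weight_map:
  fixes f :: "nat \<Rightarrow> 'k::linorder"
  assumes q: "q \<noteq> (0::'f::field)" and d: "distinct xs"
  shows "merge_weight q \<phi> (map f xs) =
    (\<Prod>(u, v)\<in>{(u, v). u \<in> set xs \<and> v \<in> set xs \<and> f u < f v \<and> \<phi> (f u) = \<phi> (f v)}. q powi eps (label_rank xs) u v)"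
proof -
  have fin: "finite {(u, v). u \<in> set xs \<and> v \<in> set xs \<and> f u < f v}"
    by (rule finite_subset[of _ "set xs \<times> set xs"]) auto
  have "merge_weight q \<phi> (map f xs) =
      (\<Prod>(i, j)\<in>{(i, j). i < j \<and> j < length xs}. pair_weight q \<phi> (f (xs ! i)) (f (xs ! j)))"
    unfolding merge_weight_def by (rule prod.cong) auto
  also have "\<dots> = (\<Prod>(u, v)\<in>{(u, v). u \<in> set xs \<and> v \<in> set xs \<and> f u < f v}.
      if label_rank xs u < label_rank xs v then pair_weight q \<phi> (f u) (f v) else pair_weight q \<phi> (f v) (f u))"
    by (rule prod_index_pairs[OF d]) (simp add: pair_weight_def)
  also have "\<dots> = (\<Prod>(u, v)\<in>{(u, v). u \<in> set xs \<and> v \<in> set xs \<and> f u < f v \<and> \<phi> (f u) = \<phi> (f v)}.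
      if label_rank xs u < label_rank xs v then pair_weight q \<phi> (f u) (f v) else pair_weight q \<phi> (f v) (f u))"
    using fin by (intro prod.mono_neutral_right) (auto simp: pair_weight_def split: if_splits)
  also have "\<dots> = (\<Prod>(u, v)\<in>{(u, v). u \<in> set xs \<and> v \<in> set xs \<and> f u < f v \<and> \<phi> (f u) = \<phi> (f v)}. q powi eps (label_rank xs) u v)"
  proof (rule prod.cong[OF HOL.refl], clarify)
    fix u v assume uv: "u \<in> set xs" "v \<in> set xs" "f u < f v" "\<phi> (f u) = \<phi> (f v)"
    have "label_rank xs u \<noteq> label_rank xs v" using nth_label_rank[OF d uv(1)] nth_label_rank[OF d uv(2)] uv(3) by (metis order_less_irrefl)
    then show "(if label_rank xs u < label_rank xs v then pair_weight q \<phi> (f u) (f v) else pair_weight q \<phi> (f v) (f u))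
        = q powi eps (label_rank xs) u v"
      using uv by (auto simp: pair_weight_def eps_def power_int_minus field_simps)
  qed
  finally show ?thesis .
qed

context layered_web
begin

lemma finite_labels [simp]: "finite (labels w c)"
  by (simp add: labels_def)

lemma web_inv_eq:
  assumes L: "L \<in> SLD w c"
  shows "web_inv w c L \<sigma> =
    (\<Sum>j<length (cut_thickness w c). \<Sum>(u, v)\<in>{(u, v). u \<in> block (cut_thickness w c) j \<and> v \<in> block (cut_thickness w c) j \<and> u < v}. eps \<sigma> u v) +
    (\<Sum>p\<in>merges w. \<Sum>(u, v)\<in>{(u, v). left_in w p \<in> loop w L u \<and> right_in w p \<in> loop w L v}. eps \<sigma> u v)"
proof -
  have image_sum: "image_mset f (\<Sum>i\<in>A. M i) = (\<Sum>i\<in>A. image_mset f (M i))"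
    for A :: "'i set" and M and f :: "nat \<times> nat \<Rightarrow> int"
    by (induction A rule: infinite_finite_induct) auto
  have sum_mset_sum: "sum_mset (\<Sum>i\<in>A. M i) = (\<Sum>i\<in>A. sum_mset (M i))"
    for A :: "'i set" and M :: "'i \<Rightarrow> int multiset"
    by (induction A rule: infinite_finite_induct) auto
  have image_sum': "image_mset f (\<Sum>i\<in>A. M i) = (\<Sum>i\<in>A. image_mset f (M i))"
    for A :: "'j set" and M and f :: "nat \<times> nat \<Rightarrow> int"
    by (induction A rule: infinite_finite_induct) auto
  have sum_mset_sum': "sum_mset (\<Sum>i\<in>A. M i) = (\<Sum>i\<in>A. sum_mset (M i))"
    for A :: "'j set" and M :: "'j \<Rightarrow> int multiset"
    by (induction A rule: infinite_finite_induct) auto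
  show ?thesis
    unfolding web_inv_def attacking_pairs_def
    by (simp add: image_sum sum_mset_sum image_sum' sum_mset_sum' flip: sum_unfold_sum_mset)
qed

definition level_merges :: "nat \<Rightarrow> (real \<times> real) set" where
  "level_merges i = {p \<in> merges w. snd p = frac (Z i)}"

lemma merges_levels: "merges w = (\<Union>i<m. level_merges i)"
  "i < m \<Longrightarrow> j < m \<Longrightarrow> i \<noteq> j \<Longrightarrow> level_merges i \<inter> level_merges j = {}"
  using vertex_height Z_inj by (fastforce simp: level_merges_def merges_def)+

lemma finite_merges: "finite (merges w)"
  using finite_vertices by (auto simp: merges_def)

lemma merge_fiber:
  assumes "i < m" "p \<in> level_merges i"
  obtains s1 s2 where "up_fiber i (fst p) = {s1, s2}" "s1 < s2"
    "left_in w p = lev_edge i s1" "right_in w p = lev_edge i s2" "s1 \<in> lev i" "s2 \<in> lev i"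
proof -
  have p: "p \<in> merges w" "p \<in> vertices w" "snd p = frac (Z i)"
    using assms(2) by (auto simp: level_merges_def merges_def)
  have "card (up_fiber i (fst p)) = 2"
    using bij_betw_same_card[OF fibers_vertex(1)[OF assms(1) p(2,3)]] p(1) by (simp add: merges_def)
  then obtain a b where "up_fiber i (fst p) = {a, b}" "a \<noteq> b" by (auto simp: card_2_iff)
  then obtain s1 s2 where s: "up_fiber i (fst p) = {s1, s2}" "s1 < s2"
    by (cases a b rule: linorder_cases) auto
  then have "s1 \<in> up_fiber i (fst p)" "s2 \<in> up_fiber i (fst p)" by auto
  then have m: "s1 \<in> lev i" "s2 \<in> lev i" "up i s1 = fst p" "up i s2 = fst p" by (auto simp: up_fiber_def)
  then show ?thesis
    using that[OF s] left_right_in(1,2)[OF layers[OF assms(1)] p(1,3), of s1 s2] s(2)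
    by (auto simp: lev_def up_def lev_edge_def)
qed

text \<open>Two different slots of a level that meet at the critical height can only meet at a
  merge, and the smaller slot is the left incoming edge.\<close>

lemma level_pairs:
  assumes L: "L \<in> SLD w c" and i: "i < m"
  shows "{(u, v). u \<in> labels w c \<and> v \<in> labels w c \<and> loop_pos L i u < loop_pos L i v \<and>
      up i (loop_pos L i u) = up i (loop_pos L i v)} =
    (\<Union>p\<in>level_merges i. {(u, v). left_in w p \<in> loop w L u \<and> right_in w p \<in> loop w L v})" (is "?A = ?B")
proof (intro set_eqI iffI)
  fix x assume "x \<in> ?A"
  then obtain u v where x: "x = (u, v)" and uv: "u \<in> labels w c" "v \<in> labels w c"
    "loop_pos L i u < loop_pos L i v" "up i (loop_pos L i u) = up i (loop_pos L i v)" by blast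
  let ?s = "loop_pos L i u" and ?t = "loop_pos L i v"
  have st: "?s \<in> lev i" "?t \<in> lev i" "u \<in> L (lev_edge i ?s)" "v \<in> L (lev_edge i ?t)"
    using loop_pos[OF L _ uv(1), of i] loop_pos[OF L _ uv(2), of i] i by auto
  have f: "?s \<in> up_fiber i (up i ?s)" "?t \<in> up_fiber i (up i ?s)" using st uv(4) by (auto simp: up_fiber_def)
  then have "up_fiber i (up i ?s) \<noteq> {} \<or> down_fiber i (up i ?s) \<noteq> {}" by blast
  from i this show "x \<in> ?B"
  proof (cases rule: fiber_cases)
    case (1 a b)
    then show ?thesis using f uv(3) by auto
  next
    case (2 p)
    have "{?s, ?t} \<subseteq> up_fiber i (up i ?s)" using f by simp
    moreover have "finite (up_fiber i (up i ?s))" by (simp add: up_fiber_def)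
    ultimately have "card {?s, ?t} \<le> card (up_fiber i (up i ?s))" by (rule card_mono[rotated])
    then have "card (in_edges w p) \<noteq> 1" using uv(3) bij_betw_same_card[OF 2(4)] by auto
    then have "p \<in> merges w" using vertex_trivalent[OF 2(1)] by (auto simp: splits_def)
    then have pm: "p \<in> level_merges i" using 2 by (simp add: level_merges_def)
    obtain s1 s2 where s: "up_fiber i (fst p) = {s1, s2}" "s1 < s2"
      "left_in w p = lev_edge i s1" "right_in w p = lev_edge i s2" using merge_fiber[OF i pm] by metis
    then have "?s = s1" "?t = s2" using f uv(3) 2(3) by auto
    then have "left_in w p \<in> loop w L u" "right_in w p \<in> loop w L v"
      using s st lev_edge_in_edges by (auto simp: loop_def)
    then show ?thesis using pm x by blast
  qed
next
  fix x assume "x \<in> ?B"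
  then obtain u v p where x: "x = (u, v)" and p: "p \<in> level_merges i"
    "left_in w p \<in> loop w L u" "right_in w p \<in> loop w L v" by blast
  obtain s1 s2 where s: "up_fiber i (fst p) = {s1, s2}" "s1 < s2"
      "left_in w p = lev_edge i s1" "right_in w p = lev_edge i s2" "s1 \<in> lev i" "s2 \<in> lev i"
    using merge_fiber[OF i p(1)] by metis
  have uL: "u \<in> L (lev_edge i s1)" "v \<in> L (lev_edge i s2)" using p s by (auto simp: loop_def)
  then have "loop_pos L i u = s1" "loop_pos L i v = s2" using loop_pos_eq[OF L _ s(5)] loop_pos_eq[OF L _ s(6)] i by auto
  moreover have "up i s1 = up i s2"
  proof -
    have "s1 \<in> up_fiber i (fst p)" "s2 \<in> up_fiber i (fst p)" using s(1) by auto
    then show ?thesis by (simp add: up_fiber_def)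
  qed
  moreover have "u \<in> labels w c" "v \<in> labels w c"
    using uL SLD_subset_labels[OF L] lev_edge_in_edges s by blast+
  ultimately show "x \<in> ?A" using x s(2) by simp
qed

text \<open>A loop has a single position on each level, so it cannot enter two merges of one
  layer.\<close>

lemma merge_pairs_disjoint:
  assumes L: "L \<in> SLD w c" and i: "i < m" and p: "p \<in> level_merges i" "p' \<in> level_merges i" "p \<noteq> p'"
  shows "{(u, v). left_in w p \<in> loop w L u \<and> right_in w p \<in> loop w L v} \<inter>
    {(u, v). left_in w p' \<in> loop w L u \<and> right_in w p' \<in> loop w L v} = {}"
proof (rule ccontr)
  assume "\<not> ?thesis"
  then obtain u where u: "left_in w p \<in> loop w L u" "left_in w p' \<in> loop w L u" by auto
  obtain s1 where s: "s1 \<in> up_fiber i (fst p)" "left_in w p = lev_edge i s1" "s1 \<in> lev i"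
    using merge_fiber[OF i p(1)] by (metis insertI1)
  obtain t1 where t: "t1 \<in> up_fiber i (fst p')" "left_in w p' = lev_edge i t1" "t1 \<in> lev i"
    using merge_fiber[OF i p(2)] by (metis insertI1)
  have "s1 = t1"
    using loop_pos_eq[OF L _ s(3), of u] loop_pos_eq[OF L _ t(3), of u] u s t i by (auto simp: loop_def)
  then have "fst p = fst p'" using s t by (simp add: up_fiber_def)
  then show False using p by (auto simp: level_merges_def prod_eq_iff)
qed

text \<open>The factor of \<open>home\<close> accounts for the pairs inside the blocks of the cut,
  the factor of \<open>up i\<close> for the merges in layer i.\<close>

theorem SLD_weight:
  assumes q: "q \<noteq> (0::'f::field)" and L: "L \<in> SLD w c" and xs: "xs \<in> label_perms"
  shows "merge_weight q home xs * (\<Prod>i<m. merge_weight q (up i) (path_of xs L i)) = q powi web_inv w c L (label_rank xs)"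
proof -
  let ?\<alpha> = "cut_thickness w c" and ?e = "\<lambda>(u, v). q powi eps (label_rank xs) u v"
  let ?M = "\<lambda>p. {(u, v). left_in w p \<in> loop w L u \<and> right_in w p \<in> loop w L v}"
  let ?B = "\<lambda>j. {(u, v). u \<in> block ?\<alpha> j \<and> v \<in> block ?\<alpha> j \<and> u < v}"
  have d: "distinct xs" "set xs = labels w c" using xs by (auto simp: label_perms_def)
  have finB: "finite (?B j)" for j
    by (rule finite_subset[of _ "block ?\<alpha> j \<times> block ?\<alpha> j"]) (auto simp: block_def)
  have blocks: "{(u, v). u \<in> labels w c \<and> v \<in> labels w c \<and> u < v \<and> home u = home v} = (\<Union>j<length ?\<alpha>. ?B j)"
  proof (intro set_eqI iffI)
    fix x assume "x \<in> {(u, v). u \<in> labels w c \<and> v \<in> labels w c \<and> u < v \<and> home u = home v}"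
    then obtain u v where x: "x = (u, v)" "u \<in> labels w c" "v \<in> labels w c" "u < v" "home u = home v" by blast
    obtain j where j: "j < length ?\<alpha>" "u \<in> block ?\<alpha> j" "home u = sorted_list_of_set (lev 0) ! j"
      using labels_block[OF x(2)] .
    then have "v \<in> block ?\<alpha> j" using home_fiber[OF j(1)] x by auto
    then show "x \<in> (\<Union>j<length ?\<alpha>. ?B j)" using x j by auto
  next
    fix x assume "x \<in> (\<Union>j<length ?\<alpha>. ?B j)"
    then obtain j u v where "j < length ?\<alpha>" "x = (u, v)" "u \<in> block ?\<alpha> j" "v \<in> block ?\<alpha> j" "u < v" by auto
    then show "x \<in> {(u, v). u \<in> labels w c \<and> v \<in> labels w c \<and> u < v \<and> home u = home v}"
      using home_block block_subset_labels by (auto simp: subset_iff)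
  qed
  have "merge_weight q home (map (\<lambda>u. u) xs) = prod ?e (\<Union>j<length ?\<alpha>. ?B j)"
    unfolding merge_weight_map[OF q d(1), of home "\<lambda>u. u"] d(2) blocks ..
  also have "\<dots> = (\<Prod>j<length ?\<alpha>. prod ?e (?B j))"
    using finB block_less[of _ _ _ ?\<alpha>] by (intro prod.UNION_disjoint) (auto, metis linorder_neqE_nat order_less_irrefl)
  finally have 1: "merge_weight q home xs = (\<Prod>j<length ?\<alpha>. prod ?e (?B j))" by simp
  have finM: "finite (?M p)" if "p \<in> level_merges i" "i < m" for p i
  proof (rule finite_subset)
    show "?M p \<subseteq> labels w c \<times> labels w c"
      using SLD_subset_labels[OF L] by (auto simp: loop_def)
  qed simp
  have finl: "finite (level_merges i)" for i using finite_merges by (simp add: level_merges_def)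
  have "merge_weight q (up i) (path_of xs L i) = (\<Prod>p\<in>level_merges i. prod ?e (?M p))" if i: "i < m" for i
  proof -
    have "merge_weight q (up i) (path_of xs L i) = prod ?e (\<Union>p\<in>level_merges i. ?M p)"
      using i by (simp only: path_of_def merge_weight_map[OF q d(1)] d(2) level_pairs[OF L i] less_imp_le if_True)
    also have "\<dots> = (\<Prod>p\<in>level_merges i. prod ?e (?M p))"
      using finl finM[OF _ i] merge_pairs_disjoint[OF L i] by (intro prod.UNION_disjoint) auto
    finally show ?thesis .
  qed
  then have "(\<Prod>i<m. merge_weight q (up i) (path_of xs L i)) = (\<Prod>i<m. \<Prod>p\<in>level_merges i. prod ?e (?M p))"
    by simp
  also have "\<dots> = (\<Prod>p\<in>merges w. prod ?e (?M p))"
    unfolding merges_levels(1) using finl merges_levels(2) by (intro prod.UNION_disjoint[symmetric]) auto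
  finally have 2: "(\<Prod>i<m. merge_weight q (up i) (path_of xs L i)) = (\<Prod>p\<in>merges w. prod ?e (?M p))" .
  show ?thesis
    unfolding web_inv_eq[OF L] 1 2 using q by (simp add: power_int_add power_int_sum case_prod_unfold)
qed

end

section \<open>The operator of one turn around the annulus\<close>

lemma qvar_nonzero: "qvar \<noteq> 0"
  by (simp add: qvar_def eq_fract Zero_fract_def)

lemma count_list_swap_at: "Suc i < length xs \<Longrightarrow> count_list (swap_at i xs) a = count_list xs a"
  using mset_swap[of "Suc i" xs i] by (simp add: swap_at_def flip: count_mset)

context layered_web
begin

text \<open>Operators act on functions and so run against the orientation of the web:
  \<open>split_op\<close> leads from level k + 1 to the critical height, \<open>merge_op\<close>
  from there to level k.\<close>

definition level_op :: "'f::field \<Rightarrow> nat \<Rightarrow> (real list \<Rightarrow> 'f) \<Rightarrow> real list \<Rightarrow> 'f" where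
  "level_op q k g = merge_op q (sum_list (cut_thickness w c)) (lev k) (up k) (split_op (states (Suc k)) (down k) g)"

fun levels_op :: "'f::field \<Rightarrow> nat \<Rightarrow> (real list \<Rightarrow> 'f) \<Rightarrow> real list \<Rightarrow> 'f" where
  "levels_op q 0 g = g"
| "levels_op q (Suc k) g = levels_op q k (level_op q k g)"

text \<open>The cut is treated as one more layer, merging and splitting the labels of each block
  along \<open>home\<close>. Thus the module is spanned by the orders of the labels, and the merge
  contributes the attacking pairs of the blocks.\<close>

definition cycle_op :: "'f::field \<Rightarrow> (nat list \<Rightarrow> 'f) \<Rightarrow> nat list \<Rightarrow> 'f" where
  "cycle_op q g = merge_op q (sum_list (cut_thickness w c)) (labels w c) home
     (levels_op q m (split_op label_perms home g))"

lemma finite_states: "finite (states k)"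
  by (rule finite_subset[OF _ finite_lists_length_eq[OF finite_lev, of k "sum_list (cut_thickness w c)"]])
     (auto simp: states_def)

lemma finite_label_perms: "finite label_perms"
  by (rule finite_subset[OF _ finite_lists_length_eq[OF finite_labels, of "sum_list (cut_thickness w c)"]])
     (auto simp: label_perms_length, auto simp: label_perms_def)

lemma states_swap_at: "xs \<in> states k \<Longrightarrow> Suc i < sum_list (cut_thickness w c) \<Longrightarrow> swap_at i xs \<in> states k"
  by (auto simp: states_def count_list_swap_at set_swap_at)

lemma label_perms_swap_at: "xs \<in> label_perms \<Longrightarrow> Suc i < sum_list (cut_thickness w c) \<Longrightarrow> swap_at i xs \<in> label_perms"
  using label_perms_length[of xs] by (auto simp: label_perms_def set_swap_at swap_at_def distinct_swap)

lemma hecke_op_level_op: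
  assumes "q \<noteq> (0::'f::field)" "k < m" "Suc i < sum_list (cut_thickness w c)"
  shows "hecke_op q (sum_list (cut_thickness w c)) i (level_op q k g)
    = level_op q k (hecke_op q (sum_list (cut_thickness w c)) i g)"
  unfolding level_op_def
  by (subst hecke_op_merge_op[OF assms(1) up_mono_on[OF assms(2)] assms(3)],
      subst hecke_op_split_op[OF assms(1) down_mono_on[OF assms(2)] assms(3) finite_states])
     (auto simp: states_swap_at assms(3), auto simp: states_def)

lemma hecke_op_levels_op:
  assumes "q \<noteq> (0::'f::field)" "k \<le> m" "Suc i < sum_list (cut_thickness w c)"
  shows "hecke_op q (sum_list (cut_thickness w c)) i (levels_op q k g)
    = levels_op q k (hecke_op q (sum_list (cut_thickness w c)) i g)"
  using assms(2) by (induction k arbitrary: g) (auto simp: hecke_op_level_op[OF assms(1) _ assms(3)])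

lemma hecke_op_cycle_op:
  assumes "q \<noteq> (0::'f::field)" "Suc i < sum_list (cut_thickness w c)"
  shows "hecke_op q (sum_list (cut_thickness w c)) i (cycle_op q g)
    = cycle_op q (hecke_op q (sum_list (cut_thickness w c)) i g)"
  unfolding cycle_op_def
  by (subst hecke_op_merge_op[OF assms(1) home_mono assms(2)],
      subst hecke_op_levels_op[OF assms(1) _ assms(2)], simp,
      subst hecke_op_split_op[OF assms(1) home_mono assms(2) finite_label_perms])
     (auto simp: label_perms_swap_at assms(2) label_perms_length, auto simp: label_perms_def)

lemma split_op_linear:
  "split_op S \<psi> (\<lambda>y. a * g y + b * h y) = (\<lambda>x. a * split_op S \<psi> g x + b * split_op S \<psi> h x)"
  by (rule ext) (simp add: split_op_def sum.distrib sum_distrib_left)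

lemma level_op_linear:
  "level_op q k (\<lambda>y. a * g y + b * h y) = (\<lambda>x. a * level_op q k g x + b * level_op q k h x)"
  by (rule ext) (simp add: level_op_def split_op_linear merge_op_def algebra_simps)

lemma levels_op_linear:
  "levels_op q k (\<lambda>y. a * g y + b * h y) = (\<lambda>x. a * levels_op q k g x + b * levels_op q k h x)"
  by (induction k arbitrary: g h) (auto simp: level_op_linear)

lemma cycle_op_linear:
  "cycle_op q (\<lambda>y. a * g y + b * h y) x = a * cycle_op q g x + b * cycle_op q h x"
  by (simp add: cycle_op_def split_op_linear levels_op_linear merge_op_def algebra_simps)

lemma finite_state_paths: "finite (state_paths k a)"
proof (rule finite_subset)
  let ?S = "insert a (insert [] (\<Union>i\<le>k. states i))"
  show "state_paths k a \<subseteq> {p. \<forall>i. (i \<in> {..k} \<longrightarrow> p i \<in> ?S) \<and> (i \<notin> {..k} \<longrightarrow> p i = [])}"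
  proof
    fix p assume p: "p \<in> state_paths k a"
    have "p i \<in> ?S" if "i \<le> k" for i
    proof (cases i)
      case 0
      then show ?thesis using p by (simp add: state_paths_def)
    next
      case (Suc j)
      then have "p i \<in> states i" using that p by (simp add: state_paths_def)
      then show ?thesis using that by blast
    qed
    then show "p \<in> {p. \<forall>i. (i \<in> {..k} \<longrightarrow> p i \<in> ?S) \<and> (i \<notin> {..k} \<longrightarrow> p i = [])}"
      using p by (auto simp: state_paths_def)
  qed
  show "finite {p. \<forall>i. (i \<in> {..k} \<longrightarrow> p i \<in> ?S) \<and> (i \<notin> {..k} \<longrightarrow> p i = [])}"
    by (rule finite_set_of_finite_funs) (auto simp: finite_states)
qed

text \<open>The expansion of a product of matrices as a sum over paths.\<close>

lemma levels_op_paths: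
  assumes a: "a \<in> states 0"
  shows "levels_op q k g a = (\<Sum>p\<in>state_paths k a. (\<Prod>i<k. merge_weight q (up i) (p i)) * g (p k))"
proof (induction k arbitrary: g)
  case 0
  have "state_paths 0 a = {(\<lambda>_. [])(0 := a)}" by (auto simp: state_paths_def fun_eq_iff)
  then show ?case by simp
next
  case (Suc k)
  let ?n = "sum_list (cut_thickness w c)"
  have st: "p k \<in> states k" if "p \<in> state_paths k a" for p
    using that a by (cases k) (auto simp: state_paths_def)
  let ?S = "\<lambda>p. {a' \<in> states (Suc k). map (down k) a' = map (up k) (p k)}"
  have "levels_op q (Suc k) g a = (\<Sum>p\<in>state_paths k a. (\<Prod>i<k. merge_weight q (up i) (p i)) * level_op q k g (p k))"
    using Suc.IH by simp
  also have "\<dots> = (\<Sum>p\<in>state_paths k a. \<Sum>a'\<in>?S p. (\<Prod>i<Suc k. merge_weight q (up i) (p i)) * g a')"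
  proof (rule sum.cong[OF HOL.refl])
    fix p assume "p \<in> state_paths k a"
    then have "level_op q k g (p k) = merge_weight q (up k) (p k) * (\<Sum>a'\<in>?S p. g a')"
      using st by (auto simp: level_op_def merge_op_def split_op_def states_def)
    then show "(\<Prod>i<k. merge_weight q (up i) (p i)) * level_op q k g (p k)
        = (\<Sum>a'\<in>?S p. (\<Prod>i<Suc k. merge_weight q (up i) (p i)) * g a')"
      by (simp add: sum_distrib_left algebra_simps)
  qed
  also have "\<dots> = (\<Sum>(p, a')\<in>(SIGMA p:state_paths k a. ?S p). (\<Prod>i<Suc k. merge_weight q (up i) (p i)) * g a')"
    by (rule sum.Sigma) (auto simp: finite_state_paths finite_states)
  also have "\<dots> = (\<Sum>p\<in>state_paths (Suc k) a. (\<Prod>i<Suc k. merge_weight q (up i) (p i)) * g (p (Suc k)))"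
  proof (rule sum.reindex_bij_witness[of _ "\<lambda>p. (p(Suc k := []), p (Suc k))" "\<lambda>(p, a'). p(Suc k := a')"])
    fix x assume x: "x \<in> (SIGMA p:state_paths k a. ?S p)"
    obtain p a' where xp: "x = (p, a')" by fastforce
    have p: "p \<in> state_paths k a" "a' \<in> states (Suc k)" "map (down k) a' = map (up k) (p k)"
      using x xp by auto
    then have "p (Suc k) = []" by (simp add: state_paths_def)
    then show "((case x of (p, a') \<Rightarrow> p(Suc k := a'))(Suc k := []), (case x of (p, a') \<Rightarrow> p(Suc k := a')) (Suc k)) = x"
      using xp by (auto simp: fun_eq_iff)
    show "(case x of (p, a') \<Rightarrow> p(Suc k := a')) \<in> state_paths (Suc k) a"
      using p xp by (auto simp: state_paths_def less_Suc_eq)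
    show "(\<Prod>i<Suc k. merge_weight q (up i) ((case x of (p, a') \<Rightarrow> p(Suc k := a')) i)) * g ((case x of (p, a') \<Rightarrow> p(Suc k := a')) (Suc k))
      = (case x of (p, a') \<Rightarrow> (\<Prod>i<Suc k. merge_weight q (up i) (p i)) * g a')"
      using xp by simp
  next
    fix p assume p: "p \<in> state_paths (Suc k) a"
    show "(case (p(Suc k := []), p (Suc k)) of (p, a') \<Rightarrow> p(Suc k := a')) = p" by simp
    show "(p(Suc k := []), p (Suc k)) \<in> (SIGMA p:state_paths k a. ?S p)"
      using p by (auto simp: state_paths_def)
  qed
  finally show ?case .
qed

text \<open>Splitting the indicator of xs along \<open>home\<close> leaves the indicator of
  \<open>map home xs\<close>, which forces the paths to close up.\<close>

theorem cycle_op_diagonal: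
  assumes q: "q \<noteq> (0::'f::field)" and xs: "xs \<in> label_perms"
  shows "cycle_op q (\<lambda>ys. of_bool (ys = xs)) xs = (\<Sum>L\<in>SLD w c. q powi web_inv w c L (label_rank xs))"
proof -
  let ?\<delta> = "\<lambda>ys. of_bool (ys = xs) :: 'f" and ?a = "map home xs"
  have split: "split_op label_perms home ?\<delta> a = of_bool (a = ?a)" for a
  proof -
    have "split_op label_perms home ?\<delta> a = (\<Sum>ys | ys \<in> label_perms \<and> map home ys = a. if ys = xs then 1 else 0)"
      by (simp add: split_op_def of_bool_def)
    also have "\<dots> = (if xs \<in> {ys. ys \<in> label_perms \<and> map home ys = a} then 1 else 0)"
      by (rule sum.delta) (simp add: finite_label_perms)
    finally show ?thesis using xs by auto
  qed
  have "levels_op q m (split_op label_perms home ?\<delta>) ?a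
      = (\<Sum>p\<in>state_paths m ?a. (\<Prod>i<m. merge_weight q (up i) (p i)) * of_bool (p m = ?a))"
    unfolding levels_op_paths[OF home_state[OF xs]] split ..
  also have "\<dots> = (\<Sum>p\<in>closed_paths xs. \<Prod>i<m. merge_weight q (up i) (p i))"
    by (rule sum.mono_neutral_cong_right) (auto simp: finite_state_paths closed_paths_def)
  also have "\<dots> = (\<Sum>L\<in>SLD w c. \<Prod>i<m. merge_weight q (up i) (path_of xs L i))"
    by (rule sum.reindex_bij_betw[OF bij_betw_SLD_closed_paths[OF xs], symmetric])
  finally have "cycle_op q ?\<delta> xs = (\<Sum>L\<in>SLD w c. merge_weight q home xs * (\<Prod>i<m. merge_weight q (up i) (path_of xs L i)))"
    using xs label_perms_length[OF xs]
    by (simp add: cycle_op_def merge_op_def label_perms_def sum_distrib_left)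
  also have "\<dots> = (\<Sum>L\<in>SLD w c. q powi web_inv w c L (label_rank xs))"
    using SLD_weight[OF q _ xs] by simp
  finally show ?thesis .
qed

end

text \<open>The outcome of the topological part, free of layers and levels: the symmetry argument
  sees the web only through the diagonal of this kernel.\<close>

theorem web_hecke_kernel:
  assumes "annular_web w" "radial_cut w c"
  defines "n \<equiv> sum_list (cut_thickness w c)"
  shows "\<exists>k. hecke_kernel qvar n k \<and>
    (\<forall>xs. distinct xs \<and> set xs = labels w c \<longrightarrow> k xs xs = (\<Sum>L\<in>SLD w c. qvar powi web_inv w c L (label_rank xs)))"
proof -
  interpret annular_web w by fact
  obtain m Y Z where "layered_web w c m Y Z" using layers_exist[OF assms(2)] .
  then interpret layered_web w c m Y Z .
  let ?k = "\<lambda>xs ys. if length ys = n then cycle_op qvar (\<lambda>zs. of_bool (zs = ys)) xs else 0"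
  have "hecke_kernel qvar n ?k"
    by (intro hecke_kernelI qvar_nonzero cycle_op_linear)
       (auto simp: n_def hecke_op_cycle_op[OF qvar_nonzero], simp add: cycle_op_def merge_op_def)
  then show ?thesis
    using cycle_op_diagonal[OF qvar_nonzero] label_perms_length unfolding n_def
    by (intro exI[of _ ?k]) (auto simp: label_perms_def n_def)
qed

section \<open>Quasisymmetric expansions\<close>

text \<open>For sorted \<open>ps\<close>, the condition under which the monomial with indices
  \<open>ps\<close> occurs in the fundamental quasisymmetric function attached to xs: indices may
  only stay equal where the key rises.\<close>

definition compatible :: "nat list \<Rightarrow> ('a \<Rightarrow> nat) \<Rightarrow> 'a list \<Rightarrow> bool" where
  "compatible ps key xs \<longleftrightarrow> successively (\<lambda>(p, x) (p', x'). p < p' \<or> key x < key x') (zip ps xs)"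

lemma compatible_nth:
  "length ps = length xs \<Longrightarrow> compatible ps key xs \<longleftrightarrow>
     (\<forall>i. Suc i < length xs \<longrightarrow> ps ! i < ps ! Suc i \<or> key (xs ! i) < key (xs ! Suc i))"
  by (auto simp: compatible_def successively_conv_nth)

lemma compatible_lex:
  assumes "length ps = length xs" "sorted ps" "compatible ps key xs" "i < j" "j < length xs"
  shows "ps ! i < ps ! j \<or> ps ! i = ps ! j \<and> key (xs ! i) < key (xs ! j)"
  using assms(4,5)
proof (induction j)
  case (Suc j)
  have "ps ! j < ps ! Suc j \<or> key (xs ! j) < key (xs ! Suc j)"
    using assms(1,3) Suc.prems by (simp add: compatible_nth)
  moreover have "ps ! j \<le> ps ! Suc j" using assms(1,2) Suc.prems by (intro sorted_nth_mono) auto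
  ultimately show ?case using Suc by (cases "i = j") auto
qed simp

definition fill :: "nat list \<Rightarrow> 'a list \<Rightarrow> 'a \<Rightarrow> nat" where
  "fill ps xs = (\<lambda>d\<in>set xs. ps ! label_rank xs d)"

lemma fill_nth: "distinct xs \<Longrightarrow> i < length xs \<Longrightarrow> fill ps xs (xs ! i) = ps ! i"
  by (simp add: fill_def label_rank_nth)

lemma map_fill: "distinct xs \<Longrightarrow> length ps = length xs \<Longrightarrow> map (fill ps xs) xs = ps"
  by (rule nth_equalityI) (auto simp: fill_nth)

text \<open>Standardisation: ties between equal values are broken by the key.\<close>

lemma bij_betw_fill:
  fixes key :: "'a \<Rightarrow> nat"
  assumes D: "finite D" and M: "size M = card D"
  shows "bij_betw (fill (sorted_list_of_multiset M))
    {xs. distinct xs \<and> set xs = D \<and> compatible (sorted_list_of_multiset M) key xs}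
    {\<sigma> \<in> D \<rightarrow>\<^sub>E UNIV. image_mset \<sigma> (mset_set D) = M \<and> (\<forall>d\<in>D. \<forall>e\<in>D. d \<noteq> e \<and> \<sigma> d = \<sigma> e \<longrightarrow> key d \<noteq> key e)}"
    (is "bij_betw _ ?X ?S")
proof -
  define ps where "ps = sorted_list_of_multiset M"
  have ps: "sorted ps" "mset ps = M" "length ps = card D"
    using M by (auto simp: ps_def simp flip: size_mset)
  \<comment> \<open>W exceeds every key, so \<open>code\<close> below is a numeral in base W that
    compares values first and keys second.\<close>
  define W where "W = Suc (\<Sum>d\<in>D. key d)"
  have W: "key d < W" if "d \<in> D" for d
    using member_le_sum[of d D key] that D by (simp add: W_def)
  define code where "code \<sigma> d = \<sigma> d * W + key d" for \<sigma> d
  have code_less: "code \<sigma> d < code \<sigma> e \<longleftrightarrow> \<sigma> d < \<sigma> e \<or> \<sigma> d = \<sigma> e \<and> key d < key e"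
    if "d \<in> D" "e \<in> D" for \<sigma> d e
  proof -
    have *: "\<sigma> d * W + key d < \<sigma> e * W + key e" if "\<sigma> d < \<sigma> e" "d \<in> D" for d e
    proof -
      have "Suc (\<sigma> d) * W \<le> \<sigma> e * W" using that by (intro mult_right_mono) auto
      then show ?thesis using W[OF that(2)] by simp
    qed
    show ?thesis using *[of d e] *[of e d] that
      by (cases "\<sigma> d" "\<sigma> e" rule: linorder_cases) (auto simp: code_def)
  qed
  have lenX: "length xs = card D" if "distinct xs" "set xs = D" for xs
    using that distinct_card by metis
  have sorted_code: "sorted_wrt (<) (map (code (fill ps xs)) xs)" if xs: "xs \<in> ?X" for xs
  proof -
    have x: "distinct xs" "set xs = D" "compatible ps key xs" "length ps = length xs"
      using xs ps lenX by (auto simp: ps_def)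
    show ?thesis unfolding sorted_wrt_iff_nth_less
    proof (intro allI impI)
      fix i j assume ij: "i < j" "j < length (map (code (fill ps xs)) xs)"
      then have "xs ! i \<in> D" "xs ! j \<in> D" using x nth_mem[of i xs] nth_mem[of j xs] by auto
      then show "map (code (fill ps xs)) xs ! i < map (code (fill ps xs)) xs ! j"
        using ij compatible_lex[OF x(4) ps(1) x(3), of i j] x by (simp add: code_less fill_nth)
    qed
  qed
  have "inj_on (fill ps) ?X"
  proof (rule inj_onI)
    fix xs ys assume xy: "xs \<in> ?X" "ys \<in> ?X" "fill ps xs = fill ps ys"
    let ?c = "code (fill ps xs)"
    have "map ?c xs = map ?c ys"
      using sorted_code[OF xy(1)] sorted_code[OF xy(2)] xy by (intro strict_sorted_equal) auto
    moreover have "inj_on ?c (set xs \<union> set ys)"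
      using sorted_code[OF xy(1)] xy by (auto simp: strict_sorted_iff distinct_map)
    ultimately show "xs = ys" using inj_on_map_eq_map by blast
  qed
  moreover have "fill ps ` ?X = ?S"
  proof (intro set_eqI iffI)
    fix \<sigma> assume "\<sigma> \<in> fill ps ` ?X"
    then obtain xs where xs: "xs \<in> ?X" "\<sigma> = fill ps xs" by blast
    have x: "distinct xs" "set xs = D" "length xs = card D" using xs lenX by auto
    have "\<sigma> \<in> D \<rightarrow>\<^sub>E UNIV" using x xs by (auto simp: fill_def)
    moreover have "image_mset \<sigma> (mset_set D) = M"
      using map_fill[of xs ps] x ps xs by (metis mset_map mset_set_set)
    moreover have "key d \<noteq> key e" if "d \<in> D" "e \<in> D" "d \<noteq> e" "\<sigma> d = \<sigma> e" for d e
    proof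
      assume "key d = key e"
      then have "code \<sigma> d = code \<sigma> e" using that by (simp add: code_def)
      moreover have "inj_on (code \<sigma>) D"
        using sorted_code[OF xs(1)] xs x by (auto simp: strict_sorted_iff distinct_map)
      ultimately show False using that by (auto dest: inj_onD)
    qed
    ultimately show "\<sigma> \<in> ?S" by blast
  next
    fix \<sigma> assume s: "\<sigma> \<in> ?S"
    let ?c = "code \<sigma>"
    have inj: "inj_on ?c D"
    proof (rule inj_onI, rule ccontr)
      fix d e assume de: "d \<in> D" "e \<in> D" "?c d = ?c e" "d \<noteq> e"
      then have "\<sigma> d = \<sigma> e" using code_less[of d e \<sigma>] code_less[of e d \<sigma>]
        by (metis linorder_neqE_nat order_less_irrefl)
      then show False using de s by (auto simp: code_def)
    qed
    define xs where "xs = map (inv_into D ?c) (sorted_list_of_set (?c ` D))"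
    have cx: "map ?c xs = sorted_list_of_set (?c ` D)"
      unfolding xs_def map_map by (rule map_idI) (auto simp: D f_inv_into_f)
    have x: "distinct xs" "set xs = D"
    proof -
      show "distinct xs" using cx by (metis distinct_map distinct_sorted_list_of_set)
      show "set xs = D" by (simp add: xs_def D inj image_image[symmetric] inv_into_image_cancel)
    qed
    have strict: "?c (xs ! i) < ?c (xs ! j)" if "i < j" "j < length xs" for i j
    proof -
      have "sorted_wrt (<) (map ?c xs)" unfolding cx by simp
      then show ?thesis using that by (simp add: sorted_wrt_iff_nth_less)
    qed
    have xD: "xs ! i \<in> D" if "i < length xs" for i using that x(2) by auto
    have lex: "\<sigma> (xs ! i) < \<sigma> (xs ! j) \<or> \<sigma> (xs ! i) = \<sigma> (xs ! j) \<and> key (xs ! i) < key (xs ! j)"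
      if "i < j" "j < length xs" for i j
      using strict[OF that] that code_less xD by auto
    have "sorted (map \<sigma> xs)"
      unfolding sorted_wrt_iff_nth_less using lex by fastforce
    moreover have "mset (map \<sigma> xs) = M"
      using s x by (metis (mono_tags, lifting) mem_Collect_eq mset_map mset_set_set)
    ultimately have pm: "ps = map \<sigma> xs"
      by (metis ps_def sorted_list_of_multiset_mset sorted_sort_id)
    have "compatible ps key xs"
      using lex by (force simp: compatible_nth pm)
    moreover have "fill ps xs = \<sigma>"
    proof
      fix d
      show "fill ps xs d = \<sigma> d"
      proof (cases "d \<in> D")
        case True
        then obtain i where "i < length xs" "d = xs ! i" using x by (metis in_set_conv_nth)
        then show ?thesis using x by (simp add: fill_nth pm)
      next
        case False
        then show ?thesis using s x by (auto simp: fill_def PiE_def extensional_def)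
      qed
    qed
    ultimately show "\<sigma> \<in> fill ps ` ?X" using x unfolding ps_def by blast
  qed
  ultimately show ?thesis by (simp add: bij_betw_def ps_def)
qed

text \<open>
  The expansion of a quasisymmetric generating function, indexed by linear orders, in monomials.
\<close>

definition qsym :: "'a list set \<Rightarrow> ('a \<Rightarrow> nat) \<Rightarrow> ('a list \<Rightarrow> ratfun) \<Rightarrow> nat \<Rightarrow> series" where
  "qsym X key \<kappa> n M = (if size M = n \<and> 0 \<notin># M
     then \<Sum>xs | xs \<in> X \<and> compatible (sorted_list_of_multiset M) key xs. \<kappa> xs else 0)"

text \<open>
  Picks the coefficient of the hook Schur function: the signs come from the expansion of the hook,
  viewed as a ribbon, in complete symmetric functions.
\<close>

definition hook_content :: "nat \<Rightarrow> nat set \<Rightarrow> nat list" where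
  "hook_content n B = map (\<lambda>i. Suc (card {b \<in> B. b \<le> i})) [0..<n]"

definition hook_functional :: "nat \<Rightarrow> nat \<Rightarrow> series \<Rightarrow> ratfun" where
  "hook_functional n k f = (\<Sum>B\<in>Pow {k..<n}. (- 1) ^ card ({k..<n} - B) * f (mset (hook_content n B)))"

text \<open>With the key n - u used for labels, the labels fall up to place k - 1 and rise from
  there, whence the name.\<close>

definition valley :: "nat \<Rightarrow> ('a \<Rightarrow> nat) \<Rightarrow> 'a list \<Rightarrow> bool" where
  "valley k key xs \<longleftrightarrow> (\<forall>i. Suc i < length xs \<longrightarrow> (key (xs ! i) < key (xs ! Suc i) \<longleftrightarrow> Suc i < k))"

lemma hook_content_step:
  assumes "finite B" "Suc i < n"
  shows "hook_content n B ! i < hook_content n B ! Suc i \<longleftrightarrow> Suc i \<in> B"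
    "hook_content n B ! i \<le> hook_content n B ! Suc i"
proof -
  have "{b \<in> B. b \<le> Suc i} = (if Suc i \<in> B then insert (Suc i) {b \<in> B. b \<le> i} else {b \<in> B. b \<le> i})"
    by (auto simp: le_Suc_eq)
  then show "hook_content n B ! i < hook_content n B ! Suc i \<longleftrightarrow> Suc i \<in> B"
    "hook_content n B ! i \<le> hook_content n B ! Suc i"
    using assms by (auto simp: hook_content_def)
qed

lemma sorted_hook_content: "finite B \<Longrightarrow> sorted (hook_content n B)"
  by (auto simp: sorted_iff_nth_mono hook_content_def intro!: card_mono)

lemma all_Suc_less_conv: "(\<forall>i. Suc i < n \<longrightarrow> P i (Suc i)) \<longleftrightarrow> (\<forall>j\<in>{1..<n}. P (j - 1) j)"
proof
  assume l: "\<forall>i. Suc i < n \<longrightarrow> P i (Suc i)"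
  show "\<forall>j\<in>{1..<n}. P (j - 1) j"
  proof
    fix j assume "j \<in> {1..<n}"
    then show "P (j - 1) j" using l by (cases j) auto
  qed
next
  assume r: "\<forall>j\<in>{1..<n}. P (j - 1) j"
  show "\<forall>i. Suc i < n \<longrightarrow> P i (Suc i)"
  proof (intro allI impI)
    fix i assume "Suc i < n"
    then show "P i (Suc i)" using r[rule_format, of "Suc i"] by simp
  qed
qed

lemma hook_functional_qsym:
  assumes X: "finite X" "\<And>xs. xs \<in> X \<Longrightarrow> length xs = n" and k: "1 \<le> k" "k \<le> n"
  shows "hook_functional n k (qsym X key \<kappa> n) = (\<Sum>xs | xs \<in> X \<and> valley k key xs. \<kappa> xs)"
proof -
  let ?S = "{k..<n}"
  \<comment> \<open>The places at which the key fails to rise. The content of B rises exactly at the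
    places in B, so compatibility means that \<open>A xs\<close> is contained in B.\<close>
  define A where "A xs = {j \<in> {1..<n}. \<not> key (xs ! (j - 1)) < key (xs ! j)}" for xs
  have f: "qsym X key \<kappa> n (mset (hook_content n B)) = (\<Sum>xs\<in>X. of_bool (A xs \<subseteq> B) * \<kappa> xs)" if B: "B \<subseteq> ?S" for B
  proof -
    have fin: "finite B" using B finite_subset by blast
    have "compatible (hook_content n B) key xs \<longleftrightarrow> A xs \<subseteq> B" if "xs \<in> X" for xs
    proof -
      have "compatible (hook_content n B) key xs \<longleftrightarrow>
          (\<forall>i. Suc i < n \<longrightarrow> Suc i \<in> B \<or> key (xs ! i) < key (xs ! Suc i))"
        using X(2)[OF that] hook_content_step(1)[OF fin, of _ n]
        by (subst compatible_nth) (auto simp: hook_content_def)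
      also have "\<dots> \<longleftrightarrow> (\<forall>j\<in>{1..<n}. j \<in> B \<or> key (xs ! (j - 1)) < key (xs ! j))"
        by (rule all_Suc_less_conv)
      finally show ?thesis by (auto simp: A_def)
    qed
    moreover have "sorted_list_of_multiset (mset (hook_content n B)) = hook_content n B"
      using sorted_hook_content[OF fin] by (simp add: sorted_sort_id)
    moreover have "size (mset (hook_content n B)) = n" "0 \<notin># mset (hook_content n B)"
      by (auto simp: hook_content_def)
    ultimately have "qsym X key \<kappa> n (mset (hook_content n B)) = (\<Sum>xs | xs \<in> X \<and> A xs \<subseteq> B. \<kappa> xs)"
      unfolding qsym_def by (auto intro!: sum.cong)
    then show ?thesis using X(1) by (simp add: sum.inter_filter[symmetric] of_bool_def if_distrib[of "\<lambda>a. a * _"] cong: if_cong)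
  qed
  \<comment> \<open>Inclusion-exclusion, obtained by expanding the product over x in S of 1 -
    [x not in A]; if A is not contained in S, every term vanishes.\<close>
  have alt: "(\<Sum>B\<in>Pow ?S. (- 1) ^ card (?S - B) * of_bool (A xs \<subseteq> B)) = (of_bool (A xs = ?S) :: ratfun)" for xs
  proof (cases "A xs \<subseteq> ?S")
    case True
    have "(\<Sum>B\<in>Pow ?S. (- 1) ^ card (?S - B) * of_bool (A xs \<subseteq> B))
        = (\<Sum>B\<in>Pow ?S. (- 1) ^ (card ?S - card B) * (\<Prod>x\<in>B. 1) * (\<Prod>x\<in>?S - B. of_bool (x \<notin> A xs) :: ratfun))"
    proof (rule sum.cong[OF HOL.refl])
      fix B assume B: "B \<in> Pow ?S"
      then have "card (?S - B) = card ?S - card B" by (intro card_Diff_subset) (auto intro: finite_subset)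
      moreover have "(\<Prod>x\<in>?S - B. of_bool (x \<notin> A xs) :: ratfun) = of_bool (\<forall>x\<in>?S - B. x \<notin> A xs)"
        by (auto simp: of_bool_def intro!: prod.neutral)
      moreover have "(\<forall>x\<in>?S - B. x \<notin> A xs) \<longleftrightarrow> A xs \<subseteq> B" using True by auto
      ultimately show "(- 1) ^ card (?S - B) * of_bool (A xs \<subseteq> B)
        = (- 1) ^ (card ?S - card B) * (\<Prod>x\<in>B. 1) * (\<Prod>x\<in>?S - B. of_bool (x \<notin> A xs) :: ratfun)" by simp
    qed
    also have "\<dots> = (\<Prod>x\<in>?S. 1 - of_bool (x \<notin> A xs))"
      by (rule prod_diff_conv_sum'[symmetric]) simp
    also have "\<dots> = of_bool (\<forall>x\<in>?S. x \<in> A xs)"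
      by (auto simp: of_bool_def intro!: prod.neutral)
    also have "(\<forall>x\<in>?S. x \<in> A xs) \<longleftrightarrow> A xs = ?S" using True by auto
    finally show ?thesis .
  next
    case False
    then show ?thesis by (auto intro!: sum.neutral)
  qed
  have val: "A xs = ?S \<longleftrightarrow> valley k key xs" if "xs \<in> X" for xs
  proof -
    have "A xs = ?S \<longleftrightarrow> (\<forall>j\<in>{1..<n}. key (xs ! (j - 1)) < key (xs ! j) \<longleftrightarrow> j < k)"
    proof -
      have "A xs = ?S \<longleftrightarrow> (\<forall>j. j \<in> {1..<n} \<longrightarrow> (j \<in> A xs \<longleftrightarrow> j \<in> ?S))"
      proof -
        have "A xs \<subseteq> {1..<n}" "?S \<subseteq> {1..<n}" using k by (auto simp: A_def)
        then show ?thesis by blast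
      qed
      also have "\<dots> \<longleftrightarrow> (\<forall>j\<in>{1..<n}. key (xs ! (j - 1)) < key (xs ! j) \<longleftrightarrow> j < k)"
        by (auto simp: A_def)
      finally show ?thesis .
    qed
    also have "\<dots> \<longleftrightarrow> valley k key xs"
      unfolding valley_def X(2)[OF that] by (rule all_Suc_less_conv[symmetric])
    finally show ?thesis .
  qed
  have "hook_functional n k (qsym X key \<kappa> n)
      = (\<Sum>B\<in>Pow ?S. (- 1) ^ card (?S - B) * (\<Sum>xs\<in>X. of_bool (A xs \<subseteq> B) * \<kappa> xs))"
    unfolding hook_functional_def by (intro sum.cong) (auto simp: f)
  also have "\<dots> = (\<Sum>xs\<in>X. (\<Sum>B\<in>Pow ?S. (- 1) ^ card (?S - B) * of_bool (A xs \<subseteq> B)) * \<kappa> xs)"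
    unfolding sum_distrib_left sum_distrib_right mult.assoc by (rule sum.swap)
  also have "\<dots> = (\<Sum>xs\<in>X. of_bool (valley k key xs) * \<kappa> xs)"
    unfolding alt by (intro sum.cong) (auto simp: val)
  also have "\<dots> = (\<Sum>xs | xs \<in> X \<and> valley k key xs. \<kappa> xs)"
    using X(1) by (simp add: sum.inter_filter[symmetric] of_bool_def if_distrib[of "\<lambda>a. a * _"] cong: if_cong)
  finally show ?thesis .
qed

section \<open>The web LLT function as a sum over orders of the labels\<close>

definition symmetric_series :: "series \<Rightarrow> bool" where
  "symmetric_series f \<longleftrightarrow>
     (\<forall>M. 0 \<in># M \<longrightarrow> f M = 0) \<and> (\<forall>M j. 1 \<le> j \<longrightarrow> f (image_mset (id(j := Suc j, Suc j := j)) M) = f M)"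

context layered_web
begin

lemma web_inv_cong:
  assumes L: "L \<in> SLD w c" and eq: "\<And>u v. u \<in> labels w c \<Longrightarrow> v \<in> labels w c \<Longrightarrow> eps \<sigma> u v = eps \<sigma>' u v"
  shows "web_inv w c L \<sigma> = web_inv w c L \<sigma>'"
proof -
  have "u \<in> labels w c" if "e \<in> loop w L u" for e u
    using that SLD_subset_labels[OF L, of e] by (auto simp: loop_def)
  then show ?thesis
    unfolding web_inv_eq[OF L] using block_subset_labels eq
    by (intro arg_cong2[where f = "(+)"] sum.cong HOL.refl) (auto simp: subset_iff)
qed

text \<open>On a tie \<open>eps\<close> counts (u, v) positively exactly when v < u, that is, as if
  the larger label came first. The key n - u breaks ties in the same direction, so the values and
  the ranks give the same signs.\<close>

lemma eps_fill:
  assumes xs: "distinct xs" "set xs = labels w c" and n: "n = card (labels w c)"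
    and ps: "length ps = n" "sorted ps" "compatible ps (\<lambda>u. n - u) xs"
    and u: "u \<in> labels w c" and v: "v \<in> labels w c"
  shows "eps (fill ps xs) u v = eps (label_rank xs) u v"
proof -
  have len: "length xs = n" using xs n distinct_card by metis
  have le: "u \<le> n" "v \<le> n" using u v n by (auto simp: labels_def)
  note ru = nth_label_rank[OF xs(1), of u, unfolded xs(2), OF u]
  note rv = nth_label_rank[OF xs(1), of v, unfolded xs(2), OF v]
  have f: "fill ps xs u = ps ! label_rank xs u" "fill ps xs v = ps ! label_rank xs v"
    using u v xs by (auto simp: fill_def)
  have lex: "ps ! i < ps ! j \<or> ps ! i = ps ! j \<and> n - xs ! i < n - xs ! j" if "i < j" "j < n" for i j
    using compatible_lex[of ps xs "\<lambda>u. n - u" i j] that ps len by auto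
  show ?thesis
  proof (cases "label_rank xs u" "label_rank xs v" rule: linorder_cases)
    case less
    have "label_rank xs v < n" using rv(1) len by simp
    from lex[OF less this] have "fill ps xs u < fill ps xs v \<or> fill ps xs v = fill ps xs u \<and> v < u"
      unfolding f ru(2) rv(2) by linarith
    then have "eps (fill ps xs) u v = 1" by (simp add: eps_def)
    then show ?thesis using less by (simp add: eps_def)
  next
    case equal
    then have "u = v" using ru(2) rv(2) by metis
    then show ?thesis by (simp add: eps_def)
  next
    case greater
    have "label_rank xs u < n" using ru(1) len by simp
    from lex[OF greater this] have "fill ps xs v < fill ps xs u \<or> fill ps xs v = fill ps xs u \<and> u < v"
      unfolding f ru(2) rv(2) by linarith
    then have "\<not> (fill ps xs u < fill ps xs v \<or> fill ps xs v = fill ps xs u \<and> v < u)" by auto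
    then have "eps (fill ps xs) u v = -1" unfolding eps_def by simp
    moreover have "eps (label_rank xs) u v = -1" using greater unfolding eps_def by simp
    ultimately show ?thesis by simp
  qed
qed

text \<open>\<open>web_inv\<close> sees \<sigma> only through its standardisation. The keys of
  different labels differ, so the tie condition in \<open>bij_betw_fill\<close> is automatic, and
  positivity of the values follows from the content.\<close>

theorem web_LLT_qsym:
  fixes n
  defines "n \<equiv> sum_list (cut_thickness w c)"
  shows "web_LLT w c = qsym {xs. distinct xs \<and> set xs = labels w c} (\<lambda>u. n - u)
    (\<lambda>xs. 1 / qfact_comp (cut_thickness w c) * (\<Sum>L\<in>SLD w c. qvar powi web_inv w c L (label_rank xs))) n"
proof
  fix M :: "nat multiset"
  let ?P = "{xs. distinct xs \<and> set xs = labels w c}"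
  let ?A = "{\<sigma> \<in> labels w c \<rightarrow>\<^sub>E {0<..}. image_mset \<sigma> (mset_set (labels w c)) = M}"
  have card: "card (labels w c) = n" by (simp add: labels_def n_def)
  show "web_LLT w c M = qsym ?P (\<lambda>u. n - u)
    (\<lambda>xs. 1 / qfact_comp (cut_thickness w c) * (\<Sum>L\<in>SLD w c. qvar powi web_inv w c L (label_rank xs))) n M"
  proof (cases "size M = n \<and> 0 \<notin># M")
    case False
    have empty: "?A = {}"
    proof (rule equals0I)
      fix \<sigma> assume s: "\<sigma> \<in> ?A"
      then have "size M = n" using card by (metis (mono_tags, lifting) mem_Collect_eq size_image_mset size_mset_set)
      moreover have "0 \<notin># M"
      proof
        assume "0 \<in># M"
        then have "0 \<in># image_mset \<sigma> (mset_set (labels w c))" using s by simp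
        then show False using s by (auto simp: PiE_def Pi_def)
      qed
      ultimately show False using False by simp
    qed
    show ?thesis unfolding web_LLT_def empty using False by (auto simp: qsym_def)
  next
    case True
    let ?ps = "sorted_list_of_multiset M"
    let ?X = "{xs. distinct xs \<and> set xs = labels w c \<and> compatible ?ps (\<lambda>u. n - u) xs}"
    have ps: "length ?ps = n" "sorted ?ps" using True by (auto simp flip: size_mset)
    have A: "?A = {\<sigma> \<in> labels w c \<rightarrow>\<^sub>E UNIV. image_mset \<sigma> (mset_set (labels w c)) = M \<and>
        (\<forall>d\<in>labels w c. \<forall>e\<in>labels w c. d \<noteq> e \<and> \<sigma> d = \<sigma> e \<longrightarrow> n - d \<noteq> n - e)}"
    proof (intro set_eqI iffI)
      fix \<sigma> assume "\<sigma> \<in> ?A"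
      then show "\<sigma> \<in> {\<sigma> \<in> labels w c \<rightarrow>\<^sub>E UNIV. image_mset \<sigma> (mset_set (labels w c)) = M \<and>
        (\<forall>d\<in>labels w c. \<forall>e\<in>labels w c. d \<noteq> e \<and> \<sigma> d = \<sigma> e \<longrightarrow> n - d \<noteq> n - e)}"
        using card by (auto simp: labels_def)
    next
      fix \<sigma> assume s: "\<sigma> \<in> {\<sigma> \<in> labels w c \<rightarrow>\<^sub>E UNIV. image_mset \<sigma> (mset_set (labels w c)) = M \<and>
        (\<forall>d\<in>labels w c. \<forall>e\<in>labels w c. d \<noteq> e \<and> \<sigma> d = \<sigma> e \<longrightarrow> n - d \<noteq> n - e)}"
      have "\<sigma> d > 0" if "d \<in> labels w c" for d
      proof -
        have "image_mset \<sigma> (mset_set (labels w c)) = M" using s by simp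
        moreover have "\<sigma> d \<in># image_mset \<sigma> (mset_set (labels w c))" using that by simp
        ultimately have "\<sigma> d \<in># M" by (simp only:)
        then show ?thesis using True by (cases "\<sigma> d") auto
      qed
      then show "\<sigma> \<in> ?A" using s by (auto simp: PiE_def)
    qed
    have bij: "bij_betw (fill ?ps) ?X ?A"
      unfolding A by (rule bij_betw_fill) (use True card in auto)
    have "web_LLT w c M = 1 / qfact_comp (cut_thickness w c) * (\<Sum>\<sigma>\<in>?A. \<Sum>L\<in>SLD w c. qvar powi web_inv w c L \<sigma>)"
      unfolding web_LLT_def by (subst sum.swap) simp
    also have "(\<Sum>\<sigma>\<in>?A. \<Sum>L\<in>SLD w c. qvar powi web_inv w c L \<sigma>)
        = (\<Sum>xs\<in>?X. \<Sum>L\<in>SLD w c. qvar powi web_inv w c L (fill ?ps xs))"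
      by (rule sum.reindex_bij_betw[OF bij, symmetric])
    also have "\<dots> = (\<Sum>xs\<in>?X. \<Sum>L\<in>SLD w c. qvar powi web_inv w c L (label_rank xs))"
      using ps card by (intro sum.cong HOL.refl arg_cong2[where f = power_int] web_inv_cong eps_fill[of _ n]) auto
    finally show ?thesis using True by (simp add: qsym_def sum_distrib_left conj_assoc)
  qed
qed

end

section \<open>Symmetry of the web LLT function\<close>

lemma unshuffle_members:
  fixes as bs ys :: "'a::linorder list"
  assumes "sorted_wrt (>) as" "sorted_wrt (>) bs" "sorted_wrt (>) ys" "set ys = set as \<union> set bs" "set as \<inter> set bs = {}"
  shows "select (map (\<lambda>v. v \<in> set as) ys) ys = as" "select (map (\<lambda>v. v \<notin> set as) ys) ys = bs"
proof -
  have sel: "select (map P ys) ys = filter P ys" for P :: "'a \<Rightarrow> bool" by (induction ys) auto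
  have strict: "sorted_wrt (<) (rev zs) \<longleftrightarrow> sorted_wrt (>) zs" for zs :: "'a list"
    by (simp add: sorted_wrt_rev)
  have eq: "xs = zs" if "sorted_wrt (>) xs" "sorted_wrt (>) zs" "set xs = set zs" for xs zs :: "'a list"
    using strict_sorted_equal[of "rev xs" "rev zs"] that by (simp add: strict)
  show "select (map (\<lambda>v. v \<in> set as) ys) ys = as" "select (map (\<lambda>v. v \<notin> set as) ys) ys = bs"
    unfolding sel using assms by (auto intro!: eq sorted_wrt_filter)
qed

lemma sorted_wrt_select: "length \<beta> = length ys \<Longrightarrow> sorted_wrt P ys \<Longrightarrow> sorted_wrt P (select \<beta> ys)"
  by (induction \<beta> ys rule: list_induct2) (use set_select in fastforce)+

lemma set_select_Un: "length \<beta> = length ys \<Longrightarrow> set (select \<beta> ys) \<union> set (select (map Not \<beta>) ys) = set ys"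
  by (induction \<beta> ys rule: list_induct2) auto

lemma map_member_select:
  "length \<beta> = length ys \<Longrightarrow> distinct ys \<Longrightarrow> map (\<lambda>v. v \<in> set (select \<beta> ys)) ys = \<beta>"
proof (induction \<beta> ys rule: list_induct2)
  case (Cons b \<beta> y ys)
  have "map (\<lambda>v. v \<in> set (select (b # \<beta>) (y # ys))) ys = map (\<lambda>v. v \<in> set (select \<beta> ys)) ys"
    using Cons.prems by (intro map_cong) auto
  moreover have "y \<in> set (select (b # \<beta>) (y # ys)) \<longleftrightarrow> b"
    using Cons.prems set_select[of \<beta> ys] by auto
  ultimately show ?case using Cons by (simp only: list.map) simp
qed simp

lemma rev_sort_eq:
  fixes xs ys :: "'a::linorder list"
  assumes "sorted_wrt (>) ys" "set xs = set ys" "distinct xs"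
  shows "rev (sort xs) = ys"
proof -
  have "sort xs = rev ys"
    using assms by (intro strict_sorted_equal) (auto simp: sorted_wrt_rev strict_sorted_iff)
  then show ?thesis by simp
qed

lemma sorted_wrt_rev_sort:
  fixes xs :: "'a::linorder list"
  shows "distinct xs \<Longrightarrow> sorted_wrt (>) (rev (sort xs))"
  by (simp add: sorted_wrt_rev strict_sorted_iff flip: sorted_wrt_rev[of "(>)"])

text \<open>An order whose window of a + b places consists of two descending runs arises from a
  unique order with a descending window and a unique unshuffling of it. The claim then holds for
  each such order separately. \<open>P\<close> and \<open>Q\<close> are arbitrary conditions on the
  places outside the window, which the unshuffling leaves alone.\<close>

lemma hecke_kernel_sum_sym:
  fixes k :: "'a::linorder list \<Rightarrow> 'a list \<Rightarrow> 'f::field" and D :: "'a set"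
  defines "mid r N xs \<equiv> take N (drop r xs)"
  defines "T r a b P Q \<equiv> {xs. distinct xs \<and> set xs = D \<and> P (take r xs) \<and> Q (drop (r + (a + b)) xs) \<and>
    sorted_wrt (>) (take a (mid r (a + b) xs)) \<and> sorted_wrt (>) (drop a (mid r (a + b) xs))}"
  assumes q: "q \<noteq> 0" and k: "hecke_kernel q (card D) k" and r: "r + (a + b) \<le> card D"
  shows "(\<Sum>xs\<in>T r a b P Q. k xs xs) = (\<Sum>xs\<in>T r b a P Q. k xs xs)"
proof -
  let ?N = "a + b" and ?n = "card D"
  let ?U = "\<lambda>y \<beta>. take r y @ unshuffle \<beta> (mid r ?N y) @ drop (r + ?N) y"
  define Y where "Y = {ys. distinct ys \<and> set ys = D \<and> P (take r ys) \<and> Q (drop (r + ?N) ys) \<and> sorted_wrt (>) (mid r ?N ys)}"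
  have fin: "finite D" if "?N \<noteq> 0" using that r by (metis add_is_0 card.infinite le_zero_eq)
  have len: "length xs = ?n" if "distinct xs" "set xs = D" for xs using that distinct_card by metis
  have decomp: "xs = take r xs @ mid r ?N xs @ drop (r + ?N) xs" for xs
    unfolding mid_def by (metis append_take_drop_id add.commute drop_drop)
  have lens: "length (take r xs) = r" "length (mid r ?N xs) = ?N" if "length xs = ?n" for xs
    using that r by (auto simp: mid_def)
  have parts: "take r (p @ m @ s) = p" "mid r ?N (p @ m @ s) = m" "drop (r + ?N) (p @ m @ s) = s"
    if "length p = r" "length m = ?N" for p m s
    using that by (auto simp: mid_def)
  have key: "(\<Sum>xs\<in>T r a' b' P Q. k xs xs) = (\<Sum>y\<in>Y. \<Sum>\<beta>\<in>bool_words a' b'. k (?U y \<beta>) (?U y \<beta>))"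
    if ab: "a' + b' = ?N" for a' b'
  proof -
    have Tab: "T r a' b' P Q = {xs. distinct xs \<and> set xs = D \<and> P (take r xs) \<and> Q (drop (r + ?N) xs) \<and>
      sorted_wrt (>) (take a' (mid r ?N xs)) \<and> sorted_wrt (>) (drop a' (mid r ?N xs))}"
      unfolding T_def ab ..
    have "(\<Sum>xs\<in>T r a' b' P Q. k xs xs) = (\<Sum>(y, \<beta>)\<in>Y \<times> bool_words a' b'. k (?U y \<beta>) (?U y \<beta>))"
    proof (rule sum.reindex_bij_witness[of _ "\<lambda>(y, \<beta>). ?U y \<beta>"
          "\<lambda>xs. (take r xs @ rev (sort (mid r ?N xs)) @ drop (r + ?N) xs,
                 map (\<lambda>v. v \<in> set (take a' (mid r ?N xs))) (rev (sort (mid r ?N xs))))"])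
      fix xs assume xs: "xs \<in> T r a' b' P Q"
      define p m s where "p = take r xs" and "m = mid r ?N xs" and "s = drop (r + ?N) xs"
      have x: "distinct xs" "set xs = D" "P p" "Q s" "sorted_wrt (>) (take a' m)" "sorted_wrt (>) (drop a' m)"
        using xs by (auto simp: Tab p_def m_def s_def)
      have xd: "xs = p @ m @ s" using decomp by (simp add: p_def m_def s_def)
      have l: "length p = r" "length m = ?N" using lens[OF len[OF x(1,2)]] by (auto simp: p_def m_def)
      have dm: "distinct m" using x(1) xd by simp
      have am: "set (take a' m) \<inter> set (drop a' m) = {}" "set m = set (take a' m) \<union> set (drop a' m)"
        using dm by (metis append_take_drop_id distinct_append, metis append_take_drop_id set_append)
      let ?y = "rev (sort m)"
      have sy: "sorted_wrt (>) ?y" "set ?y = set (take a' m) \<union> set (drop a' m)"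
        using sorted_wrt_rev_sort[OF dm] am by auto
      have un: "select (map (\<lambda>v. v \<in> set (take a' m)) ?y) ?y = take a' m"
        "select (map (\<lambda>v. v \<notin> set (take a' m)) ?y) ?y = drop a' m"
        using unshuffle_members[OF x(5,6) sy am(1)] by auto
      have l': "length ?y = ?N" using l by simp
      note pr = parts[OF l(1) l'(1), of s] and pm = parts[OF l(1) l(2), of s]
      show "(case (take r xs @ rev (sort (mid r ?N xs)) @ drop (r + ?N) xs,
              map (\<lambda>v. v \<in> set (take a' (mid r ?N xs))) (rev (sort (mid r ?N xs)))) of (y, \<beta>) \<Rightarrow> ?U y \<beta>) = xs"
        unfolding xd pm prod.case pr using un by (simp add: unshuffle_def comp_def)
      have "trues (map (\<lambda>v. v \<in> set (take a' m)) ?y) = length (take a' m)"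
        using length_select[of "map (\<lambda>v. v \<in> set (take a' m)) ?y" ?y] un(1) by simp
      then have "map (\<lambda>v. v \<in> set (take a' m)) ?y \<in> bool_words a' b'"
        using l ab by (simp add: bool_words_def)
      moreover have "p @ ?y @ s \<in> Y"
        using x sy pr am xd by (auto simp: Y_def)
      ultimately show "(take r xs @ rev (sort (mid r ?N xs)) @ drop (r + ?N) xs,
              map (\<lambda>v. v \<in> set (take a' (mid r ?N xs))) (rev (sort (mid r ?N xs)))) \<in> Y \<times> bool_words a' b'"
        by (simp add: p_def m_def s_def)
      show "(case (take r xs @ rev (sort (mid r ?N xs)) @ drop (r + ?N) xs,
              map (\<lambda>v. v \<in> set (take a' (mid r ?N xs))) (rev (sort (mid r ?N xs)))) of
              (y, \<beta>) \<Rightarrow> k (?U y \<beta>) (?U y \<beta>)) = k xs xs"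
        unfolding xd pm prod.case pr using un by (simp add: unshuffle_def comp_def)
    next
      fix z assume "z \<in> Y \<times> bool_words a' b'"
      then obtain y \<beta> where z: "z = (y, \<beta>)" "y \<in> Y" "\<beta> \<in> bool_words a' b'" by blast
      define p m s where "p = take r y" and "m = mid r ?N y" and "s = drop (r + ?N) y"
      have y: "distinct y" "set y = D" "P p" "Q s" "sorted_wrt (>) m"
        using z(2) by (auto simp: Y_def p_def m_def s_def)
      have yd: "y = p @ m @ s" using decomp by (simp add: p_def m_def s_def)
      have l: "length p = r" "length m = ?N" using lens[OF len[OF y(1,2)]] by (auto simp: p_def m_def)
      have dm: "distinct m" using y(1) yd by simp
      have lb: "length \<beta> = length m" "trues \<beta> = a'" using z(3) ab l by (auto simp: bool_words_def)
      let ?m = "unshuffle \<beta> m"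
      have sm: "set ?m = set m" using set_select_Un[OF lb(1)] by (simp add: unshuffle_def)
      have lm: "length ?m = ?N" using length_unshuffle[OF lb(1)] l by simp
      have dm': "distinct ?m" using sm lm l dm by (metis card_distinct distinct_card)
      have tk: "take a' ?m = select \<beta> m" "drop a' ?m = select (map Not \<beta>) m"
        using length_select[OF lb(1)] lb(2) by (auto simp: unshuffle_def)
      note pm = parts[OF l(1) l(2), of s] and pr = parts[OF l(1) lm, of s]
      have rs: "rev (sort ?m) = m" using rev_sort_eq[OF y(5) sm dm'] .
      show "(take r (case z of (y, \<beta>) \<Rightarrow> ?U y \<beta>) @ rev (sort (mid r ?N (case z of (y, \<beta>) \<Rightarrow> ?U y \<beta>))) @ drop (r + ?N) (case z of (y, \<beta>) \<Rightarrow> ?U y \<beta>),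
           map (\<lambda>v. v \<in> set (take a' (mid r ?N (case z of (y, \<beta>) \<Rightarrow> ?U y \<beta>)))) (rev (sort (mid r ?N (case z of (y, \<beta>) \<Rightarrow> ?U y \<beta>))))) = z"
        unfolding z(1) prod.case yd pm pr rs tk using map_member_select[OF lb(1) dm] by simp
      show "(case z of (y, \<beta>) \<Rightarrow> ?U y \<beta>) \<in> T r a' b' P Q"
        unfolding z(1) prod.case yd pm Tab mem_Collect_eq pr tk
        using y yd dm' sm sorted_wrt_select[OF lb(1) y(5)] sorted_wrt_select[of "map Not \<beta>" m] lb by auto
    qed
    also have "\<dots> = (\<Sum>y\<in>Y. \<Sum>\<beta>\<in>bool_words a' b'. k (?U y \<beta>) (?U y \<beta>))"
      by (rule sum.cartesian_product[symmetric])
    finally show ?thesis .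
  qed
  have "(\<Sum>\<beta>\<in>bool_words a b. k (?U y \<beta>) (?U y \<beta>)) = (\<Sum>\<beta>\<in>bool_words b a. k (?U y \<beta>) (?U y \<beta>))" if y: "y \<in> Y" for y
  proof (rule hecke_kernel_unshuffle_sym[OF q k])
    have "length y = ?n" using y len by (auto simp: Y_def)
    then show "length (mid r ?N y) = ?N" "length (take r y @ mid r ?N y @ drop (r + ?N) y) = ?n"
      using lens decomp[of y] by auto
    show "sorted_wrt (>) (mid r ?N y)" using y by (simp add: Y_def)
  qed
  then show ?thesis using key[of a b] key[of b a] by simp
qed

lemma compatible_append:
  assumes "length ps = length xs"
  shows "compatible (ps @ ps') key (xs @ xs') \<longleftrightarrow> compatible ps key xs \<and> compatible ps' key xs' \<and>
    (xs = [] \<or> xs' = [] \<or> ps' = [] \<or> last ps < hd ps' \<or> key (last xs) < key (hd xs'))"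
proof (cases "xs = [] \<or> xs' = [] \<or> ps' = []")
  case True
  then show ?thesis using assms by (auto simp: compatible_def)
next
  case False
  then have ne: "ps \<noteq> []" "xs \<noteq> []" using assms by auto
  have "last (zip ps xs) = (last ps, last xs)" using assms ne by (simp add: last_zip)
  moreover have "hd (zip ps' xs') = (hd ps', hd xs')" using False by (cases ps'; cases xs') auto
  ultimately show ?thesis
    using False ne assms by (auto simp: compatible_def successively_append_iff zip_eq_Nil_iff)
qed

lemma compatible_replicate:
  "compatible (replicate (length xs) j) key xs \<longleftrightarrow> sorted_wrt (\<lambda>x y. key x < key y) xs"
proof -
  have "compatible (replicate (length xs) j) key xs \<longleftrightarrow> successively (\<lambda>x y. key x < key y) xs"
    by (simp add: compatible_nth successively_conv_nth)
  also have "\<dots> \<longleftrightarrow> sorted_wrt (\<lambda>x y. key x < key y) xs"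
    by (rule successively_conv_sorted_wrt) (auto simp: transp_def)
  finally show ?thesis .
qed

text \<open>Exchanging j and j + 1 in the content exchanges the lengths of two adjacent constant
  blocks of the sorted list and changes nothing around them.\<close>

lemma sorted_content_decomp:
  fixes M :: "nat multiset"
  obtains pre suf a b where "sorted_list_of_multiset M = pre @ replicate a j @ replicate b (Suc j) @ suf"
    "sorted_list_of_multiset (image_mset (id(j := Suc j, Suc j := j)) M) = pre @ replicate b j @ replicate a (Suc j) @ suf"
    "\<forall>x\<in>set pre. x < j" "\<forall>x\<in>set suf. Suc j < x"
proof -
  define pre where "pre = sorted_list_of_multiset (filter_mset (\<lambda>x. x < j) M)"
  define suf where "suf = sorted_list_of_multiset (filter_mset (\<lambda>x. Suc j < x) M)"
  define a b where "a = count M j" and "b = count M (Suc j)"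
  have ps: "sorted pre" "sorted suf" "\<forall>x\<in>set pre. x < j" "\<forall>x\<in>set suf. Suc j < x"
    by (auto simp: pre_def suf_def)
  have srt: "sorted (pre @ replicate c j @ replicate d (Suc j) @ suf)" for c d
  proof -
    have "x \<le> y" if "x \<in> set pre" "y \<in> set suf" for x y
      using ps(3,4) that by fastforce
    then show ?thesis using ps by (auto simp: sorted_append)
  qed
  have M: "M = mset (pre @ replicate a j @ replicate b (Suc j) @ suf)"
  proof (rule multiset_eqI)
    fix x
    consider "x < j" | "x = j" | "x = Suc j" | "Suc j < x" by linarith
    then show "count M x = count (mset (pre @ replicate a j @ replicate b (Suc j) @ suf)) x"
      by cases (auto simp: pre_def suf_def a_def b_def)
  qed
  have "sorted_list_of_multiset M = pre @ replicate a j @ replicate b (Suc j) @ suf"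
    using srt[of a b] by (subst M) (simp only: sorted_list_of_multiset_mset sorted_sort_id)
  moreover have "image_mset (id(j := Suc j, Suc j := j)) M = mset (pre @ replicate b j @ replicate a (Suc j) @ suf)"
  proof -
    have "map (id(j := Suc j, Suc j := j)) pre = pre" "map (id(j := Suc j, Suc j := j)) suf = suf"
      using ps by (auto intro!: map_idI)
    then have "image_mset (id(j := Suc j, Suc j := j)) (mset pre) = mset pre"
      "image_mset (id(j := Suc j, Suc j := j)) (mset suf) = mset suf"
      by (simp_all flip: mset_map)
    then show ?thesis by (subst M) simp
  qed
  then have "sorted_list_of_multiset (image_mset (id(j := Suc j, Suc j := j)) M) = pre @ replicate b j @ replicate a (Suc j) @ suf"
    using srt[of b a] by (simp only: sorted_list_of_multiset_mset sorted_sort_id)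
  ultimately show ?thesis using that ps by blast
qed

lemma compatible_append_less:
  assumes "length ps = length xs" "length ps' = length xs'" "\<forall>p\<in>set ps. \<forall>p'\<in>set ps'. p < p'"
  shows "compatible (ps @ ps') key (xs @ xs') \<longleftrightarrow> compatible ps key xs \<and> compatible ps' key xs'"
proof -
  have "last ps < hd ps'" if "xs \<noteq> []" "ps' \<noteq> []" using assms that by (metis hd_in_set last_in_set length_0_conv)
  then show ?thesis by (auto simp: compatible_append[OF assms(1)])
qed

context layered_web
begin

lemma compatible_iff_sorted:
  fixes n
  assumes "set xs \<subseteq> labels w c" "n = card (labels w c)" "length xs = a"
  shows "compatible (replicate a j) (\<lambda>u. n - u) xs \<longleftrightarrow> sorted_wrt (>) xs"
proof -
  have "n - u < n - v \<longleftrightarrow> v < u" if "u \<in> set xs" "v \<in> set xs" for u v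
    using assms that by (auto simp: labels_def subset_iff)
  then have "sorted_wrt (\<lambda>u v. n - u < n - v) xs \<longleftrightarrow> sorted_wrt (>) xs"
    using sorted_wrt_mono_rel[of xs "\<lambda>u v. n - u < n - v" "(>)"] sorted_wrt_mono_rel[of xs "(>)" "\<lambda>u v. n - u < n - v"]
    by blast
  then show ?thesis using compatible_replicate[of xs j "\<lambda>u. n - u"] assms(3) by simp
qed

text \<open>Where the values rise nothing is asked of the labels; within a block of equal values the
  key n - u has to rise, so the labels have to fall.\<close>

lemma compatible_content_iff:
  fixes n
  assumes xs: "distinct xs" "set xs = labels w c" and n: "n = card (labels w c)"
    and len: "length pre = r" "r + (a + b) + length suf = n"
    and ps: "\<forall>x\<in>set pre. x < j" "\<forall>x\<in>set suf. Suc j < x"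
  shows "compatible (pre @ replicate a j @ replicate b (Suc j) @ suf) (\<lambda>u. n - u) xs \<longleftrightarrow>
    compatible pre (\<lambda>u. n - u) (take r xs) \<and> compatible suf (\<lambda>u. n - u) (drop (r + (a + b)) xs) \<and>
    sorted_wrt (>) (take a (take (a + b) (drop r xs))) \<and> sorted_wrt (>) (drop a (take (a + b) (drop r xs)))"
proof -
  define x1 x2 x3 x4 where "x1 = take r xs" and "x2 = take a (take (a + b) (drop r xs))"
    and "x3 = drop a (take (a + b) (drop r xs))" and "x4 = drop (r + (a + b)) xs"
  have l: "length xs = n" using xs n distinct_card by metis
  have xd: "xs = x1 @ x2 @ x3 @ x4"
    unfolding x1_def x2_def x3_def x4_def append_assoc[of "take a _", symmetric] append_take_drop_id
    by (metis add.commute append_take_drop_id drop_drop)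
  have ls: "length x1 = r" "length x2 = a" "length x3 = b" "length x4 = length suf"
    using l len by (auto simp: x1_def x2_def x3_def x4_def)
  have sub: "set x2 \<subseteq> labels w c" "set x3 \<subseteq> labels w c" using xs xd by auto
  have "compatible (pre @ replicate a j @ replicate b (Suc j) @ suf) (\<lambda>u. n - u) (x1 @ x2 @ x3 @ x4) \<longleftrightarrow>
     compatible pre (\<lambda>u. n - u) x1 \<and> compatible (replicate a j) (\<lambda>u. n - u) x2 \<and>
     compatible (replicate b (Suc j)) (\<lambda>u. n - u) x3 \<and> compatible suf (\<lambda>u. n - u) x4"
  proof -
    have "\<forall>p\<in>set pre. \<forall>p'\<in>set (replicate a j @ replicate b (Suc j) @ suf). p < p'"
      using ps by fastforce
    then have 1: "compatible (pre @ replicate a j @ replicate b (Suc j) @ suf) (\<lambda>u. n - u) (x1 @ x2 @ x3 @ x4) \<longleftrightarrow>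
        compatible pre (\<lambda>u. n - u) x1 \<and> compatible (replicate a j @ replicate b (Suc j) @ suf) (\<lambda>u. n - u) (x2 @ x3 @ x4)"
      using ls len(1) by (intro compatible_append_less) simp_all
    have "\<forall>p\<in>set (replicate a j). \<forall>p'\<in>set (replicate b (Suc j) @ suf). p < p'"
      using ps by fastforce
    then have 2: "compatible (replicate a j @ replicate b (Suc j) @ suf) (\<lambda>u. n - u) (x2 @ x3 @ x4) \<longleftrightarrow>
        compatible (replicate a j) (\<lambda>u. n - u) x2 \<and> compatible (replicate b (Suc j) @ suf) (\<lambda>u. n - u) (x3 @ x4)"
      using ls len(1) by (intro compatible_append_less) simp_all
    have "\<forall>p\<in>set (replicate b (Suc j)). \<forall>p'\<in>set suf. p < p'" using ps by fastforce
    then have 3: "compatible (replicate b (Suc j) @ suf) (\<lambda>u. n - u) (x3 @ x4) \<longleftrightarrow>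
        compatible (replicate b (Suc j)) (\<lambda>u. n - u) x3 \<and> compatible suf (\<lambda>u. n - u) x4"
      using ls len(1) by (intro compatible_append_less) simp_all
    show ?thesis unfolding 1 2 3 ..
  qed
  then have "compatible (pre @ replicate a j @ replicate b (Suc j) @ suf) (\<lambda>u. n - u) xs \<longleftrightarrow>
     compatible pre (\<lambda>u. n - u) x1 \<and> sorted_wrt (>) x2 \<and> sorted_wrt (>) x3 \<and> compatible suf (\<lambda>u. n - u) x4"
    unfolding xd[symmetric] compatible_iff_sorted[OF sub(1) n ls(2)] compatible_iff_sorted[OF sub(2) n ls(3)] .
  then show ?thesis unfolding x1_def x2_def x3_def x4_def by blast
qed

end

text \<open>The exponents of two neighbouring variables are the lengths of two adjacent descending
  runs, and \<open>hecke_kernel_sum_sym\<close> exchanges these lengths.\<close>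

theorem symmetric_web_LLT:
  assumes "annular_web w" "radial_cut w c"
  shows "symmetric_series (web_LLT w c)"
proof -
  interpret annular_web w by fact
  obtain m Y Z where "layered_web w c m Y Z" using layers_exist[OF assms(2)] .
  then interpret layered_web w c m Y Z .
  define n where "n = sum_list (cut_thickness w c)"
  let ?P = "{xs. distinct xs \<and> set xs = labels w c}" and ?key = "\<lambda>u. n - u"
  let ?C = "1 / qfact_comp (cut_thickness w c)"
  have card: "n = card (labels w c)" by (simp add: labels_def n_def)
  obtain k where k: "hecke_kernel qvar n k"
    "\<And>xs. xs \<in> ?P \<Longrightarrow> k xs xs = (\<Sum>L\<in>SLD w c. qvar powi web_inv w c L (label_rank xs))"
    using web_hecke_kernel[OF assms] by (auto simp: n_def)
  have F: "web_LLT w c M = (\<Sum>xs | xs \<in> ?P \<and> compatible (sorted_list_of_multiset M) ?key xs. ?C * k xs xs)"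
    if "size M = n" "0 \<notin># M" for M
    using that by (simp add: web_LLT_qsym qsym_def k(2) flip: n_def)
  have F0: "web_LLT w c M = 0" if "\<not> (size M = n \<and> 0 \<notin># M)" for M
    using that by (auto simp: web_LLT_qsym qsym_def simp flip: n_def)
  show ?thesis unfolding symmetric_series_def
  proof (intro conjI allI impI)
    show "web_LLT w c M = 0" if "0 \<in># M" for M using that F0 by simp
    fix M :: "nat multiset" and j :: nat assume j: "1 \<le> j"
    let ?M = "image_mset (id(j := Suc j, Suc j := j)) M"
    have M0: "0 \<in># ?M \<longleftrightarrow> 0 \<in># M"
    proof -
      have "(id(j := Suc j, Suc j := j)) x = 0 \<longleftrightarrow> x = 0" for x using j by simp
      then show ?thesis by (metis imageE image_eqI set_image_mset)
    qed
    show "web_LLT w c ?M = web_LLT w c M"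
    proof (cases "size M = n \<and> 0 \<notin># M")
      case False
      then have "\<not> (size ?M = n \<and> 0 \<notin># ?M)" unfolding M0 by simp
      then show ?thesis using F0[OF False] F0 by simp
    next
      case True
      obtain pre suf a b where d: "sorted_list_of_multiset M = pre @ replicate a j @ replicate b (Suc j) @ suf"
        "sorted_list_of_multiset ?M = pre @ replicate b j @ replicate a (Suc j) @ suf"
        "\<forall>x\<in>set pre. x < j" "\<forall>x\<in>set suf. Suc j < x"
        by (rule sorted_content_decomp)
      let ?r = "length pre"
      have "length (sorted_list_of_multiset M) = n" using True by (simp flip: size_mset)
      then have len: "?r + (a + b) + length suf = n" "?r + (b + a) + length suf = n" using d by auto
      define T where "T a b = {xs. distinct xs \<and> set xs = labels w c \<and> compatible pre ?key (take ?r xs) \<and>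
        compatible suf ?key (drop (?r + (a + b)) xs) \<and>
        sorted_wrt (>) (take a (take (a + b) (drop ?r xs))) \<and> sorted_wrt (>) (drop a (take (a + b) (drop ?r xs)))}" for a b
      have S: "{xs \<in> ?P. compatible (pre @ replicate a j @ replicate b (Suc j) @ suf) ?key xs} = T a b"
        if "?r + (a + b) + length suf = n" for a b
        using compatible_content_iff[OF _ _ card HOL.refl that d(3,4)] by (auto simp: T_def)
      have "(\<Sum>xs\<in>T a b. k xs xs) = (\<Sum>xs\<in>T b a. k xs xs)"
        unfolding T_def
        by (rule hecke_kernel_sum_sym[OF qvar_nonzero k(1)[unfolded card]]) (use len card in auto)
      moreover have "web_LLT w c M = ?C * (\<Sum>xs\<in>T a b. k xs xs)"
        unfolding F[OF conjunct1[OF True] conjunct2[OF True]] S[OF len(1), folded d(1)] by (rule sum_distrib_left[symmetric])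
      moreover have "web_LLT w c ?M = ?C * (\<Sum>xs\<in>T b a. k xs xs)"
      proof -
        have "size ?M = n" "0 \<notin># ?M" using True M0 by auto
        then show ?thesis unfolding F[OF \<open>size ?M = n\<close> \<open>0 \<notin># ?M\<close>] S[OF len(2), folded d(2)]
          by (intro sum_distrib_left[symmetric])
      qed
      ultimately show ?thesis by simp
    qed
  qed
qed

section \<open>Schur functions\<close>

definition part :: "nat list \<Rightarrow> nat \<Rightarrow> nat" where
  "part lam i = (if 1 \<le> i \<and> i \<le> length lam then lam ! (i - 1) else 0)"

lemma diagram_iff: "(i, j) \<in> diagram lam \<longleftrightarrow> 1 \<le> i \<and> 1 \<le> j \<and> j \<le> part lam i"
  by (auto simp: diagram_def part_def)

lemma finite_diagram [simp]: "finite (diagram lam)"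
proof (rule finite_subset)
  show "diagram lam \<subseteq> {..length lam} \<times> {..sum_list lam}"
    by (auto simp: diagram_def) (metis One_nat_def Suc_le_eq Suc_pred elem_le_sum_list le_trans not_less_eq_eq)
qed simp

lemma part_antimono:
  assumes "is_partition lam" "1 \<le> i" "i \<le> i'"
  shows "part lam i' \<le> part lam i"
proof (cases "i = i' \<or> i' > length lam")
  case True
  then show ?thesis by (auto simp: part_def)
next
  case False
  then have "lam ! (i' - 1) \<le> lam ! (i - 1)"
    using assms sorted_wrt_nth_less[of "(\<ge>)" lam "i - 1" "i' - 1"] by (auto simp: is_partition_def)
  then show ?thesis using False assms by (auto simp: part_def)
qed

text \<open>
  Gelfand-Tsetlin patterns: \<open>g i v\<close> is the number of entries at most \<open>v\<close> in row \<open>i\<close> of a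
  semistandard tableau of shape \<open>lam\<close> and content \<open>M\<close>.
\<close>

definition gt_patterns :: "nat list \<Rightarrow> nat multiset \<Rightarrow> (nat \<Rightarrow> nat \<Rightarrow> nat) set" where
  "gt_patterns lam M = {g. (\<forall>i v. i = 0 \<or> length lam < i \<longrightarrow> g i v = 0) \<and> (\<forall>i. g i 0 = 0) \<and>
     (\<forall>i v. g i v \<le> g i (Suc v)) \<and> (\<forall>i v. 1 \<le> i \<longrightarrow> g (Suc i) (Suc v) \<le> g i v) \<and>
     (\<exists>V. \<forall>v\<ge>V. \<forall>i. g i v = part lam i) \<and>
     (\<forall>v. (\<Sum>i=1..length lam. g i v) = size {#x \<in># M. x \<le> v#})}"

definition row_counts :: "nat list \<Rightarrow> (nat \<times> nat \<Rightarrow> nat) \<Rightarrow> nat \<Rightarrow> nat \<Rightarrow> nat" where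
  "row_counts lam T i v = card {j. (i, j) \<in> diagram lam \<and> T (i, j) \<le> v}"

definition tableau_of :: "nat list \<Rightarrow> (nat \<Rightarrow> nat \<Rightarrow> nat) \<Rightarrow> nat \<times> nat \<Rightarrow> nat" where
  "tableau_of lam g = (\<lambda>(i, j)\<in>diagram lam. LEAST v. j \<le> g i v)"

lemma finite_row [simp]: "finite {j. (i, j) \<in> diagram lam \<and> P j}"
  by (rule finite_subset[of _ "{..part lam i}"]) (auto simp: diagram_iff)

text \<open>Rows increase weakly, so the entries up to v fill an initial segment of the row. This
  Galois connection is what lets a tableau and its counts determine each other.\<close>

lemma row_counts_le_iff:
  assumes T: "T \<in> SSYT lam" and c: "(i, j) \<in> diagram lam"
  shows "T (i, j) \<le> v \<longleftrightarrow> j \<le> row_counts lam T i v"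
proof -
  let ?R = "{j. (i, j) \<in> diagram lam \<and> T (i, j) \<le> v}"
  have mono: "T (i, j) \<le> T (i, j')" if "(i, j) \<in> diagram lam" "(i, j') \<in> diagram lam" "j \<le> j'" for j j'
    using T that by (cases "j = j'") (auto simp: SSYT_def)
  have down: "{1..j'} \<subseteq> ?R" if "j' \<in> ?R" for j'
  proof
    fix l assume l: "l \<in> {1..j'}"
    then have "(i, l) \<in> diagram lam" using that by (auto simp: diagram_iff)
    moreover have "T (i, l) \<le> v" using mono[of l j'] l that calculation by auto
    ultimately show "l \<in> ?R" by simp
  qed
  show ?thesis
  proof
    assume "T (i, j) \<le> v"
    then have "{1..j} \<subseteq> ?R" using down[of j] c by simp
    then have "card {1..j} \<le> card ?R" by (intro card_mono) auto
    then show "j \<le> row_counts lam T i v" by (simp add: row_counts_def)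
  next
    assume l: "j \<le> row_counts lam T i v"
    show "T (i, j) \<le> v"
    proof (rule ccontr)
      assume n: "\<not> T (i, j) \<le> v"
      have "?R \<subseteq> {1..<j}"
      proof
        fix l assume l: "l \<in> ?R"
        then have "\<not> j \<le> l" using mono[of j l] c n by auto
        then show "l \<in> {1..<j}" using l by (auto simp: diagram_iff)
      qed
      then have "card ?R \<le> card {1..<j}" by (intro card_mono) auto
      then show False using l c by (auto simp: row_counts_def diagram_iff)
    qed
  qed
qed

lemma row_counts_beyond: "i = 0 \<or> length lam < i \<Longrightarrow> row_counts lam T i v = 0"
  by (auto simp: row_counts_def diagram_def)

lemma sum_row_counts:
  "(\<Sum>i=1..length lam. row_counts lam T i v) = size {#x \<in># image_mset T (mset_set (diagram lam)). x \<le> v#}"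
proof -
  let ?C = "{c \<in> diagram lam. T c \<le> v}"
  have "size {#x \<in># image_mset T (mset_set (diagram lam)). x \<le> v#} = card ?C"
    by (simp add: filter_mset_image_mset filter_mset_mset_set)
  also have "?C = (SIGMA i:{1..length lam}. {j. (i, j) \<in> diagram lam \<and> T (i, j) \<le> v})"
    by (auto simp: diagram_def)
  also have "card \<dots> = (\<Sum>i=1..length lam. row_counts lam T i v)"
    by (subst card_SigmaI) (auto simp: row_counts_def)
  finally show ?thesis ..
qed

lemma multiset_eq_cumulative:
  assumes "\<And>v::nat. size {#x \<in># M. x \<le> v#} = size {#x \<in># N. x \<le> v#}"
  shows "M = N"
proof (rule multiset_eqI)
  fix x
  have split: "size {#y \<in># A. y \<le> Suc v#} = size {#y \<in># A. y \<le> v#} + count A (Suc v)" for A :: "nat multiset" and v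
  proof -
    have "{#y \<in># A. y \<le> Suc v#} = {#y \<in># A. y \<le> v#} + replicate_mset (count A (Suc v)) (Suc v)"
      by (rule multiset_eqI) (auto simp: le_Suc_eq)
    then show ?thesis by simp
  qed
  have zero: "size {#y \<in># A. y \<le> 0#} = count A 0" for A :: "nat multiset"
  proof -
    have "{#y \<in># A. y \<le> 0#} = replicate_mset (count A 0) 0"
      by (rule multiset_eqI) auto
    then show ?thesis by simp
  qed
  show "count M x = count N x"
    using assms[of x] assms[of "x - 1"] split[where A = M and v = "x - 1"] split[where A = N and v = "x - 1"] zero
    by (cases x) auto
qed

text \<open>The interlacing inequality between rows i and i + 1, with its shift in v, expresses that
  columns increase strictly.\<close>

lemma row_counts_gt:
  assumes T: "T \<in> SSYT lam" and part: "is_partition lam"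
  shows "row_counts lam T \<in> gt_patterns lam (image_mset T (mset_set (diagram lam)))"
proof -
  have pos: "0 < T c" if "c \<in> diagram lam" for c using T that by (auto simp: SSYT_def)
  have "row_counts lam T i 0 = 0" for i using pos by (force simp: row_counts_def)
  moreover have "row_counts lam T i v \<le> row_counts lam T i (Suc v)" for i v
    unfolding row_counts_def by (intro card_mono) auto
  moreover have "row_counts lam T (Suc i) (Suc v) \<le> row_counts lam T i v" if i: "1 \<le> i" for i v
    unfolding row_counts_def
  proof (intro card_mono subsetI)
    fix j assume j: "j \<in> {j. (Suc i, j) \<in> diagram lam \<and> T (Suc i, j) \<le> Suc v}"
    then have c: "(i, j) \<in> diagram lam" using part_antimono[OF part i, of "Suc i"] i by (auto simp: diagram_iff)
    then have "T (i, j) < T (Suc i, j)" using T j by (auto simp: SSYT_def)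
    then show "j \<in> {j. (i, j) \<in> diagram lam \<and> T (i, j) \<le> v}" using j c by auto
  qed simp
  moreover have "\<exists>V. \<forall>v\<ge>V. \<forall>i. row_counts lam T i v = part lam i"
  proof (intro exI allI impI)
    fix v i assume v: "(\<Sum>c\<in>diagram lam. T c) \<le> v"
    have "T c \<le> v" if "c \<in> diagram lam" for c
      using member_le_sum[of c "diagram lam" T] that v by simp
    then have "{j. (i, j) \<in> diagram lam \<and> T (i, j) \<le> v} = {j. (i, j) \<in> diagram lam}" by blast
    also have "\<dots> = {1..part lam i}" by (cases "1 \<le> i") (auto simp: diagram_iff part_def)
    finally show "row_counts lam T i v = part lam i" by (simp add: row_counts_def)
  qed
  ultimately show ?thesis
    unfolding gt_patterns_def using row_counts_beyond sum_row_counts by simp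
qed

text \<open>The interval in which \<open>g i v\<close> can move when the neighbouring rows of the pattern are fixed.\<close>

definition gt_lower :: "(nat \<Rightarrow> nat \<Rightarrow> nat) \<Rightarrow> nat \<Rightarrow> nat \<Rightarrow> nat" where
  "gt_lower g v i = max (g i (v - 1)) (g (Suc i) (Suc v))"

definition gt_upper :: "(nat \<Rightarrow> nat \<Rightarrow> nat) \<Rightarrow> nat \<Rightarrow> nat \<Rightarrow> nat" where
  "gt_upper g v i = (if i = 1 then g i (Suc v) else min (g i (Suc v)) (g (i - 1) (v - 1)))"

text \<open>The Bender-Knuth involution in terms of patterns: \<open>g i v\<close> is reflected in
  its interval. In the tableau this exchanges, row by row, the numbers of those v and v + 1 that can
  be changed freely.\<close>

definition bender_knuth :: "(nat \<Rightarrow> nat \<Rightarrow> nat) \<Rightarrow> nat \<Rightarrow> nat \<Rightarrow> nat \<Rightarrow> nat" where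
  "bender_knuth g v i u = (if u = v \<and> 1 \<le> i then gt_lower g v i + gt_upper g v i - g i v else g i u)"

lemma SSYT_pos: "T \<in> SSYT lam \<Longrightarrow> d \<in> diagram lam \<Longrightarrow> 0 < T d"
  using PiE_mem[of T "diagram lam" "\<lambda>_. {0<..}" d] by (simp add: SSYT_def)

lemma SSYT_undefined: "T \<in> SSYT lam \<Longrightarrow> d \<notin> diagram lam \<Longrightarrow> T d = undefined"
  using PiE_arb[of T "diagram lam" "\<lambda>_. {0<..}" d] by (simp add: SSYT_def)

context
  fixes lam :: "nat list" and M :: "nat multiset" and g :: "nat \<Rightarrow> nat \<Rightarrow> nat"
  assumes lam: "is_partition lam" and g: "g \<in> gt_patterns lam M"
begin

lemma gt_props:
  shows "i = 0 \<or> length lam < i \<Longrightarrow> g i v = 0" "g i 0 = 0" "g i v \<le> g i (Suc v)"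
    "1 \<le> i \<Longrightarrow> g (Suc i) (Suc v) \<le> g i v" "\<exists>V. \<forall>v\<ge>V. \<forall>i. g i v = part lam i"
    "(\<Sum>i=1..length lam. g i v) = size {#x \<in># M. x \<le> v#}"
proof -
  note c = g[unfolded gt_patterns_def mem_Collect_eq]
  note c2 = c[THEN conjunct2] note c3 = c2[THEN conjunct2] note c4 = c3[THEN conjunct2] note c5 = c4[THEN conjunct2]
  show "i = 0 \<or> length lam < i \<Longrightarrow> g i v = 0" using c[THEN conjunct1] by iprover
  show "g i 0 = 0" using c2[THEN conjunct1] by iprover
  show "g i v \<le> g i (Suc v)" using c3[THEN conjunct1] by iprover
  show "1 \<le> i \<Longrightarrow> g (Suc i) (Suc v) \<le> g i v" using c4[THEN conjunct1] by iprover
  show "\<exists>V. \<forall>v\<ge>V. \<forall>i. g i v = part lam i" by (rule c5[THEN conjunct1])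
  show "(\<Sum>i=1..length lam. g i v) = size {#x \<in># M. x \<le> v#}" using c5[THEN conjunct2] by iprover
qed

lemma gt_mono: "v \<le> v' \<Longrightarrow> g i v \<le> g i v'"
  by (rule lift_Suc_mono_le[of "g i"]) (rule gt_props(3))

lemma gt_le_part: "g i v \<le> part lam i"
proof -
  obtain V where "\<forall>v\<ge>V. \<forall>i. g i v = part lam i" using gt_props(5) by blast
  then have "g i (max v V) = part lam i" by simp
  then show ?thesis using gt_mono[of v "max v V" i] by simp
qed

lemma tableau_of_le_iff:
  assumes "(i, j) \<in> diagram lam"
  shows "tableau_of lam g (i, j) \<le> v \<longleftrightarrow> j \<le> g i v"
proof -
  obtain V where "\<forall>v\<ge>V. \<forall>i. g i v = part lam i" using gt_props(5) by blast
  then have "j \<le> g i V" using assms by (simp add: diagram_iff)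
  then have "j \<le> g i (LEAST v. j \<le> g i v)" by (rule LeastI)
  then show ?thesis using assms gt_mono[of "LEAST v. j \<le> g i v" v i]
    by (auto simp: tableau_of_def intro: Least_le)
qed

lemma tableau_of_SSYT: "tableau_of lam g \<in> SSYT lam"
proof -
  have pos: "0 < tableau_of lam g (i, j)" if "(i, j) \<in> diagram lam" for i j
  proof (rule ccontr)
    assume "\<not> ?thesis"
    then have "j \<le> g i 0" using tableau_of_le_iff[OF that, of 0] by simp
    then show False using gt_props(2) that by (simp add: diagram_iff)
  qed
  have row: "tableau_of lam g (i, j) \<le> tableau_of lam g (i, j')"
    if "(i, j) \<in> diagram lam" "(i, j') \<in> diagram lam" "j < j'" for i j j'
    using tableau_of_le_iff[OF that(1)] tableau_of_le_iff[OF that(2), of "tableau_of lam g (i, j')"] that(3) by simp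
  have step: "tableau_of lam g (i, j) < tableau_of lam g (Suc i, j)"
    if c: "(i, j) \<in> diagram lam" "(Suc i, j) \<in> diagram lam" for i j
  proof -
    obtain v where v: "tableau_of lam g (Suc i, j) = Suc v" using pos[OF c(2)] by (cases "tableau_of lam g (Suc i, j)") auto
    then have "j \<le> g (Suc i) (Suc v)" using tableau_of_le_iff[OF c(2), of "Suc v"] by simp
    also have "\<dots> \<le> g i v" using c(1) by (intro gt_props(4)) (simp add: diagram_iff)
    finally show ?thesis using tableau_of_le_iff[OF c(1), of v] v by simp
  qed
  have col: "tableau_of lam g (i, j) < tableau_of lam g (i', j)"
    if "(i, j) \<in> diagram lam" "(i', j) \<in> diagram lam" "i < i'" for i i' j
  proof -
    have "(i + Suc d, j) \<in> diagram lam \<Longrightarrow> tableau_of lam g (i, j) < tableau_of lam g (i + Suc d, j)" for d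
    proof (induction d)
      case 0
      then show ?case using step[OF that(1)] by simp
    next
      case (Suc d)
      have "1 \<le> i" using that(1) by (simp add: diagram_iff)
      then have "(i + Suc d, j) \<in> diagram lam"
        using Suc.prems part_antimono[OF lam, of "i + Suc d" "i + Suc (Suc d)"] by (simp add: diagram_iff)
      then show ?case using Suc step[of "i + Suc d" j] by simp
    qed
    from this[of "i' - Suc i"] that show ?thesis by simp
  qed
  show ?thesis using pos row col by (auto simp: SSYT_def tableau_of_def)
qed

lemma row_counts_tableau_of: "row_counts lam (tableau_of lam g) = g"
proof (intro ext)
  fix i v
  show "row_counts lam (tableau_of lam g) i v = g i v"
  proof (cases "i = 0 \<or> length lam < i")
    case True
    then show ?thesis using gt_props(1) row_counts_beyond by simp
  next
    case False
    then have "{j. (i, j) \<in> diagram lam \<and> tableau_of lam g (i, j) \<le> v} = {1..g i v}"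
      using tableau_of_le_iff gt_le_part[of i v] by (auto simp: diagram_iff)
    then show ?thesis by (simp add: row_counts_def)
  qed
qed

lemma content_tableau_of: "image_mset (tableau_of lam g) (mset_set (diagram lam)) = M"
proof (rule multiset_eq_cumulative)
  fix v
  show "size {#x \<in># image_mset (tableau_of lam g) (mset_set (diagram lam)). x \<le> v#} = size {#x \<in># M. x \<le> v#}"
    unfolding sum_row_counts[symmetric] row_counts_tableau_of by (rule gt_props(6))
qed

lemma gt_bounds:
  assumes "1 \<le> v" "1 \<le> i"
  shows "gt_lower g v i \<le> g i v" "g i v \<le> gt_upper g v i"
  using assms gt_props(3)[of i "v - 1"] gt_props(3)[of i v] gt_props(4)[of i v] gt_props(4)[of "i - 1" "v - 1"]
  by (auto simp: gt_lower_def gt_upper_def)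

text \<open>The lower bound of a row and the upper bound of the next are the maximum and the minimum
  of the same two numbers, so together they contribute the sum of these numbers.\<close>

lemma sum_gt_bounds:
  "(\<Sum>i=1..L. gt_lower g v i + gt_upper g v i) + gt_upper g v (Suc L) = (\<Sum>i=1..L. g i (v - 1) + g i (Suc v)) + g (Suc L) (Suc v)"
proof (induction L)
  case (Suc L)
  have "gt_lower g v (Suc L) + gt_upper g v (Suc (Suc L)) = g (Suc L) (v - 1) + g (Suc (Suc L)) (Suc v)"
    by (auto simp: gt_lower_def gt_upper_def max_def min_def)
  then show ?case using Suc by simp
qed (simp add: gt_upper_def)

lemma bender_knuth_bounds:
  assumes "1 \<le> v" "1 \<le> i"
  shows "gt_lower g v i \<le> bender_knuth g v i v" "bender_knuth g v i v \<le> gt_upper g v i"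
    "bender_knuth g v i v + g i v = gt_lower g v i + gt_upper g v i"
  using gt_bounds[OF assms] assms by (auto simp: bender_knuth_def)

lemma gt_zero_row: "length lam < i \<Longrightarrow> gt_lower g v i = 0 \<and> gt_upper g v i = 0 \<or> i = 0"
  using gt_props(1) by (auto simp: gt_lower_def gt_upper_def)

lemma bender_knuth_gt:
  assumes v: "1 \<le> v"
  shows "bender_knuth g v \<in> gt_patterns lam (image_mset (id(v := Suc v, Suc v := v)) M)"
proof -
  let ?M = "image_mset (id(v := Suc v, Suc v := v)) M"
  have out: "bender_knuth g v i u = 0" if "i = 0 \<or> length lam < i" for i u
    using that gt_props(1) gt_zero_row[of i v] by (auto simp: bender_knuth_def)
  have zero: "bender_knuth g v i 0 = 0" for i using v gt_props(2) by (auto simp: bender_knuth_def)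
  have mono: "bender_knuth g v i u \<le> bender_knuth g v i (Suc u)" for i u
  proof (cases "1 \<le> i \<and> (u = v \<or> Suc u = v)")
    case True
    then show ?thesis
      using bender_knuth_bounds[OF v, of i]
      by (auto simp: gt_lower_def gt_upper_def split: if_splits) (auto simp: bender_knuth_def)
  next
    case False
    then show ?thesis using gt_props(3)[of i u] by (auto simp: bender_knuth_def)
  qed
  have inter: "bender_knuth g v (Suc i) (Suc u) \<le> bender_knuth g v i u" if i: "1 \<le> i" for i u
  proof -
    consider "u = v" | "Suc u = v" | "u \<noteq> v" "Suc u \<noteq> v" by blast
    then show ?thesis
    proof cases
      case 1
      then have "g (Suc i) (Suc v) \<le> bender_knuth g v i v"
        using bender_knuth_bounds(1)[OF v i] by (auto simp: gt_lower_def)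
      then show ?thesis using 1 by (simp add: bender_knuth_def)
    next
      case 2
      then have "bender_knuth g v (Suc i) v \<le> g i (v - 1)"
        using bender_knuth_bounds(2)[OF v, of "Suc i"] i by (auto simp: gt_upper_def)
      moreover have "bender_knuth g v i u = g i (v - 1)" using 2 by (auto simp: bender_knuth_def)
      ultimately show ?thesis using 2 by simp
    next
      case 3
      then show ?thesis using gt_props(4)[OF i, of u] by (simp add: bender_knuth_def)
    qed
  qed
  have ev: "\<exists>V. \<forall>u\<ge>V. \<forall>i. bender_knuth g v i u = part lam i"
  proof -
    obtain V where "\<forall>v\<ge>V. \<forall>i. g i v = part lam i" using gt_props(5) by blast
    then show ?thesis by (intro exI[of _ "max V (Suc v)"]) (auto simp: bender_knuth_def)
  qed
  have cum: "(\<Sum>i=1..length lam. bender_knuth g v i u) = size {#x \<in># ?M. x \<le> u#}" for u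
  proof (cases "u = v")
    case False
    have "{#x \<in># ?M. x \<le> u#} = image_mset (id(v := Suc v, Suc v := v)) {#x \<in># M. x \<le> u#}"
      unfolding filter_mset_image_mset using False by (intro arg_cong[where f = "image_mset _"] filter_mset_cong) (auto simp: le_Suc_eq)
    then have "size {#x \<in># ?M. x \<le> u#} = size {#x \<in># M. x \<le> u#}" by simp
    then show ?thesis using gt_props(6)[of u] False by (simp add: bender_knuth_def)
  next
    case True
    let ?L = "length lam"
    \<comment> \<open>With A(u) the number of elements of M that are at most u, the reflected values
      add up to A(v - 1) + A(v + 1) - A(v) = A(v - 1) + count M (v + 1), as the exchanged content
      demands.\<close>
    have "(\<Sum>i=1..?L. bender_knuth g v i v + g i v) = (\<Sum>i=1..?L. gt_lower g v i + gt_upper g v i)"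
      using bender_knuth_bounds(3)[OF v] by (intro sum.cong) auto
    also have "\<dots> = (\<Sum>i=1..?L. g i (v - 1) + g i (Suc v))"
      using sum_gt_bounds[of v ?L] gt_zero_row[of "Suc ?L" v] gt_props(1)[of "Suc ?L" "Suc v"] by simp
    finally have "(\<Sum>i=1..?L. bender_knuth g v i v) + size {#x \<in># M. x \<le> v#}
        = size {#x \<in># M. x \<le> v - 1#} + size {#x \<in># M. x \<le> Suc v#}"
      unfolding sum.distrib gt_props(6) .
    moreover have "size {#x \<in># M. x \<le> Suc v#} = size {#x \<in># M. x \<le> v#} + count M (Suc v)"
    proof -
      have "{#x \<in># M. x \<le> Suc v#} = {#x \<in># M. x \<le> v#} + replicate_mset (count M (Suc v)) (Suc v)"
        by (rule multiset_eqI) (auto simp: le_Suc_eq)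
      then show ?thesis by simp
    qed
    moreover have "size {#x \<in># ?M. x \<le> v#} = size {#x \<in># M. x \<le> v - 1#} + count M (Suc v)"
    proof -
      have "{#x \<in># ?M. x \<le> v#} = image_mset (id(v := Suc v, Suc v := v)) {#x \<in># M. x \<le> v - 1 \<or> x = Suc v#}"
        unfolding filter_mset_image_mset using v by (intro arg_cong[where f = "image_mset _"] filter_mset_cong) auto
      moreover have "{#x \<in># M. x \<le> v - 1 \<or> x = Suc v#} = {#x \<in># M. x \<le> v - 1#} + replicate_mset (count M (Suc v)) (Suc v)"
        by (rule multiset_eqI) auto
      ultimately show ?thesis by simp
    qed
    ultimately show ?thesis using True by simp
  qed
  show ?thesis unfolding gt_patterns_def using out zero mono inter ev cum by blast
qed

end

text \<open>The bounds involve only values of the pattern at v - 1 and v + 1, which the reflection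
  leaves alone.\<close>

lemma bender_knuth_involution:
  assumes "is_partition lam" "g \<in> gt_patterns lam M" "1 \<le> v"
  shows "bender_knuth (bender_knuth g v) v = g"
proof (intro ext)
  fix i u
  let ?h = "bender_knuth g v"
  have "gt_lower ?h v i = gt_lower g v i" "gt_upper ?h v i = gt_upper g v i"
    using assms(3) by (auto simp: gt_lower_def gt_upper_def bender_knuth_def)
  then show "bender_knuth ?h v i u = g i u"
    using bender_knuth_bounds(3)[OF assms, of i] by (auto simp: bender_knuth_def)
qed

lemma bij_betw_row_counts:
  assumes lam: "is_partition lam"
  shows "bij_betw (row_counts lam) {T \<in> SSYT lam. image_mset T (mset_set (diagram lam)) = M} (gt_patterns lam M)"
proof (rule bij_betwI[of _ _ _ "tableau_of lam"])
  show "row_counts lam \<in> {T \<in> SSYT lam. image_mset T (mset_set (diagram lam)) = M} \<rightarrow> gt_patterns lam M"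
    using row_counts_gt[OF _ lam] by auto
  show "tableau_of lam \<in> gt_patterns lam M \<rightarrow> {T \<in> SSYT lam. image_mset T (mset_set (diagram lam)) = M}"
    using tableau_of_SSYT[OF lam] content_tableau_of[OF lam] by auto
  show "row_counts lam (tableau_of lam g) = g" if "g \<in> gt_patterns lam M" for g
    using row_counts_tableau_of[OF lam that] .
  fix T assume T: "T \<in> {T \<in> SSYT lam. image_mset T (mset_set (diagram lam)) = M}"
  show "tableau_of lam (row_counts lam T) = T"
  proof
    fix c
    show "tableau_of lam (row_counts lam T) c = T c"
    proof (cases "c \<in> diagram lam")
      case True
      obtain i j where c: "c = (i, j)" by fastforce
      have "(LEAST v. j \<le> row_counts lam T i v) = T (i, j)"
        using row_counts_le_iff[of T lam i j] T True c by (intro Least_equality) auto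
      then show ?thesis using True c by (simp add: tableau_of_def)
    next
      case False
      then show ?thesis using T SSYT_undefined[of T lam c] by (simp add: tableau_of_def)
    qed
  qed
qed

theorem symmetric_schur:
  assumes lam: "is_partition lam"
  shows "symmetric_series (schur lam)"
  unfolding symmetric_series_def
proof (intro conjI allI impI)
  fix M :: "nat multiset"
  assume M: "0 \<in># M"
  have "T \<notin> SSYT lam" if "image_mset T (mset_set (diagram lam)) = M" for T
  proof
    assume T: "T \<in> SSYT lam"
    have "0 \<in># image_mset T (mset_set (diagram lam))" using M that by simp
    then obtain d where "d \<in> diagram lam" "T d = 0" by auto
    then show False using SSYT_pos[OF T] by fastforce
  qed
  then have empty: "{T \<in> SSYT lam. image_mset T (mset_set (diagram lam)) = M} = {}" by blast
  show "schur lam M = 0" unfolding schur_def empty by simp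
next
  fix M :: "nat multiset" and v :: nat assume v: "1 \<le> v"
  let ?M = "image_mset (id(v := Suc v, Suc v := v)) M"
  have MM: "image_mset (id(v := Suc v, Suc v := v)) ?M = M"
  proof -
    have "id(v := Suc v, Suc v := v) \<circ> id(v := Suc v, Suc v := v) = id" by (auto simp: fun_eq_iff)
    then show ?thesis by (simp add: multiset.map_comp)
  qed
  have "bij_betw (\<lambda>g. bender_knuth g v) (gt_patterns lam ?M) (gt_patterns lam M)"
  proof (rule bij_betwI[of _ _ _ "\<lambda>g. bender_knuth g v"])
    show "(\<lambda>g. bender_knuth g v) \<in> gt_patterns lam ?M \<rightarrow> gt_patterns lam M"
      using bender_knuth_gt[OF lam _ v, of _ ?M] MM by auto
    show "(\<lambda>g. bender_knuth g v) \<in> gt_patterns lam M \<rightarrow> gt_patterns lam ?M"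
      using bender_knuth_gt[OF lam _ v, of _ M] by auto
  qed (use bender_knuth_involution[OF lam _ v] in auto)
  then show "schur lam ?M = schur lam M"
    using bij_betw_same_card[OF bij_betw_row_counts[OF lam, of M]] bij_betw_same_card[OF bij_betw_row_counts[OF lam, of ?M]]
    by (auto simp: schur_def dest: bij_betw_same_card)
qed

section \<open>Unitriangularity and Schur expansions\<close>

definition content :: "nat list \<Rightarrow> nat multiset" where
  "content lam = image_mset fst (mset_set (diagram lam))"

lemma count_content: "count (content lam) i = part lam i"
proof -
  have "count (content lam) i = card {c \<in> diagram lam. fst c = i}"
    by (simp add: content_def count_image_mset Int_def vimage_def conj_commute)
  also have "{c \<in> diagram lam. fst c = i} = Pair i ` {j. (i, j) \<in> diagram lam}" by force
  also have "card \<dots> = card {j. (i, j) \<in> diagram lam}" by (rule card_image) (auto simp: inj_on_def)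
  also have "{j. (i, j) \<in> diagram lam} = {1..part lam i}"
    by (cases "1 \<le> i") (auto simp: diagram_iff part_def)
  finally show ?thesis by simp
qed

lemma part_inject:
  assumes "is_partition lam" "is_partition mu" "part lam = part mu"
  shows "lam = mu"
proof -
  have len: "i \<le> length lam \<longleftrightarrow> part lam i > 0" if "is_partition lam" "1 \<le> i" for lam i
  proof
    assume "i \<le> length lam"
    then have "lam ! (i - 1) \<in> set lam" using that by simp
    then have "lam ! (i - 1) \<noteq> 0" using that(1) unfolding is_partition_def by metis
    then show "part lam i > 0" using \<open>i \<le> length lam\<close> that by (simp add: part_def)
  qed (auto simp: part_def split: if_splits)
  have l: "length lam = length mu"
  proof (rule ccontr)
    assume "length lam \<noteq> length mu"
    then have "1 \<le> max (length lam) (length mu)" by auto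
    then show False
      using len[OF assms(1), of "max (length lam) (length mu)"] len[OF assms(2), of "max (length lam) (length mu)"]
        assms(3) \<open>length lam \<noteq> length mu\<close> by (auto simp: max_def split: if_splits)
  qed
  show ?thesis
  proof (rule nth_equalityI[OF l])
    fix i assume "i < length lam"
    then show "lam ! i = mu ! i" using fun_cong[OF assms(3), of "Suc i"] l by (simp add: part_def)
  qed
qed

lemma content_inject: "is_partition lam \<Longrightarrow> is_partition mu \<Longrightarrow> content lam = content mu \<Longrightarrow> lam = mu"
  by (rule part_inject) (auto simp: fun_eq_iff simp flip: count_content)

lemma diagram_inject: "is_partition lam \<Longrightarrow> is_partition mu \<Longrightarrow> diagram lam = diagram mu \<Longrightarrow> lam = mu"
  by (rule content_inject) (auto simp: content_def)

lemma card_diagram: "card (diagram lam) = sum_list lam"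
proof -
  have "diagram lam = (SIGMA i:{1..length lam}. {1..lam ! (i - 1)})" by (auto simp: diagram_def)
  then have "card (diagram lam) = (\<Sum>i=1..length lam. lam ! (i - 1))" by simp
  also have "\<dots> = (\<Sum>i<length lam. lam ! i)"
    by (rule sum.reindex_bij_witness[of _ Suc "\<lambda>i. i - 1"]) auto
  finally show ?thesis by (simp add: sum_list_sum_nth atLeast0LessThan)
qed

lemma row_le_SSYT:
  assumes "is_partition lam" "T \<in> SSYT lam" "(i, j) \<in> diagram lam"
  shows "i \<le> T (i, j)"
  using assms(3)
proof (induction i)
  case (Suc i)
  show ?case
  proof (cases "i = 0")
    case True
    then show ?thesis using SSYT_pos[OF assms(2) Suc.prems] by simp
  next
    case False
    then have c: "(i, j) \<in> diagram lam"
      using Suc.prems part_antimono[OF assms(1), of i "Suc i"] by (simp add: diagram_iff)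
    then have "T (i, j) < T (Suc i, j)" using assms(2) Suc.prems by (auto simp: SSYT_def)
    then show ?thesis using Suc.IH[OF c] by simp
  qed
qed simp

text \<open>Columns increase strictly, so an entry is at least its row index, and the total is least
  only when each row i is filled with i. The total of the content thus plays the part usually given
  to dominance order.\<close>

lemma SSYT_content:
  assumes lam: "is_partition lam" and T: "T \<in> SSYT lam" and M: "image_mset T (mset_set (diagram lam)) = M"
  shows "sum_mset (content lam) \<le> sum_mset M"
    "sum_mset (content lam) = sum_mset M \<Longrightarrow> T = restrict fst (diagram lam)"
proof -
  have s: "sum_mset M = (\<Sum>c\<in>diagram lam. T c)" "sum_mset (content lam) = (\<Sum>c\<in>diagram lam. fst c)"
    unfolding M[symmetric] content_def by (simp_all flip: sum_unfold_sum_mset)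
  have le: "fst c \<le> T c" if "c \<in> diagram lam" for c
    using row_le_SSYT[OF lam T, of "fst c" "snd c"] that by simp
  then show "sum_mset (content lam) \<le> sum_mset M" unfolding s by (intro sum_mono)
  assume "sum_mset (content lam) = sum_mset M"
  then have "fst c = T c" if "c \<in> diagram lam" for c
    using that le unfolding s by (intro sum_mono_inv[of fst "diagram lam" T]) auto
  then show "T = restrict fst (diagram lam)"
    using SSYT_undefined[OF T] by (intro ext) (simp add: restrict_def del: split_paired_All)
qed

lemma schur_content:
  assumes lam: "is_partition lam" and "schur lam M \<noteq> 0"
  shows "sum_mset (content lam) \<le> sum_mset M" "sum_mset (content lam) = sum_mset M \<Longrightarrow> M = content lam"
    "size M = sum_list lam"
proof -
  have "{T \<in> SSYT lam. image_mset T (mset_set (diagram lam)) = M} \<noteq> {}"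
  proof
    assume e: "{T \<in> SSYT lam. image_mset T (mset_set (diagram lam)) = M} = {}"
    show False using assms(2) unfolding schur_def e by simp
  qed
  then obtain T where T: "T \<in> SSYT lam" "image_mset T (mset_set (diagram lam)) = M" by blast
  show "sum_mset (content lam) \<le> sum_mset M" using SSYT_content(1)[OF lam T] .
  show "M = content lam" if "sum_mset (content lam) = sum_mset M"
    using SSYT_content(2)[OF lam T that] T(2) by (auto simp: content_def intro!: image_mset_cong)
  show "size M = sum_list lam" using T(2) card_diagram by (metis size_image_mset size_mset_set)
qed

lemma schur_self:
  assumes lam: "is_partition lam"
  shows "schur lam (content lam) = 1"
proof -
  have "restrict fst (diagram lam) \<in> SSYT lam"
    by (auto simp: SSYT_def diagram_iff)
  moreover have "image_mset (restrict fst (diagram lam)) (mset_set (diagram lam)) = content lam"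
    unfolding content_def by (intro image_mset_cong) auto
  ultimately have "{T \<in> SSYT lam. image_mset T (mset_set (diagram lam)) = content lam} = {restrict fst (diagram lam)}"
    using SSYT_content(2)[OF lam] by blast
  then show ?thesis by (simp add: schur_def)
qed

lemma schur_content_content:
  assumes "is_partition lam" "is_partition mu" "sum_mset (content mu) \<le> sum_mset (content lam)"
  shows "schur lam (content mu) = of_bool (lam = mu)"
proof (cases "lam = mu")
  case True
  then show ?thesis using schur_self[OF assms(2)] by simp
next
  case False
  then have "content mu \<noteq> content lam" using content_inject[OF assms(1,2)] by metis
  then have "schur lam (content mu) = 0"
    using schur_content(1,2)[OF assms(1), of "content mu"] assms(3) by (metis le_antisym)
  then show ?thesis using False by simp
qed

text \<open>Among the partitions at which a and b differ take a \<mu> whose content has the least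
  total. Evaluating the difference of the expansions at that content leaves a \<mu> - b \<mu>
  alone.\<close>

lemma schur_expansion_unique:
  assumes "schur_expansion f a" "schur_expansion f b"
  shows "a = b"
proof (rule ccontr)
  assume "a \<noteq> b"
  define S where "S = {lam. a lam \<noteq> 0} \<union> {lam. b lam \<noteq> 0}"
  have S: "finite S" "\<And>lam. lam \<in> S \<Longrightarrow> is_partition lam" using assms by (auto simp: S_def schur_expansion_def)
  have sum: "f M = (\<Sum>lam\<in>S. a lam * schur lam M)" "f M = (\<Sum>lam\<in>S. b lam * schur lam M)" for M
  proof -
    have "(\<Sum>lam | a lam \<noteq> 0. a lam * schur lam M) = (\<Sum>lam\<in>S. a lam * schur lam M)"
      "(\<Sum>lam | b lam \<noteq> 0. b lam * schur lam M) = (\<Sum>lam\<in>S. b lam * schur lam M)"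
      using S(1) by (auto intro!: sum.mono_neutral_left simp: S_def)
    then show "f M = (\<Sum>lam\<in>S. a lam * schur lam M)" "f M = (\<Sum>lam\<in>S. b lam * schur lam M)"
      using assms by (simp_all add: schur_expansion_def)
  qed
  define D where "D = {lam \<in> S. a lam \<noteq> b lam}"
  have D: "finite D" "D \<noteq> {}"
  proof -
    obtain lam where lam: "a lam \<noteq> b lam" using \<open>a \<noteq> b\<close> by blast
    then have "lam \<in> D" by (cases "a lam = 0") (auto simp: D_def S_def)
    then show "D \<noteq> {}" by blast
    show "finite D" using S(1) by (simp add: D_def)
  qed
  obtain mu where mu: "mu \<in> D" "\<And>lam. lam \<in> D \<Longrightarrow> sum_mset (content mu) \<le> sum_mset (content lam)"
    using ex_min_if_finite[of "(\<lambda>lam. sum_mset (content lam)) ` D"] D by (auto simp: not_less)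
  have "(\<Sum>lam\<in>S. (a lam - b lam) * schur lam (content mu)) = 0"
    using sum[of "content mu"] by (simp add: algebra_simps sum_subtractf)
  also have "(\<Sum>lam\<in>S. (a lam - b lam) * schur lam (content mu)) = (\<Sum>lam\<in>S. if lam = mu then a mu - b mu else 0)"
  proof (rule sum.cong[OF HOL.refl])
    fix lam assume lam: "lam \<in> S"
    show "(a lam - b lam) * schur lam (content mu) = (if lam = mu then a mu - b mu else 0)"
    proof (cases "lam \<in> D")
      case True
      then show ?thesis using schur_content_content[of lam mu] mu S(2) by (auto simp: D_def)
    next
      case False
      then show ?thesis using lam mu(1) by (auto simp: D_def)
    qed
  qed
  also have "\<dots> = a mu - b mu" using mu(1) S(1) by (simp add: D_def)
  finally show False using mu(1) by (simp add: D_def)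
qed

definition partitions_of :: "nat \<Rightarrow> nat list set" where
  "partitions_of n = {lam. is_partition lam \<and> sum_list lam = n}"

lemma finite_partitions_of: "finite (partitions_of n)"
proof (rule finite_subset)
  show "partitions_of n \<subseteq> {xs. set xs \<subseteq> {..n} \<and> length xs \<le> n}"
  proof clarify
    fix lam assume lam: "lam \<in> partitions_of n"
    have "length lam \<le> sum_list lam" if "0 \<notin> set lam" for lam :: "nat list"
      using that by (induction lam) auto
    then show "set lam \<subseteq> {..n} \<and> length lam \<le> n"
      using lam by (auto simp: partitions_of_def is_partition_def member_le_sum_list)
  qed
  show "finite {xs. set xs \<subseteq> {..n} \<and> length xs \<le> n}" by (rule finite_lists_length_le) simp
qed

text \<open>Take a monomial N of least total with nonzero coefficient. If j + 1 occurred in it more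
  often than j, exchanging the two would lower the total and keep the coefficient. So the
  multiplicities decrease weakly, and N is the content of a partition.\<close>

lemma symmetric_series_zero:
  assumes f: "symmetric_series f" and zero: "\<And>lam. is_partition lam \<Longrightarrow> f (content lam) = 0"
  shows "f M = 0"
proof (rule ccontr)
  assume "f M \<noteq> 0"
  then obtain N where N: "f N \<noteq> 0" "\<And>N'. f N' \<noteq> 0 \<Longrightarrow> sum_mset N \<le> sum_mset N'"
    using ex_has_least_nat[of "\<lambda>M. f M \<noteq> 0" M sum_mset] by blast
  have N0: "0 \<notin># N" using f N(1) by (auto simp: symmetric_series_def)
  have dec: "count N (Suc j) \<le> count N j" if j: "1 \<le> j" for j
  proof (rule ccontr)
    assume less: "\<not> count N (Suc j) \<le> count N j"
    define R where "R = {#x \<in># N. x \<noteq> j \<and> x \<noteq> Suc j#}"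
    let ?N = "image_mset (id(j := Suc j, Suc j := j)) N"
    have ND: "N = R + (replicate_mset (count N j) j + replicate_mset (count N (Suc j)) (Suc j))"
      by (rule multiset_eqI) (auto simp: R_def)
    have "image_mset (id(j := Suc j, Suc j := j)) R = R"
      by (rule multiset.map_ident_strong) (auto simp: R_def)
    then have "?N = R + (replicate_mset (count N j) (Suc j) + replicate_mset (count N (Suc j)) j)"
      by (subst ND) simp
    then have "sum_mset ?N = sum_mset R + (count N j * Suc j + count N (Suc j) * j)"
      by (simp add: sum_mset_replicate_mset)
    moreover have "sum_mset N = sum_mset R + (count N j * j + count N (Suc j) * Suc j)"
      by (subst ND) (simp add: sum_mset_replicate_mset)
    moreover have "f ?N \<noteq> 0" using f N(1) j by (simp add: symmetric_series_def)
    ultimately show False using N(2)[of ?N] less by simp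
  qed
  \<comment> \<open>The number of parts of the partition sought; the empty multiset has no maximum
    and is set apart.\<close>
  define L where "L = (if N = {#} then 0 else Max (set_mset N))"
  define lam where "lam = map (\<lambda>i. count N (Suc i)) [0..<L]"
  have anti: "count N i' \<le> count N i" if "i \<le> i'" "1 \<le> i" for i i'
    using that by (induction i' rule: dec_induct) (auto intro: order_trans[OF dec])
  have "is_partition lam"
    unfolding is_partition_def
  proof
    show "sorted_wrt (\<ge>) lam" by (auto simp: lam_def sorted_wrt_iff_nth_less intro: anti)
    show "0 \<notin> set lam"
    proof
      assume "0 \<in> set lam"
      then obtain i where i: "i < L" "count N (Suc i) = 0" by (auto simp: lam_def)
      then have ne: "N \<noteq> {#}" and "Max (set_mset N) = L" by (auto simp: L_def split: if_splits)
      then have "L \<in># N" using Max_in[of "set_mset N"] by simp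
      then have pos: "0 < count N L" by simp
      have "count N L \<le> count N (Suc i)" using i by (intro anti) auto
      then show False using pos i(2) by linarith
    qed
  qed
  moreover have "content lam = N"
  proof (rule multiset_eqI)
    fix x
    show "count (content lam) x = count N x"
    proof (cases "1 \<le> x \<and> x \<le> L")
      case True
      then show ?thesis by (cases x) (simp_all add: count_content part_def lam_def)
    next
      case False
      have "count N x = 0"
      proof (cases "x = 0")
        case True
        then show ?thesis using N0 by (simp add: count_eq_zero_iff)
      next
        case False
        then have "L < x" using \<open>\<not> (1 \<le> x \<and> x \<le> L)\<close> by simp
        then have "x \<notin># N" using Max_ge[of "set_mset N" x] by (auto simp: L_def split: if_splits)
        then show ?thesis by (simp add: count_eq_zero_iff)
      qed
      then show ?thesis using False by (auto simp: count_content part_def lam_def)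
    qed
  qed
  ultimately show False using zero N(1) by metis
qed

lemma symmetric_series_diff_sum:
  assumes f: "symmetric_series f" and "\<And>lam. lam \<in> S \<Longrightarrow> is_partition lam"
  shows "symmetric_series (\<lambda>M. f M - (\<Sum>lam\<in>S. a lam * schur lam M))"
proof -
  have "schur lam (image_mset (id(j := Suc j, Suc j := j)) M) = schur lam M" if "lam \<in> S" "1 \<le> j" for lam j M
    using symmetric_schur[OF assms(2)[OF that(1)]] that(2) by (simp add: symmetric_series_def)
  moreover have "schur lam M = 0" if "lam \<in> S" "0 \<in># M" for lam M
    using symmetric_schur[OF assms(2)[OF that(1)]] that(2) by (simp add: symmetric_series_def)
  ultimately show ?thesis using f by (simp add: symmetric_series_def)
qed

text \<open>
  The Kostka matrix is unitriangular with respect to the statistic \<open>sum_mset (content lam)\<close>, so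
  the coefficients are found by recursion on it.
\<close>

lemma schur_expansion_exists:
  assumes f: "symmetric_series f" and hom: "\<And>M. f M \<noteq> 0 \<Longrightarrow> size M = n"
  obtains a where "schur_expansion f a" "\<And>lam. a lam \<noteq> 0 \<Longrightarrow> lam \<in> partitions_of n"
proof -
  let ?P = "partitions_of n" and ?N = "\<lambda>lam. sum_mset (content lam)"
  have P: "is_partition lam" if "lam \<in> ?P" for lam using that by (simp add: partitions_of_def)
  have "\<exists>a. (\<forall>lam. a lam \<noteq> 0 \<longrightarrow> lam \<in> ?P) \<and>
      (\<forall>mu\<in>?P. ?N mu < j \<longrightarrow> f (content mu) = (\<Sum>lam\<in>?P. a lam * schur lam (content mu)))" for j
  proof (induction j)
    case 0
    show ?case by (intro exI[of _ "\<lambda>_. 0"]) simp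
  next
    case (Suc j)
    then obtain a where a: "\<And>lam. a lam \<noteq> 0 \<Longrightarrow> lam \<in> ?P"
      "\<And>mu. mu \<in> ?P \<Longrightarrow> ?N mu < j \<Longrightarrow> f (content mu) = (\<Sum>lam\<in>?P. a lam * schur lam (content mu))" by blast
    \<comment> \<open>The defect at \<mu>. Correcting it only where the total equals j does not
      disturb smaller totals, since there the added Schur functions vanish by
      \<open>schur_content_content\<close>.\<close>
    define d where "d mu = f (content mu) - (\<Sum>lam\<in>?P. a lam * schur lam (content mu))" for mu
    define b where "b lam = (if lam \<in> ?P \<and> ?N lam = j then d lam else 0)" for lam
    have "f (content mu) = (\<Sum>lam\<in>?P. (a lam + b lam) * schur lam (content mu))" if mu: "mu \<in> ?P" "?N mu < Suc j" for mu
    proof -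
      have "(\<Sum>lam\<in>?P. b lam * schur lam (content mu)) = (\<Sum>lam\<in>?P. if lam = mu then b mu else 0)"
      proof (rule sum.cong[OF HOL.refl])
        fix lam assume lam: "lam \<in> ?P"
        show "b lam * schur lam (content mu) = (if lam = mu then b mu else 0)"
        proof (cases "?N lam = j")
          case True
          then show ?thesis using schur_content_content[OF P[OF lam] P[OF mu(1)]] mu(2) by auto
        next
          case False
          then show ?thesis by (auto simp: b_def)
        qed
      qed
      also have "\<dots> = b mu" using mu(1) finite_partitions_of by simp
      finally have "(\<Sum>lam\<in>?P. b lam * schur lam (content mu)) = b mu" .
      then show ?thesis
        using mu a(2)[OF mu(1)] by (cases "?N mu = j") (auto simp: distrib_right sum.distrib b_def d_def)
    qed
    then show ?case using a(1) by (intro exI[of _ "\<lambda>lam. a lam + b lam"]) (auto simp: b_def)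
  qed
  from this[of "Suc (Max (?N ` ?P))"] obtain a where a: "\<And>lam. a lam \<noteq> 0 \<Longrightarrow> lam \<in> ?P"
    "\<And>mu. mu \<in> ?P \<Longrightarrow> f (content mu) = (\<Sum>lam\<in>?P. a lam * schur lam (content mu))"
    using finite_partitions_of[of n] by (auto simp: less_Suc_eq_le)
  have "f M - (\<Sum>lam\<in>?P. a lam * schur lam M) = 0" for M
  proof (rule symmetric_series_zero)
    show "symmetric_series (\<lambda>M. f M - (\<Sum>lam\<in>?P. a lam * schur lam M))"
      using P by (intro symmetric_series_diff_sum f)
    fix mu assume mu: "is_partition mu"
    show "f (content mu) - (\<Sum>lam\<in>?P. a lam * schur lam (content mu)) = 0"
    proof (cases "mu \<in> ?P")
      case False
      then have sz: "size (content mu) \<noteq> n" using mu card_diagram[of mu] by (simp add: content_def partitions_of_def)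
      then have "f (content mu) = 0" using hom by blast
      moreover have "schur lam (content mu) = 0" if "lam \<in> ?P" for lam
        using schur_content(3)[OF P[OF that], of "content mu"] sz that by (auto simp: partitions_of_def)
      ultimately show ?thesis by simp
    qed (use a(2) in simp)
  qed
  moreover have "(\<Sum>lam\<in>?P. a lam * schur lam M) = (\<Sum>lam | a lam \<noteq> 0. a lam * schur lam M)" for M
    using a(1) finite_partitions_of by (intro sum.mono_neutral_right) auto
  moreover have "finite {lam. a lam \<noteq> 0}"
  proof (rule finite_subset[OF _ finite_partitions_of[of n]])
    show "{lam. a lam \<noteq> 0} \<subseteq> ?P" using a(1) by blast
  qed
  ultimately have "schur_expansion f a"
    using a(1) P by (auto simp: schur_expansion_def)
  then show ?thesis using that a(1) by blast
qed

text \<open>The standard tableaux of shape \<open>lam\<close>, as lists of the cells in the order of their entries.\<close>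

definition standard_orders :: "nat list \<Rightarrow> (nat \<times> nat) list set" where
  "standard_orders lam = {xs. distinct xs \<and> set xs = diagram lam \<and>
     (\<forall>i j j'. (i, j) \<in> diagram lam \<and> (i, j') \<in> diagram lam \<and> j < j' \<longrightarrow> label_rank xs (i, j) < label_rank xs (i, j')) \<and>
     (\<forall>i i' j. (i, j) \<in> diagram lam \<and> (i', j) \<in> diagram lam \<and> i < i' \<longrightarrow> label_rank xs (i, j) < label_rank xs (i', j))}"

section \<open>Schur functions as sums over standard tableaux\<close>

lemma standard_orders_length: "xs \<in> standard_orders lam \<Longrightarrow> length xs = sum_list lam"
  using card_diagram[of lam] distinct_card[of xs] by (auto simp: standard_orders_def)

lemma finite_standard_orders: "finite (standard_orders lam)"
  by (rule finite_subset[OF _ finite_lists_length_eq[OF finite_diagram, of lam "sum_list lam"]])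
     (auto simp: standard_orders_length, auto simp: standard_orders_def)

lemma fill_less_iff:
  assumes xs: "distinct xs" "set xs = D" and ps: "length ps = length xs" "sorted ps" "compatible ps key xs"
    and d: "d \<in> D" "e \<in> D"
  shows "label_rank xs d < label_rank xs e \<longleftrightarrow>
    fill ps xs d < fill ps xs e \<or> fill ps xs d = fill ps xs e \<and> key d < key e"
proof -
  note rd = nth_label_rank[OF xs(1), unfolded xs(2), OF d(1)] and re = nth_label_rank[OF xs(1), unfolded xs(2), OF d(2)]
  have f: "fill ps xs d = ps ! label_rank xs d" "fill ps xs e = ps ! label_rank xs e"
    using d xs by (auto simp: fill_def)
  show ?thesis
  proof (cases "label_rank xs d" "label_rank xs e" rule: linorder_cases)
    case less
    then show ?thesis using compatible_lex[OF ps less re(1)] unfolding f rd(2) re(2) by simp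
  next
    case equal
    then have "d = e" using rd(2) re(2) by metis
    then show ?thesis by simp
  next
    case greater
    then have "fill ps xs e < fill ps xs d \<or> fill ps xs e = fill ps xs d \<and> key e < key d"
      using compatible_lex[OF ps greater rd(1)] unfolding f rd(2) re(2) by simp
    then show ?thesis using greater by auto
  qed
qed

lemma bij_betw_restrict:
  assumes "bij_betw f X S" "A \<subseteq> S"
  shows "bij_betw f {x \<in> X. f x \<in> A} A"
proof -
  have "f ` X = S" and inj: "inj_on f X" using assms(1) by (auto simp: bij_betw_def)
  then have "f ` {x \<in> X. f x \<in> A} = A" using assms(2) by blast
  moreover have "inj_on f {x \<in> X. f x \<in> A}" by (rule inj_on_subset[OF inj]) blast
  ultimately show ?thesis by (simp add: bij_betw_def)
qed

text \<open>Breaking ties by column, weak increase along rows and strict increase down columns both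
  turn into inequalities between ranks, which are the conditions of a standard tableau.\<close>

theorem schur_qsym:
  assumes lam: "is_partition lam"
  shows "schur lam = qsym (standard_orders lam) snd (\<lambda>_. 1) (sum_list lam)"
proof
  fix M :: "nat multiset"
  let ?D = "diagram lam" and ?ps = "sorted_list_of_multiset M"
  let ?A = "{T \<in> SSYT lam. image_mset T (mset_set ?D) = M}"
  show "schur lam M = qsym (standard_orders lam) snd (\<lambda>_. 1) (sum_list lam) M"
  proof (cases "size M = sum_list lam \<and> 0 \<notin># M")
    case False
    then have "schur lam M = 0"
      using schur_content(3)[OF lam, of M] symmetric_schur[OF lam] by (auto simp: symmetric_series_def)
    then show ?thesis using False by (auto simp: qsym_def)
  next
    case True
    let ?X = "{xs. distinct xs \<and> set xs = ?D \<and> compatible ?ps snd xs}"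
    let ?S = "{\<sigma> \<in> ?D \<rightarrow>\<^sub>E UNIV. image_mset \<sigma> (mset_set ?D) = M \<and> (\<forall>d\<in>?D. \<forall>e\<in>?D. d \<noteq> e \<and> \<sigma> d = \<sigma> e \<longrightarrow> snd d \<noteq> snd e)}"
    have ps: "length ?ps = sum_list lam" "sorted ?ps" using True by (auto simp flip: size_mset)
    have bij: "bij_betw (fill ?ps) ?X ?S"
      by (rule bij_betw_fill) (use True card_diagram in auto)
    \<comment> \<open>Equal entries form a horizontal strip, so the column separates them.\<close>
    have "?A \<subseteq> ?S"
    proof
      fix T assume T: "T \<in> ?A"
      have "snd d \<noteq> snd e" if de: "d \<in> ?D" "e \<in> ?D" "d \<noteq> e" "T d = T e" for d e
      proof
        assume "snd d = snd e"
        then obtain i i' j where c: "d = (i, j)" "e = (i', j)" by (metis prod.collapse)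
        have "i \<noteq> i'" using c de(3) by simp
        moreover have "\<forall>i i' j. (i, j) \<in> ?D \<and> (i', j) \<in> ?D \<and> i < i' \<longrightarrow> T (i, j) < T (i', j)"
          using T by (simp add: SSYT_def)
        ultimately show False using c de(1,2,4) by (metis linorder_neqE_nat order_less_irrefl)
      qed
      moreover have "T \<in> ?D \<rightarrow>\<^sub>E UNIV" using T SSYT_undefined[of T lam] by (simp add: PiE_def extensional_def del: split_paired_All)
      ultimately show "T \<in> ?S" using T by blast
    qed
    then have "card ?A = card {xs \<in> ?X. fill ?ps xs \<in> ?A}"
    proof -
      assume sub: "?A \<subseteq> ?S"
      have "bij_betw (fill ?ps) {xs \<in> ?X. fill ?ps xs \<in> ?A} ?A"
        by (rule bij_betw_restrict[OF bij sub])
      then show ?thesis by (rule bij_betw_same_card[symmetric])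
    qed
    also have "{xs \<in> ?X. fill ?ps xs \<in> ?A} = {xs \<in> standard_orders lam. compatible ?ps snd xs}"
    proof -
      have "fill ?ps xs \<in> ?A \<longleftrightarrow> xs \<in> standard_orders lam" if xs: "xs \<in> ?X" for xs
      proof -
        have x: "distinct xs" "set xs = ?D" "compatible ?ps snd xs" using xs by auto
        then have lx: "length ?ps = length xs" using ps card_diagram distinct_card by metis
        note less = fill_less_iff[OF x(1,2) lx ps(2) x(3)]
        have S: "fill ?ps xs \<in> ?S" by (rule bij_betw_apply[OF bij xs])
        have im: "image_mset (fill ?ps xs) (mset_set ?D) = M" and ext: "fill ?ps xs \<in> ?D \<rightarrow>\<^sub>E UNIV"
          using S[unfolded mem_Collect_eq] by iprover+
        have pos: "fill ?ps xs d > 0" if "d \<in> ?D" for d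
        proof -
          have "fill ?ps xs d \<in># image_mset (fill ?ps xs) (mset_set ?D)" using that by simp
          then have "fill ?ps xs d \<in># M" unfolding im .
          then show ?thesis using True by (metis not_gr0)
        qed
        have "fill ?ps xs \<in> ?D \<rightarrow>\<^sub>E {0<..}" using ext pos by (simp add: PiE_iff)
        moreover have "(fill ?ps xs (i, j) \<le> fill ?ps xs (i, j')) \<longleftrightarrow> label_rank xs (i, j) < label_rank xs (i, j')"
          if "(i, j) \<in> ?D" "(i, j') \<in> ?D" "j < j'" for i j j'
          using less[OF that(1,2)] that(3) by auto
        moreover have "(fill ?ps xs (i, j) < fill ?ps xs (i', j)) \<longleftrightarrow> label_rank xs (i, j) < label_rank xs (i', j)"
          if "(i, j) \<in> ?D" "(i', j) \<in> ?D" for i i' j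
          using less[OF that(1,2)] by auto
        ultimately show ?thesis
          using im x by (simp add: SSYT_def standard_orders_def)
      qed
      moreover have "standard_orders lam \<subseteq> {xs. distinct xs \<and> set xs = ?D}" by (auto simp: standard_orders_def)
      ultimately show ?thesis by blast
    qed
    finally show ?thesis using True by (simp add: schur_def qsym_def)
  qed
qed

section \<open>Standard orders of valley type\<close>

definition hook_cells :: "nat \<Rightarrow> nat \<Rightarrow> (nat \<times> nat) list" where
  "hook_cells n k = map (\<lambda>p. if p < k then (1, Suc p) else (p - k + 2, 1)) [0..<n]"

lemma part_hook: "part (hook n k) i = (if i = 1 then k else if 2 \<le> i \<and> i \<le> Suc (n - k) then 1 else 0)"
  by (auto simp: part_def hook_def nth_Cons split: nat.splits)

lemma partition_hook: "1 \<le> k \<Longrightarrow> is_partition (hook n k)"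
  by (auto simp: is_partition_def hook_def sorted_wrt_iff_nth_less nth_Cons split: nat.splits)

lemma sum_list_hook: "k \<le> n \<Longrightarrow> sum_list (hook n k) = n"
  by (simp add: hook_def sum_list_replicate)

lemma set_hook_cells:
  assumes "1 \<le> k" "k \<le> n"
  shows "set (hook_cells n k) = diagram (hook n k)"
proof (intro set_eqI iffI)
  fix c assume "c \<in> set (hook_cells n k)"
  then show "c \<in> diagram (hook n k)" using assms by (auto simp: hook_cells_def diagram_iff part_hook split: if_splits)
next
  fix c assume c: "c \<in> diagram (hook n k)"
  obtain i j where ij: "c = (i, j)" by fastforce
  then consider "i = 1" "1 \<le> j" "j \<le> k" | "2 \<le> i" "i \<le> Suc (n - k)" "j = 1"
    using c by (auto simp: diagram_iff part_hook split: if_splits)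
  then show "c \<in> set (hook_cells n k)"
  proof cases
    case 1
    then show ?thesis unfolding hook_cells_def set_map set_upt using ij assms
      by (intro image_eqI[of _ _ "j - 1"]) auto
  next
    case 2
    then show ?thesis unfolding hook_cells_def set_map set_upt using ij assms
      by (intro image_eqI[of _ _ "i + k - 2"]) auto
  qed
qed

text \<open>The tableau that fills the arm first and the leg afterwards: its columns rise along the
  arm, and on the leg they stay at 1.\<close>

lemma hook_cells_standard:
  assumes k: "1 \<le> k" "k \<le> n"
  shows "hook_cells n k \<in> standard_orders (hook n k)" "valley k snd (hook_cells n k)"
proof -
  have l: "length (hook_cells n k) = n" by (simp add: hook_cells_def)
  have nth: "hook_cells n k ! p = (if p < k then (1, Suc p) else (p - k + 2, 1))" if "p < n" for p
    using that by (simp add: hook_cells_def)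
  have d: "distinct (hook_cells n k)"
    unfolding hook_cells_def distinct_map by (auto simp: inj_on_def split: if_splits)
  have rank: "label_rank (hook_cells n k) (i, j) = (if i = 1 then j - 1 else i + k - 2)"
    if "(i, j) \<in> diagram (hook n k)" for i j
  proof -
    let ?p = "if i = 1 then j - 1 else i + k - 2"
    have "?p < n" "hook_cells n k ! ?p = (i, j)"
      using that k nth[of ?p] by (auto simp: diagram_iff part_hook split: if_splits)
    then show ?thesis using label_rank_nth[OF d, of ?p] l by simp
  qed
  show "hook_cells n k \<in> standard_orders (hook n k)"
    unfolding standard_orders_def using d set_hook_cells[OF k] k
    by (auto simp: rank, auto simp: diagram_iff part_hook split: if_splits)
  show "valley k snd (hook_cells n k)"
    unfolding valley_def l using nth by auto
qed

text \<open>While columns rise strictly, no cell below the first row can be added, since the cell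
  above it in the same column would have come before; so the first k cells are (1, 1), ..., (1, k).
  Afterwards columns do not rise, so no later cell can have its left neighbour after the arm, and
  only cells of column 1 remain.\<close>

lemma standard_valley_unique:
  assumes lam: "is_partition lam" and xs: "xs \<in> standard_orders lam" "valley k snd xs"
    and n: "n = sum_list lam" and k: "1 \<le> k" "k \<le> n"
  shows "xs = hook_cells n k"
proof -
  have l: "length xs = n" using standard_orders_length[OF xs(1)] n by simp
  have d: "distinct xs" "set xs = diagram lam" using xs(1) by (auto simp: standard_orders_def)
  have row: "label_rank xs (i, j) < label_rank xs (i, j')" if "(i, j) \<in> diagram lam" "(i, j') \<in> diagram lam" "j < j'" for i j j'
    using xs(1) that by (auto simp: standard_orders_def)
  have col: "label_rank xs (i, j) < label_rank xs (i', j)" if "(i, j) \<in> diagram lam" "(i', j) \<in> diagram lam" "i < i'" for i i' j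
    using xs(1) that by (auto simp: standard_orders_def)
  have inD: "xs ! p \<in> diagram lam" if "p < n" for p using that l d nth_mem by blast
  have left: "\<exists>p'<p. xs ! p' = (i, j')" if p: "p < n" "xs ! p = (i, j)" and j: "1 \<le> j'" "j' < j" for p i j j'
  proof -
    have c: "(i, j) \<in> diagram lam" using inD[OF p(1)] p(2) by simp
    then have c': "(i, j') \<in> diagram lam" using j by (simp add: diagram_iff)
    have "label_rank xs (i, j) = p" using label_rank_nth[OF d(1), of p] p l by simp
    then show ?thesis using row[OF c' c j(2)] nth_label_rank[OF d(1), of "(i, j')"] c' d(2) by metis
  qed
  have above: "\<exists>p'<p. xs ! p' = (i', j)" if p: "p < n" "xs ! p = (i, j)" and i: "1 \<le> i'" "i' < i" for p i i' j
  proof -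
    have c: "(i, j) \<in> diagram lam" using inD[OF p(1)] p(2) by simp
    then have c': "(i', j) \<in> diagram lam" using i part_antimono[OF lam, of i' i] by (simp add: diagram_iff)
    have "label_rank xs (i, j) = p" using label_rank_nth[OF d(1), of p] p l by simp
    then show ?thesis using col[OF c' c i(2)] nth_label_rank[OF d(1), of "(i', j)"] c' d(2) by metis
  qed
  have inc: "p < p' \<Longrightarrow> p' < k \<Longrightarrow> snd (xs ! p) < snd (xs ! p')" for p p'
  proof (induction p' rule: less_induct)
    case (less p')
    then obtain q where q: "p' = Suc q" by (cases p') auto
    have "snd (xs ! q) < snd (xs ! p')" using xs(2) less.prems q k l by (simp add: valley_def)
    then show ?case using less.IH[of q] less.prems q by (cases "p = q") auto
  qed
  have dec: "k - 1 \<le> p \<Longrightarrow> p \<le> p' \<Longrightarrow> p' < n \<Longrightarrow> snd (xs ! p') \<le> snd (xs ! p)" for p p'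
  proof (induction p' rule: less_induct)
    case (less p')
    show ?case
    proof (cases "p = p'")
      case False
      then obtain q where q: "p' = Suc q" "p \<le> q" using less.prems by (cases p') auto
      have "\<not> snd (xs ! q) < snd (xs ! Suc q)" using xs(2) less.prems q k l by (auto simp: valley_def)
      then show ?thesis using less.IH[of q] less.prems q by simp
    qed simp
  qed
  have inj: "xs ! p = xs ! p' \<longleftrightarrow> p = p'" if "p < n" "p' < n" for p p'
    using that l d(1) by (simp add: nth_eq_iff_index_eq)
  have first: "p < k \<Longrightarrow> xs ! p = (1, Suc p)" for p
  proof (induction p rule: less_induct)
    case (less p)
    have pn: "p < n" using less.prems k by simp
    obtain i j where ij: "xs ! p = (i, j)" by fastforce
    have pos: "1 \<le> i" "1 \<le> j" using inD[OF pn] ij by (auto simp: diagram_iff)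
    have i: "i = 1"
    proof (rule ccontr)
      assume "i \<noteq> 1"
      then obtain p' where p': "p' < p" "xs ! p' = (1, j)" using above[OF pn ij, of 1] pos by auto
      then show False using inc[OF p'(1) less.prems] ij by simp
    qed
    have "\<not> j < Suc p"
    proof
      assume j: "j < Suc p"
      then have "xs ! (j - 1) = (1, j)" using less.IH[of "j - 1"] less.prems pos by auto
      then have "j - 1 = p" using inj[of "j - 1" p] ij i pn j pos by auto
      then show False using j pos by simp
    qed
    moreover have "\<not> Suc p < j"
    proof
      assume j: "Suc p < j"
      then obtain p' where p': "p' < p" "xs ! p' = (i, Suc p)" using left[OF pn ij, of "Suc p"] by auto
      then show False using less.IH[OF p'(1)] less.prems by simp
    qed
    ultimately show ?case using ij i by simp
  qed
  have second: "k \<le> p \<Longrightarrow> p < n \<Longrightarrow> xs ! p = (p - k + 2, 1)" for p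
  proof (induction p rule: less_induct)
    case (less p)
    note pn = less.prems(2)
    obtain i j where ij: "xs ! p = (i, j)" by fastforce
    have pos: "1 \<le> i" "1 \<le> j" using inD[OF pn] ij by (auto simp: diagram_iff)
    have jk: "j \<le> k" using dec[of "k - 1" p] less.prems first[of "k - 1"] ij k by simp
    have i: "2 \<le> i"
    proof (rule ccontr)
      assume "\<not> 2 \<le> i"
      then have "xs ! (j - 1) = xs ! p" using first[of "j - 1"] jk pos ij by auto
      moreover have "j - 1 < n" "j - 1 \<noteq> p" using jk pos less.prems by auto
      ultimately show False using inj[of "j - 1" p] pn by blast
    qed
    \<comment> \<open>The left neighbour in row i comes earlier, but not on the arm because i is at
      least 2; from it to the present cell the column would rise.\<close>
    have j: "j = 1"
    proof (rule ccontr)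
      assume "j \<noteq> 1"
      then have "1 \<le> j - 1" "j - 1 < j" using pos by linarith+
      from left[OF pn ij this] obtain p' where p': "p' < p" "xs ! p' = (i, j - 1)" by blast
      then have "k \<le> p'" using first[of p'] i by force
      then have "k - 1 \<le> p'" "p' \<le> p" using p'(1) by auto
      from dec[OF this pn] have "j \<le> j - 1" using p'(2) ij by simp
      then show False using pos by simp
    qed
    have "\<not> i < p - k + 2"
    proof
      assume a: "i < p - k + 2"
      then have "xs ! (i + k - 2) = xs ! p" using less.IH[of "i + k - 2"] less.prems i j ij by auto
      then show False using inj[of "i + k - 2" p] a i less.prems by auto
    qed
    moreover have "\<not> p - k + 2 < i"
    proof
      assume "p - k + 2 < i"
      then obtain p' where p': "p' < p" "xs ! p' = (p - k + 2, 1)" using above[OF pn ij, of "p - k + 2"] j by auto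
      then have "k \<le> p'" using first[of p'] by force
      then show False using less.IH[OF p'(1)] p' less.prems by simp
    qed
    ultimately show ?case using ij j by simp
  qed
  show ?thesis
    by (rule nth_equalityI) (auto simp: l hook_cells_def first second)
qed

theorem hook_functional_schur:
  assumes lam: "lam \<in> partitions_of n" and k: "1 \<le> k" "k \<le> n"
  shows "hook_functional n k (schur lam) = of_bool (lam = hook n k)"
proof -
  have p: "is_partition lam" "sum_list lam = n" using lam by (auto simp: partitions_of_def)
  have "hook_functional n k (schur lam) = (\<Sum>xs | xs \<in> standard_orders lam \<and> valley k snd xs. 1)"
    unfolding schur_qsym[OF p(1)] p(2)
    by (rule hook_functional_qsym) (use finite_standard_orders standard_orders_length p k in auto)
  also have "{xs. xs \<in> standard_orders lam \<and> valley k snd xs} = (if lam = hook n k then {hook_cells n k} else {})"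
  proof (cases "lam = hook n k")
    case True
    have "xs = hook_cells n k" if "xs \<in> standard_orders lam" "valley k snd xs" for xs
      using standard_valley_unique[OF p(1) that _ k] p(2) by simp
    moreover have "hook_cells n k \<in> standard_orders lam" "valley k snd (hook_cells n k)"
      using hook_cells_standard[OF k] True by simp_all
    ultimately have "{xs. xs \<in> standard_orders lam \<and> valley k snd xs} = {hook_cells n k}" by blast
    then show ?thesis using True by simp
  next
    case False
    have "lam = hook n k" if "xs \<in> standard_orders lam" "valley k snd xs" for xs
    proof (rule diagram_inject[OF p(1) partition_hook[OF k(1)]])
      have "xs = hook_cells n k" using standard_valley_unique[OF p(1) that _ k] p(2) by simp
      then show "diagram lam = diagram (hook n k)"
        using that(1) set_hook_cells[OF k] by (simp add: standard_orders_def)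
    qed
    then show ?thesis using False by auto
  qed
  finally show ?thesis by simp
qed

section \<open>Hook coefficients\<close>

lemma hook_cell_iff:
  "1 \<le> k \<Longrightarrow> (i, j) \<in> diagram (hook n k) \<longleftrightarrow> i = 1 \<and> 1 \<le> j \<and> j \<le> k \<or> 2 \<le> i \<and> i \<le> Suc (n - k) \<and> j = 1"
  by (auto simp: diagram_iff part_hook)

text \<open>The standardisation of \<open>row_of\<close>. The labels in the first row tie, and
  \<open>eps\<close> puts larger ones first, so the arm is read backwards; the leg follows
  downwards, starting with row 2 at place k.\<close>

definition tableau_order :: "nat \<Rightarrow> nat \<Rightarrow> (nat \<times> nat \<Rightarrow> nat) \<Rightarrow> nat list" where
  "tableau_order n k T = map (\<lambda>p. if p < k then T (1, k - p) else T (p - k + 2, 1)) [0..<n]"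

definition order_tableau :: "nat \<Rightarrow> nat \<Rightarrow> nat list \<Rightarrow> nat \<times> nat \<Rightarrow> nat" where
  "order_tableau n k xs = (\<lambda>(i, j)\<in>diagram (hook n k). if i = 1 then xs ! (k - j) else xs ! (k + i - 2))"

definition valley_orders :: "nat \<Rightarrow> nat \<Rightarrow> nat list set" where
  "valley_orders n k = {xs. distinct xs \<and> set xs = {1..n} \<and>
     (\<forall>i. Suc i < n \<longrightarrow> (if Suc i < k then xs ! Suc i < xs ! i else xs ! i < xs ! Suc i))}"

context
  fixes n k :: nat
  assumes k: "1 \<le> k" "k \<le> n"
begin

lemma valley_orders_length: "xs \<in> valley_orders n k \<Longrightarrow> length xs = n"
  using distinct_card[of xs] by (auto simp: valley_orders_def)

lemma valley_orders_desc:
  assumes "xs \<in> valley_orders n k" "p < p'" "p' < k"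
  shows "xs ! p' < xs ! p"
  using assms(2,3)
proof (induction p' rule: less_induct)
  case (less p')
  then obtain q where q: "p' = Suc q" by (cases p') auto
  have "xs ! p' < xs ! q" using assms(1) less.prems q k by (auto simp: valley_orders_def)
  then show ?case using less.IH[of q] less.prems q by (cases "p = q") auto
qed

lemma valley_orders_asc:
  assumes "xs \<in> valley_orders n k" "k - 1 \<le> p" "p < p'" "p' < n"
  shows "xs ! p < xs ! p'"
  using assms(3,4)
proof (induction p' rule: less_induct)
  case (less p')
  then obtain q where q: "p' = Suc q" by (cases p') auto
  have "xs ! q < xs ! p'" using assms(1,2) less.prems q k by (auto simp: valley_orders_def)
  then show ?case using less.IH[of q] less.prems q by (cases "p = q") auto
qed

lemma order_tableau_SYT:
  assumes xs: "xs \<in> valley_orders n k"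
  shows "order_tableau n k xs \<in> SYT (hook n k)"
proof -
  let ?D = "diagram (hook n k)" and ?T = "order_tableau n k xs"
  define g where "g = (\<lambda>(i, j). if i = 1 then k - j else k + i - 2 :: nat)"
  have T: "?T c = xs ! g c" if "c \<in> ?D" for c using that by (auto simp: order_tableau_def g_def split: prod.splits)
  have gb: "bij_betw g ?D {..<n}"
    by (rule bij_betwI[of _ _ _ "\<lambda>p. if p < k then (1, k - p) else (p - k + 2, 1)"])
       (use k in \<open>auto simp: g_def hook_cell_iff split: if_splits\<close>)
  have d: "distinct xs" "set xs = {1..n}" using xs by (auto simp: valley_orders_def)
  have "bij_betw (\<lambda>p. xs ! p) {..<n} {1..n}"
    using bij_betw_nth[OF d(1), of "{..<n}" "{1..n}"] valley_orders_length[OF xs] d(2) by simp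
  then have "bij_betw ((\<lambda>p. xs ! p) \<circ> g) ?D {1..n}" using bij_betw_trans[OF gb] by blast
  then have bij: "bij_betw ?T ?D {1..n}"
    by (rule bij_betw_cong[THEN iffD1, rotated]) (simp add: T)
  have row: "?T (i, j) < ?T (i, j')" if c: "(i, j) \<in> ?D" "(i, j') \<in> ?D" "j < j'" for i j j'
  proof -
    have "i = 1" "1 \<le> j" "j' \<le> k" using c k by (auto simp: hook_cell_iff)
    then show ?thesis using valley_orders_desc[OF xs, of "k - j'" "k - j"] c k by (simp add: T g_def)
  qed
  have col: "?T (i, j) < ?T (i', j)" if c: "(i, j) \<in> ?D" "(i', j) \<in> ?D" "i < i'" for i i' j
  proof -
    have b: "1 \<le> i" "2 \<le> i'" "i' \<le> Suc (n - k)" "j = 1" using c k by (auto simp: hook_cell_iff)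
    then have "g (i, j) < g (i', j)" "k - 1 \<le> g (i, j)" "g (i', j) < n" using c(3) k by (auto simp: g_def)
    then show ?thesis using valley_orders_asc[OF xs] c by (simp add: T)
  qed
  show ?thesis
    using bij row col sum_list_hook[OF k(2)] by (auto simp: SYT_def order_tableau_def)
qed

lemma tableau_order_valley:
  assumes T: "T \<in> SYT (hook n k)"
  shows "tableau_order n k T \<in> valley_orders n k"
proof -
  let ?D = "diagram (hook n k)" and ?f = "\<lambda>p. if p < k then (1, k - p) else (p - k + 2, 1) :: nat \<times> nat"
  have bij: "bij_betw T ?D {1..n}" using T sum_list_hook[OF k(2)] by (simp add: SYT_def)
  have row: "T (i, j) < T (i, j')" if "(i, j) \<in> ?D" "(i, j') \<in> ?D" "j < j'" for i j j'
    using T that unfolding SYT_def by blast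
  have col: "T (i, j) < T (i', j)" if "(i, j) \<in> ?D" "(i', j) \<in> ?D" "i < i'" for i i' j
    using T that unfolding SYT_def by blast
  have fb: "bij_betw ?f {..<n} ?D"
    by (rule bij_betwI[of _ _ _ "\<lambda>(i, j). if i = 1 then k - j else k + i - 2"])
       (use k in \<open>auto simp: hook_cell_iff split: if_splits\<close>)
  have xs: "tableau_order n k T = map (T \<circ> ?f) [0..<n]" by (auto simp: tableau_order_def)
  have b: "bij_betw (T \<circ> ?f) {..<n} {1..n}" by (rule bij_betw_trans[OF fb bij])
  have "distinct (tableau_order n k T)"
    unfolding xs distinct_map using bij_betw_imp_inj_on[OF b] by (simp add: atLeast0LessThan)
  moreover have "set (tableau_order n k T) = {1..n}"
    unfolding xs set_map set_upt using bij_betw_imp_surj_on[OF b] by (simp add: atLeast0LessThan)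
  moreover have "if Suc i < k then tableau_order n k T ! Suc i < tableau_order n k T ! i
      else tableau_order n k T ! i < tableau_order n k T ! Suc i" if i: "Suc i < n" for i
  proof -
    consider "Suc i < k" | "Suc i = k" | "k \<le> i" by linarith
    then show ?thesis
    proof cases
      case 1
      then show ?thesis using i row[of 1 "k - Suc i" "k - i"] k by (simp add: tableau_order_def hook_cell_iff)
    next
      case 2
      \<comment> \<open>The turning point, where the corner cell is compared with the first cell of
        the leg.\<close>
      then show ?thesis using i col[of 1 1 2] k by (auto simp: tableau_order_def hook_cell_iff numeral_2_eq_2)
    next
      case 3
      then show ?thesis using i col[of "i - k + 2" 1 "Suc i - k + 2"] k
        by (auto simp: tableau_order_def hook_cell_iff)
    qed
  qed
  ultimately show ?thesis by (simp add: valley_orders_def)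
qed

lemma order_tableau_tableau_order:
  assumes T: "T \<in> SYT (hook n k)"
  shows "order_tableau n k (tableau_order n k T) = T"
proof
  fix c :: "nat \<times> nat"
  obtain i j where c: "c = (i, j)" by fastforce
  show "order_tableau n k (tableau_order n k T) c = T c"
  proof (cases "c \<in> diagram (hook n k)")
    case True
    then consider "i = 1" "1 \<le> j" "j \<le> k" | "2 \<le> i" "i \<le> Suc (n - k)" "j = 1"
      using c k by (auto simp: hook_cell_iff)
    then show ?thesis
    proof cases
      case 1
      then show ?thesis using True c k by (auto simp: order_tableau_def tableau_order_def)
    next
      case 2
      then have "k + i - 2 - k + 2 = i" by simp
      then show ?thesis using True 2 c k by (auto simp: order_tableau_def tableau_order_def)
    qed
  next
    case False
    then have "T c = undefined" using T extensional_arb[of T "diagram (hook n k)" c] by (simp add: SYT_def)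
    then show ?thesis using False by (simp add: order_tableau_def)
  qed
qed

lemma tableau_order_order_tableau:
  assumes xs: "xs \<in> valley_orders n k"
  shows "tableau_order n k (order_tableau n k xs) = xs"
proof (rule nth_equalityI)
  show "length (tableau_order n k (order_tableau n k xs)) = length xs"
    using valley_orders_length[OF xs] by (simp add: tableau_order_def)
  fix p assume "p < length (tableau_order n k (order_tableau n k xs))"
  then have p: "p < n" by (simp add: tableau_order_def)
  then show "tableau_order n k (order_tableau n k xs) ! p = xs ! p"
    using k by (auto simp: tableau_order_def order_tableau_def hook_cell_iff)
qed

lemma bij_betw_tableau_order: "bij_betw (tableau_order n k) (SYT (hook n k)) (valley_orders n k)"
  by (rule bij_betwI[of _ _ _ "order_tableau n k"])
     (auto simp: order_tableau_SYT tableau_order_valley order_tableau_tableau_order tableau_order_order_tableau)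

lemma row_of_eq:
  assumes T: "T \<in> SYT lam" and c: "(i, j) \<in> diagram lam"
  shows "row_of lam T (T (i, j)) = i"
  unfolding row_of_def
proof (rule the_equality)
  show "\<exists>j'. (i, j') \<in> diagram lam \<and> T (i, j') = T (i, j)" using c by blast
  fix i' assume "\<exists>j'. (i', j') \<in> diagram lam \<and> T (i', j') = T (i, j)"
  then obtain j' where j': "(i', j') \<in> diagram lam" "T (i', j') = T (i, j)" by blast
  have "inj_on T (diagram lam)" using T by (simp add: SYT_def bij_betw_def)
  then show "i' = i" using inj_onD[of T "diagram lam" "(i', j')" "(i, j)"] j' c by simp
qed

text \<open>Rows differ for all pairs except those in the first row, and there the reading in
  decreasing order agrees with the way in which \<open>eps\<close> decides ties.\<close>

lemma eps_row_of:
  assumes T: "T \<in> SYT (hook n k)" and u: "u \<in> {1..n}" and v: "v \<in> {1..n}"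
  shows "eps (row_of (hook n k) T) u v = eps (label_rank (tableau_order n k T)) u v"
proof -
  let ?xs = "tableau_order n k T"
  have xs: "?xs \<in> valley_orders n k" using tableau_order_valley[OF T] .
  have d: "distinct ?xs" "set ?xs = {1..n}" "length ?xs = n"
    using xs valley_orders_length[OF xs] by (auto simp: valley_orders_def)
  have row: "row_of (hook n k) T (?xs ! p) = (if p < k then 1 else p - k + 2)" if p: "p < n" for p
  proof (cases "p < k")
    case True
    then have "?xs ! p = T (1, k - p)" "(1, k - p) \<in> diagram (hook n k)"
      using p k by (auto simp: tableau_order_def hook_cell_iff)
    then show ?thesis using row_of_eq[OF T, of 1 "k - p"] True by simp
  next
    case False
    then have "?xs ! p = T (p - k + 2, 1)" "(p - k + 2, 1) \<in> diagram (hook n k)"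
      using p k by (auto simp: tableau_order_def hook_cell_iff)
    then show ?thesis using row_of_eq[OF T, of "p - k + 2" 1] False by simp
  qed
  define p where "p = label_rank ?xs u"
  define p' where "p' = label_rank ?xs v"
  have p: "p < n" "?xs ! p = u" and p': "p' < n" "?xs ! p' = v"
    using nth_label_rank[OF d(1), unfolded d(2,3)] u v by (auto simp: p_def p'_def)
  have rows: "row_of (hook n k) T u = (if p < k then 1 else p - k + 2)"
    "row_of (hook n k) T v = (if p' < k then 1 else p' - k + 2)" using row p p' by auto
  show ?thesis
  proof (cases p p' rule: linorder_cases)
    case less
    then have "p' < k \<Longrightarrow> v < u" using valley_orders_desc[OF xs less] p p' by simp
    then have "eps (row_of (hook n k) T) u v = 1" using less unfolding eps_def rows by auto
    moreover have "eps (label_rank ?xs) u v = 1" using less unfolding eps_def p_def[symmetric] p'_def[symmetric] by simp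
    ultimately show ?thesis by simp
  next
    case equal
    then have "u = v" using p p' by simp
    then show ?thesis by (simp add: eps_def)
  next
    case greater
    then have "p < k \<Longrightarrow> u < v" using valley_orders_desc[OF xs greater] p p' by simp
    then have "eps (row_of (hook n k) T) u v = -1" using greater unfolding eps_def rows by auto
    moreover have "eps (label_rank ?xs) u v = -1" using greater unfolding eps_def p_def[symmetric] p'_def[symmetric] by simp
    ultimately show ?thesis by simp
  qed
qed

end

section \<open>The hook coefficient\<close>

theorem hook_functional_web_LLT:
  assumes "annular_web w" "radial_cut w c" "1 \<le> k" "k \<le> n"
    and n: "n = sum_list (cut_thickness w c)"
  shows "hook_functional n k (web_LLT w c) = 1 / qfact_comp (cut_thickness w c) *
      (\<Sum>L\<in>SLD w c. \<Sum>T\<in>SYT (hook n k). qvar powi web_inv w c L (row_of (hook n k) T))"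
proof -
  interpret annular_web w by fact
  obtain m Y Z where "layered_web w c m Y Z" using layers_exist[OF assms(2)] .
  then interpret layered_web w c m Y Z .
  let ?P = "{xs. distinct xs \<and> set xs = labels w c}" and ?C = "1 / qfact_comp (cut_thickness w c)"
  have lab: "labels w c = {1..n}" by (simp add: labels_def n)
  have len: "length xs = n" if "xs \<in> ?P" for xs using that distinct_card[of xs] lab by auto
  have "finite ?P" by (rule finite_subset[OF _ finite_lists_length_eq[OF finite_labels, of n]]) (use len in auto)
  then have "hook_functional n k (web_LLT w c) = (\<Sum>xs | xs \<in> ?P \<and> valley k (\<lambda>u. n - u) xs.
      ?C * (\<Sum>L\<in>SLD w c. qvar powi web_inv w c L (label_rank xs)))"
    unfolding web_LLT_qsym n[symmetric] by (rule hook_functional_qsym[OF _ len assms(3,4)])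
  also have "{xs. xs \<in> ?P \<and> valley k (\<lambda>u. n - u) xs} = valley_orders n k"
  proof -
    have "valley k (\<lambda>u. n - u) xs \<longleftrightarrow>
        (\<forall>i. Suc i < n \<longrightarrow> (if Suc i < k then xs ! Suc i < xs ! i else xs ! i < xs ! Suc i))" if xs: "xs \<in> ?P" for xs
    proof -
      have "(n - xs ! i < n - xs ! Suc i \<longleftrightarrow> Suc i < k) \<longleftrightarrow>
          (if Suc i < k then xs ! Suc i < xs ! i else xs ! i < xs ! Suc i)" if i: "Suc i < n" for i
      proof -
        have "xs ! i \<in> set xs" "xs ! Suc i \<in> set xs" using i len[OF xs] by auto
        then have "xs ! i \<le> n" "xs ! Suc i \<le> n" using xs lab by auto
        moreover have "xs ! i \<noteq> xs ! Suc i" using xs i len[OF xs] by (simp add: nth_eq_iff_index_eq)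
        ultimately show ?thesis by auto
      qed
      then show ?thesis unfolding valley_def len[OF xs] by blast
    qed
    then show ?thesis unfolding valley_orders_def lab by blast
  qed
  also have "(\<Sum>xs\<in>valley_orders n k. ?C * (\<Sum>L\<in>SLD w c. qvar powi web_inv w c L (label_rank xs)))
      = (\<Sum>T\<in>SYT (hook n k). ?C * (\<Sum>L\<in>SLD w c. qvar powi web_inv w c L (label_rank (tableau_order n k T))))"
    by (rule sum.reindex_bij_betw[OF bij_betw_tableau_order[OF assms(3,4)], symmetric])
  also have "\<dots> = (\<Sum>T\<in>SYT (hook n k). ?C * (\<Sum>L\<in>SLD w c. qvar powi web_inv w c L (row_of (hook n k) T)))"
  proof (rule sum.cong[OF HOL.refl])
    fix T assume T: "T \<in> SYT (hook n k)"
    have "web_inv w c L (label_rank (tableau_order n k T)) = web_inv w c L (row_of (hook n k) T)" if "L \<in> SLD w c" for L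
      using eps_row_of[OF assms(3,4) T] unfolding lab by (intro web_inv_cong[OF that]) (simp add: lab)
    then show "?C * (\<Sum>L\<in>SLD w c. qvar powi web_inv w c L (label_rank (tableau_order n k T)))
        = ?C * (\<Sum>L\<in>SLD w c. qvar powi web_inv w c L (row_of (hook n k) T))" by simp
  qed
  also have "\<dots> = ?C * (\<Sum>L\<in>SLD w c. \<Sum>T\<in>SYT (hook n k). qvar powi web_inv w c L (row_of (hook n k) T))"
    unfolding sum_distrib_left[symmetric] by (subst sum.swap) simp
  finally show ?thesis .
qed

theorem theorem5p5:
  fixes w :: "'e web" and c :: real and n k :: nat
  assumes "annular_web w"
    and "has_degree w n"
    and "radial_cut w c"
    and "1 \<le> k" and "k \<le> n"
  shows "schur_coeff (web_LLT w c) (hook n k) =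
    1 / qfact_comp (cut_thickness w c) *
      (\<Sum>L\<in>SLD w c. \<Sum>T\<in>SYT (hook n k). qvar powi web_inv w c L (row_of (hook n k) T))"
proof -
  have n: "n = sum_list (cut_thickness w c)" using assms(2,3) by (simp add: has_degree_def)
  \<comment> \<open>Homogeneity confines the expansion to partitions of n, the only ones on which
    \<open>hook_functional_schur\<close> evaluates the functional.\<close>
  have "size M = n" if "web_LLT w c M \<noteq> 0" for M
  proof -
    interpret annular_web w by fact
    obtain m Y Z where "layered_web w c m Y Z" using layers_exist[OF assms(3)] .
    then interpret layered_web w c m Y Z .
    show ?thesis using that unfolding web_LLT_qsym n[symmetric] by (auto simp: qsym_def split: if_splits)
  qed
  then obtain a where a: "schur_expansion (web_LLT w c) a" "\<And>lam. a lam \<noteq> 0 \<Longrightarrow> lam \<in> partitions_of n"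
    using schur_expansion_exists[OF symmetric_web_LLT[OF assms(1,3)]] by metis
  have "(THE a. schur_expansion (web_LLT w c) a) = a"
    using a(1) schur_expansion_unique by (intro the_equality) blast+
  then have "schur_coeff (web_LLT w c) (hook n k) = a (hook n k)" by (simp add: schur_coeff_def)
  \<comment> \<open>The coefficient is written as a sum over the whole expansion so that the
    functional can be recognised in each term and then, by linearity, on the web LLT function
    itself.\<close>
  also have "\<dots> = (\<Sum>lam | a lam \<noteq> 0. a lam * of_bool (lam = hook n k))"
    using a(1) by (simp add: schur_expansion_def of_bool_def if_distrib cong: if_cong)
  also have "\<dots> = (\<Sum>lam | a lam \<noteq> 0. a lam * hook_functional n k (schur lam))"
    using a(2) hook_functional_schur[OF _ assms(4,5)] by (intro sum.cong) auto
  also have "\<dots> = (\<Sum>B\<in>Pow {k..<n}. \<Sum>lam | a lam \<noteq> 0. a lam *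
      ((- 1) ^ card ({k..<n} - B) * schur lam (mset (hook_content n B))))"
    unfolding hook_functional_def sum_distrib_left by (rule sum.swap)
  also have "\<dots> = hook_functional n k (web_LLT w c)"
    using a(1) by (simp add: hook_functional_def schur_expansion_def sum_distrib_left mult.left_commute)
  also have "\<dots> = 1 / qfact_comp (cut_thickness w c) *
      (\<Sum>L\<in>SLD w c. \<Sum>T\<in>SYT (hook n k). qvar powi web_inv w c L (row_of (hook n k) T))"
    by (rule hook_functional_web_LLT[OF assms(1,3,4,5) n])
  finally show ?thesis .
qed

end
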